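(* Let $(V,r)$ and $(V',r')$ be two pairs in $\mathbb{R}^d$, with $V=\{v_1,\dots,v_m\}$ and $V'=\{v'_1,\dots,v'_m\}$, such that $(V,r)$ is $\mathrm{BS}$-equivalent to $(V',r')$. Let $\mathcal{F}=\{F_1,\dots,F_m\}$ be an open (or closed) cover of a Hausdorff paracompact space $T$. Then $$[\mathcal{F}_{(V,r)}]=[\mathcal{F}_{(V',r')}]\quad\text{or}\quad [\mathcal{F}_{(V,r)}]=\mathrm{inv}([\mathcal{F}_{(V',r')}])$$ in $[T,S^{d-1}]$. In particular, $[\mathcal{F}_{(V,r)}]=0$ if and only if $[\mathcal{F}_{(V',r')}]=0$. If $T$ is a closed oriented manifold of dimension $d-1$, then $\deg(\mathcal{F}_{(V,r)})=\pm\deg(\mathcal{F}_{(V',r')})$.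
   Context: Pairs and balanced sets: a pair $(V,r)$ in $\mathbb{R}^d$ consists of a finite set $V=\{v_1,\dots,v_m\}\subset\mathbb{R}^d$ and a point $r\in\mathbb{R}^d$. A subset $S\subset V$ is $r$-balanced if $r\in\operatorname{conv}(S)$; $\mathrm{BS}(V,r)$ is the family of all $r$-balanced subsets. Pairs $(V,r)$ and $(V',r')$ are $\mathrm{BS}$-equivalent if for every set of indices, $\{v_{i_1},\dots,v_{i_k}\}\in\mathrm{BS}(V,r)\iff\{v'_{i_1},\dots,v'_{i_k}\}\in\mathrm{BS}(V',r')$. Covers: a cover $\mathcal{F}=\{F_1,\dots,F_m\}$ of $T$ has $F_i$ associated to the index $i$ (the point $v_i$, resp. $v'_i$). Its nerve $N(\mathcal{F})$ is the simplicial complex of all $\sigma\subset\{1,\dots,m\}$ with $\bigcap_{i\in\sigma}F_i\neq\emptyset$. A simplex $\sigma\in N(\mathcal{F})$ is $r$-balanced with respect to $(V,r)$ if $\{v_i : i\in\sigma\}$ is $r$-balanced. Homotopy class of a cover: let $\mathcal{F}$ be an open cover of $T$ with no $r$-balanced simplices in $N(\mathcal{F})$. Choose a partition of unity $\varphi_1,\dots,\varphi_m$ with $\operatorname{supp}\varphi_i\subset F_i$. With $\tau_r(y)=\frac{y-r}{\|y-r\|}$ for $y\ne r$, the map $g:T\to S^{d-1}$, $g(x)=\tau_r\big(\sum_i\varphi_i(x)v_i\big)$ is well defined and its homotopy class in $[T,S^{d-1}]$ is independent of the partition of unity; it is denoted $[\mathcal{F}_{(V,r)}]$. For a closed cover $\mathcal{C}$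 with no $r$-balanced simplices in $N(\mathcal{C})$, one puts $[\mathcal{C}_{(V,r)}]:=[\mathcal{U}_{(V,r)}]$ for any open cover $\mathcal{U}$ with $C_i\subset U_i$ for all $i$ and $N(\mathcal{U})$ isomorphic to $N(\mathcal{C})$ (such $\mathcal U$ exists and the class does not depend on its choice). If $N(\mathcal{F})$ contains an $r$-balanced simplex, the class is undefined, written $[\mathcal{F}_{(V,r)}]=N/A$; for $\mathrm{BS}$-equivalent pairs the classes are both defined or both undefined, and the theorem concerns the case where they are defined. $[\mathcal{F}_{(V,r)}]=0$ means null-homotopic. If $T$ is a closed oriented $(d-1)$-manifold, $\deg(\mathcal{F}_{(V,r)})$ is the mapping degree of a representative of $[\mathcal{F}_{(V,r)}]$. Involution: $\mathrm{inv}:[T,S^{d-1}]\to[T,S^{d-1}]$ is the map $[g]\mapsto[f\circ g]$, where $f:S^{d-1}\to S^{d-1}$ is a homotopy equivalence of degree $-1$. *)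

theory Defs
  imports "HOL-Analysis.Analysis" "HOL-Homology.Homology"
begin

text \<open>
  \<open>\<real>\<^sup>d\<close> is a Euclidean space \<open>'v\<close> with \<open>d = DIM('v)\<close>. Both point configurations
  \<open>V = {v\<^sub>1, \<dots>, v\<^sub>m}\<close> and covers \<open>F\<^sub>1, \<dots>, F\<^sub>m\<close> are families indexed by \<open>{1..m}\<close>; values at
  other indices play no role.
\<close>

section \<open>Balanced sets\<close>

definition r_balanced :: "'v::euclidean_space \<Rightarrow> 'v set \<Rightarrow> bool"
  where "r_balanced r S \<longleftrightarrow> r \<in> convex hull S"

definition BS :: "'v::euclidean_space set \<Rightarrow> 'v \<Rightarrow> 'v set set"
  where "BS V r = {S. S \<subseteq> V \<and> r_balanced r S}"

definition BS_equivalent ::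
    "nat \<Rightarrow> (nat \<Rightarrow> 'v::euclidean_space) \<Rightarrow> 'v \<Rightarrow> (nat \<Rightarrow> 'v) \<Rightarrow> 'v \<Rightarrow> bool"
  where "BS_equivalent m v r v' r' \<longleftrightarrow>
    (\<forall>I \<subseteq> {1..m}. v ` I \<in> BS (v ` {1..m}) r \<longleftrightarrow> v' ` I \<in> BS (v' ` {1..m}) r')"


section \<open>Covers and nerves\<close>

definition paracompact_space :: "'a topology \<Rightarrow> bool"
  where "paracompact_space X \<longleftrightarrow>
    (\<forall>\<U>. (\<forall>U \<in> \<U>. openin X U) \<and> \<Union>\<U> = topspace X \<longrightarrow>
      (\<exists>\<V>. (\<forall>V \<in> \<V>. openin X V) \<and> \<Union>\<V> = topspace X \<and>
        (\<forall>V \<in> \<V>. \<exists>U \<in> \<U>. V \<subseteq> U) \<and> locally_finite_in X \<V>))"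

definition open_cover :: "'a topology \<Rightarrow> nat \<Rightarrow> (nat \<Rightarrow> 'a set) \<Rightarrow> bool"
  where "open_cover T m F \<longleftrightarrow> (\<forall>i \<in> {1..m}. openin T (F i)) \<and> (\<Union>i \<in> {1..m}. F i) = topspace T"

definition closed_cover :: "'a topology \<Rightarrow> nat \<Rightarrow> (nat \<Rightarrow> 'a set) \<Rightarrow> bool"
  where "closed_cover T m F \<longleftrightarrow> (\<forall>i \<in> {1..m}. closedin T (F i)) \<and> (\<Union>i \<in> {1..m}. F i) = topspace T"

text \<open>Intersections are taken inside \<open>T\<close>, so that the empty intersection is \<open>T\<close>.\<close>

definition nerve :: "'a topology \<Rightarrow> nat \<Rightarrow> (nat \<Rightarrow> 'a set) \<Rightarrow> nat set set"
  where "nerve T m F = {\<sigma>. \<sigma> \<subseteq> {1..m} \<and> topspace T \<inter> (\<Inter>i \<in> \<sigma>. F i) \<noteq> {}}"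

definition no_balanced_simplex ::
    "'a topology \<Rightarrow> nat \<Rightarrow> (nat \<Rightarrow> 'a set) \<Rightarrow> (nat \<Rightarrow> 'v::euclidean_space) \<Rightarrow> 'v \<Rightarrow> bool"
  where "no_balanced_simplex T m F v r \<longleftrightarrow> (\<forall>\<sigma> \<in> nerve T m F. \<not> r_balanced r (v ` \<sigma>))"


section \<open>Homotopy classes of maps into the sphere\<close>

definition unit_sphere :: "'v::euclidean_space topology"
  where "unit_sphere = top_of_set (sphere 0 1)"

definition homotopy_class :: "'a topology \<Rightarrow> 'b topology \<Rightarrow> ('a \<Rightarrow> 'b) \<Rightarrow> ('a \<Rightarrow> 'b) set"
  where "homotopy_class X Y g = {h. homotopic_with (\<lambda>_. True) X Y g h}"

definition null_class :: "'a topology \<Rightarrow> ('a \<Rightarrow> 'v::euclidean_space) set \<Rightarrow> bool"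
  where "null_class T C \<longleftrightarrow>
    (\<exists>c \<in> topspace unit_sphere. C = homotopy_class T unit_sphere (\<lambda>_. c))"

definition homotopy_equivalence_map :: "'a topology \<Rightarrow> 'b topology \<Rightarrow> ('a \<Rightarrow> 'b) \<Rightarrow> bool"
  where "homotopy_equivalence_map X Y f \<longleftrightarrow>
    continuous_map X Y f \<and>
    (\<exists>g. continuous_map Y X g \<and>
      homotopic_with (\<lambda>_. True) X X (g \<circ> f) id \<and>
      homotopic_with (\<lambda>_. True) Y Y (f \<circ> g) id)"

text \<open>
  The analogue of \<^const>\<open>Brouwer_degree2\<close> for the unit sphere of \<open>'v\<close>. Reduced homology makes
  the definition correct for \<open>S\<^sup>0\<close> as well (the swap of the two points has degree \<open>-1\<close>).
\<close>

definition sphere_degree :: "('v::euclidean_space \<Rightarrow> 'v) \<Rightarrow> int"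
  where "sphere_degree f =
    (let n = int (DIM('v) - 1); G = reduced_homology_group n (unit_sphere :: 'v topology) in
      (THE k. \<forall>x \<in> carrier G. hom_induced n unit_sphere {} unit_sphere {} f x = x [^]\<^bsub>G\<^esub> k))"

text \<open>
  The map \<open>inv\<close>, \<open>[g] \<mapsto> [f \<circ> g]\<close>, for a given \<open>f\<close>. By Hopf's theorem the result is the same for
  all homotopy equivalences \<open>f\<close> of degree \<open>-1\<close>; statements about \<open>inv\<close> are made for every such \<open>f\<close>.
\<close>

definition inv_class ::
    "'a topology \<Rightarrow> ('v::euclidean_space \<Rightarrow> 'v) \<Rightarrow> ('a \<Rightarrow> 'v) set \<Rightarrow> ('a \<Rightarrow> 'v) set"
  where "inv_class T f C = (\<Union>g \<in> C. homotopy_class T unit_sphere (f \<circ> g))"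


section \<open>The homotopy class of a cover\<close>

definition partition_of_unity ::
    "'a topology \<Rightarrow> nat \<Rightarrow> (nat \<Rightarrow> 'a set) \<Rightarrow> (nat \<Rightarrow> 'a \<Rightarrow> real) \<Rightarrow> bool"
  where "partition_of_unity T m F \<phi> \<longleftrightarrow>
    (\<forall>i \<in> {1..m}. continuous_map T euclideanreal (\<phi> i) \<and>
      (\<forall>x \<in> topspace T. 0 \<le> \<phi> i x) \<and>
      T closure_of {x \<in> topspace T. \<phi> i x \<noteq> 0} \<subseteq> F i) \<and>
    (\<forall>x \<in> topspace T. (\<Sum>i = 1..m. \<phi> i x) = 1)"

definition radial_projection :: "'v::euclidean_space \<Rightarrow> 'v \<Rightarrow> 'v"
  where "radial_projection r y = (y - r) /\<^sub>R norm (y - r)"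

definition cover_map ::
    "nat \<Rightarrow> (nat \<Rightarrow> 'a \<Rightarrow> real) \<Rightarrow> (nat \<Rightarrow> 'v::euclidean_space) \<Rightarrow> 'v \<Rightarrow> 'a \<Rightarrow> 'v"
  where "cover_map m \<phi> v r x = radial_projection r (\<Sum>i = 1..m. \<phi> i x *\<^sub>R v i)"

text \<open>
  The classes below are meaningful when the nerve has no \<open>r\<close>-balanced simplex; otherwise
  they are unspecified (the value \<open>N/A\<close>). The descriptions express independence of the
  partition of unity, respectively of the open enlargement.
\<close>

definition open_cover_class ::
    "'a topology \<Rightarrow> nat \<Rightarrow> (nat \<Rightarrow> 'a set) \<Rightarrow> (nat \<Rightarrow> 'v::euclidean_space) \<Rightarrow> 'v \<Rightarrow> ('a \<Rightarrow> 'v) set"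
  where "open_cover_class T m F v r =
    (THE C. \<exists>\<phi>. partition_of_unity T m F \<phi> \<and> C = homotopy_class T unit_sphere (cover_map m \<phi> v r))"

text \<open>
  When \<open>F\<^sub>i \<subseteq> U\<^sub>i\<close> for all \<open>i\<close>, the nerve of \<open>F\<close> is a subcomplex of that of \<open>U\<close>; as both are
  finite, they are isomorphic exactly if they are equal.
\<close>

definition closed_cover_class ::
    "'a topology \<Rightarrow> nat \<Rightarrow> (nat \<Rightarrow> 'a set) \<Rightarrow> (nat \<Rightarrow> 'v::euclidean_space) \<Rightarrow> 'v \<Rightarrow> ('a \<Rightarrow> 'v) set"
  where "closed_cover_class T m F v r =
    (THE C. \<exists>U. open_cover T m U \<and> (\<forall>i \<in> {1..m}. F i \<subseteq> U i) \<and> nerve T m U = nerve T m F \<and>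
      C = open_cover_class T m U v r)"

definition cover_class ::
    "'a topology \<Rightarrow> nat \<Rightarrow> (nat \<Rightarrow> 'a set) \<Rightarrow> (nat \<Rightarrow> 'v::euclidean_space) \<Rightarrow> 'v \<Rightarrow> ('a \<Rightarrow> 'v) set"
  where "cover_class T m F v r =
    (if open_cover T m F then open_cover_class T m F v r else closed_cover_class T m F v r)"


section \<open>Closed oriented manifolds and the degree of a cover\<close>

definition closed_manifold :: "nat \<Rightarrow> 'a topology \<Rightarrow> bool"
  where "closed_manifold n X \<longleftrightarrow>
    compact_space X \<and> Hausdorff_space X \<and> second_countable X \<and>
    (\<forall>x \<in> topspace X. \<exists>U. openin X U \<and> x \<in> U \<and> subtopology X U homeomorphic_space Euclidean_space n)"

text \<open>
  A homological orientation: generators \<open>\<omega> x\<close> of \<open>H\<^sub>n(X, X - {x})\<close> which are locally the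
  restrictions of a single class in \<open>H\<^sub>n(X, X - U)\<close>.
\<close>

definition orientation :: "nat \<Rightarrow> 'a topology \<Rightarrow> ('a \<Rightarrow> 'a chain set) \<Rightarrow> bool"
  where "orientation n X \<omega> \<longleftrightarrow>
    (\<forall>x \<in> topspace X.
      (let G = relative_homology_group (int n) X (topspace X - {x}) in
        \<omega> x \<in> carrier G \<and> subgroup_generated G {\<omega> x} = G) \<and>
      (\<exists>U c. openin X U \<and> x \<in> U \<and>
        c \<in> carrier (relative_homology_group (int n) X (topspace X - U)) \<and>
        (\<forall>y \<in> U. hom_induced (int n) X (topspace X - U) X (topspace X - {y}) id c = \<omega> y)))"

text \<open>For a closed \<open>n\<close>-manifold the class described here exists and is unique.\<close>

definition fundamental_class :: "nat \<Rightarrow> 'a topology \<Rightarrow> ('a \<Rightarrow> 'a chain set) \<Rightarrow> 'a chain set"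
  where "fundamental_class n X \<omega> =
    (THE \<mu>. \<mu> \<in> carrier (homology_group (int n) X) \<and>
      (\<forall>x \<in> topspace X. hom_induced (int n) X {} X (topspace X - {x}) id \<mu> = \<omega> x))"

text \<open>
  The two orientations of \<open>S\<^sup>d\<^sup>-\<^sup>1\<close>. Reduced homology only matters for \<open>d = 1\<close>, where it singles
  out the orientations of \<open>S\<^sup>0\<close> as the boundary of an interval.
\<close>

definition sphere_generator :: "'v::euclidean_space chain set \<Rightarrow> bool"
  where "sphere_generator s \<longleftrightarrow>
    (let G = reduced_homology_group (int (DIM('v) - 1)) (unit_sphere :: 'v topology) in
      s \<in> carrier G \<and> subgroup_generated G {s} = G)"

definition mapping_degree ::
    "'a topology \<Rightarrow> ('a \<Rightarrow> 'a chain set) \<Rightarrow> 'v::euclidean_space chain set \<Rightarrow> ('a \<Rightarrow> 'v) \<Rightarrow> int"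
  where "mapping_degree T \<omega> s g =
    (let n = DIM('v) - 1 in
      (THE k. hom_induced (int n) T {} unit_sphere {} g (fundamental_class n T \<omega>) =
              s [^]\<^bsub>homology_group (int n) (unit_sphere :: 'v topology)\<^esub> k))"

definition cover_degree ::
    "'a topology \<Rightarrow> ('a \<Rightarrow> 'a chain set) \<Rightarrow> 'v::euclidean_space chain set \<Rightarrow>
      nat \<Rightarrow> (nat \<Rightarrow> 'a set) \<Rightarrow> (nat \<Rightarrow> 'v) \<Rightarrow> 'v \<Rightarrow> int"
  where "cover_degree T \<omega> s m F v r = mapping_degree T \<omega> s (SOME g. g \<in> cover_class T m F v r)"

end

theory Submission
  imports Defs
begin

text \<open>
  Put \<open>a i = v i - r\<close> and \<open>a' i = v' i - r'\<close>. A set \<open>\<sigma>\<close> of indices is unbalanced iff the origin is not in the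
  hull of \<open>{a i | i \<in> \<sigma>}\<close>, and by BS-equivalence \<open>a\<close> and \<open>a'\<close> have the same unbalanced sets. A partition of
  unity \<open>\<phi>\<close> of the cover has unbalanced supports, and the two classes are those of
  \<open>g x = sgn (\<Sum>i. \<phi> i x *\<^sub>R a i)\<close> and \<open>g' x = sgn (\<Sum>i. \<phi> i x *\<^sub>R a' i)\<close>. So everything is about these two maps.

  The link between them is the comparison map \<open>h y = sgn (\<Sum>i. max 0 (y \<bullet> a i) *\<^sub>R a' i)\<close>. Only indices with
  \<open>y \<bullet> a i > 0\<close> contribute; they form an unbalanced set for \<open>a\<close>, hence for \<open>a'\<close>, and the sum can vanish only if
  there is no such index. If the vectors \<open>a i\<close> positively span their linear span \<open>L\<close>, then \<open>h\<close> is defined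
  on the unit sphere of \<open>L\<close> and \<open>g'\<close> is homotopic to \<open>h \<circ> g\<close> (\<open>comparison_map_homotopic\<close>). Geometrically, the
  complex of unbalanced sets is the nerve of the cover of that sphere by the open hemispheres
  \<open>{y. 0 < y \<bullet> a i}\<close>, and \<open>h \<circ> g \<simeq> g'\<close> is the part of the nerve theorem that is needed.

  There are three cases (\<open>sphere_maps_dichotomy\<close>). If a hyperplane has all \<open>a i\<close> on one closed side, but not all
  on it, then the complex of unbalanced sets is a cone and both maps are null-homotopic. If \<open>a\<close> positively
  spans a proper subspace \<open>L\<close>, both maps factor up to homotopy through a sphere of lower dimension and
  again are null-homotopic. The same holds with \<open>a\<close> and \<open>a'\<close> exchanged. In the remaining case \<open>a\<close> and \<open>a'\<close>
  positively span the whole space, and the comparison maps in the two directions are inverse homotopy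
  equivalences of the sphere. They have degree \<open>1\<close> or \<open>-1\<close>, and it remains to know that a self-map of
  a sphere of degree \<open>1\<close> is homotopic to the identity; composing with the homotopy inverse of a map
  of degree \<open>-1\<close> settles the other sign (\<open>homotopy_equivalence_homotopic_id_or_reversing\<close>).

  This part of Hopf's theorem (\<open>degree_one_imp_homotopic_id\<close>) is proved by induction on the dimension. In
  dimension at least two, a map can be deformed until each pole has finitely many preimages, these can be
  moved into the northern and the southern hemisphere respectively, and then the map can be deformed to one
  that preserves both hemispheres. Such a map is, up to homotopy, the suspension of its restriction to
  the equator, which has the same degree. The induction starts with the circle, where the change of
  argument is a cochain that detects the degree.

  The classes of covers are independent of the choices in their definition because paracompact Hausdorff
  spaces are normal: partitions of unity exist, and finite closed covers have open enlargements with the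
  same nerve. Finally, a reflection \<open>\<rho>\<close> acts on the top homology of the sphere by inversion, so
  \<open>g \<simeq> \<rho> \<circ> g'\<close> gives opposite mapping degrees.
\<close>

section \<open>Straight-line homotopies of maps into spheres\<close>

abbreviation homotopic_maps :: "'a topology \<Rightarrow> 'b topology \<Rightarrow> ('a \<Rightarrow> 'b) \<Rightarrow> ('a \<Rightarrow> 'b) \<Rightarrow> bool"
  where "homotopic_maps X Y f g \<equiv> homotopic_with (\<lambda>_. True) X Y f g"

lemma continuous_map_scaleR:
  fixes v :: "'a \<Rightarrow> 'b::real_normed_vector"
  assumes "continuous_map X euclideanreal u" "continuous_map X euclidean v"
  shows "continuous_map X euclidean (\<lambda>x. u x *\<^sub>R v x)"
  using assms by (simp add: continuous_map_atin limitin_canonical_iff tendsto_scaleR)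

text \<open>
  The field \<open>v\<close> may be undefined or discontinuous where \<open>u\<close> vanishes: there boundedness is enough. This gives the
  continuity at the poles of maps described by a height and a direction along the equator.
\<close>

lemma continuous_map_scaleR_bounded:
  fixes v :: "'a \<Rightarrow> 'b::real_normed_vector"
  assumes u: "continuous_map X euclideanreal u"
    and v: "continuous_map (subtopology X {x. u x \<noteq> 0}) euclidean v"
    and B: "\<And>x. x \<in> topspace X \<Longrightarrow> norm (v x) \<le> B"
  shows "continuous_map X euclidean (\<lambda>x. u x *\<^sub>R v x)"
  unfolding continuous_map_def
proof (intro conjI allI impI)
  fix U :: "'b set"
  assume "openin euclidean U"
  then have U: "open U" by simp
  let ?W = "{x \<in> topspace X. u x \<noteq> 0}"
  have W: "openin X ?W"
    using openin_continuous_map_preimage [OF u, of "- {0}"] by (simp add: open_Compl)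
  have sub: "subtopology X {x. u x \<noteq> 0} = subtopology X ?W"
    by (metis subtopology_restrict Collect_conj_eq Collect_mem_eq)
  have "continuous_map (subtopology X ?W) euclidean (\<lambda>x. u x *\<^sub>R v x)"
    using continuous_map_scaleR [OF continuous_map_from_subtopology [OF u] v] by (simp only: sub)
  from openin_continuous_map_preimage [OF this] U
  have "openin (subtopology X ?W) {x \<in> topspace (subtopology X ?W). u x *\<^sub>R v x \<in> U}" by simp
  moreover have "{x \<in> topspace (subtopology X ?W). u x *\<^sub>R v x \<in> U} = {x \<in> ?W. u x *\<^sub>R v x \<in> U}"
    by auto
  ultimately have 1: "openin X {x \<in> ?W. u x *\<^sub>R v x \<in> U}"
    using openin_open_subtopology [OF W] by auto
  show "openin X {x \<in> topspace X. u x *\<^sub>R v x \<in> U}"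
  proof (cases "0 \<in> U")
    case False
    then have "{x \<in> topspace X. u x *\<^sub>R v x \<in> U} = {x \<in> ?W. u x *\<^sub>R v x \<in> U}" by auto
    with 1 show ?thesis by simp
  next
    case True
    then obtain e where e: "e > 0" "ball 0 e \<subseteq> U"
      using U open_contains_ball by blast
    define d where "d = e / (\<bar>B\<bar> + 1)"
    have "openin X {x \<in> topspace X. u x \<in> ball 0 d}"
      using openin_continuous_map_preimage [OF u, of "ball 0 d"] by simp
    moreover have "u x *\<^sub>R v x \<in> U" if "x \<in> topspace X" "u x \<in> ball 0 d" for x
    proof -
      have "norm (u x *\<^sub>R v x) \<le> \<bar>u x\<bar> * (\<bar>B\<bar> + 1)"
        using B [OF that(1)] by (auto intro: mult_left_mono)
      also have "\<dots> < e"
        using that(2) by (simp add: d_def pos_less_divide_eq)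
      finally show ?thesis using e by (auto simp: dist_norm)
    qed
    moreover have "d > 0" using e by (simp add: d_def)
    ultimately have "{x \<in> topspace X. u x *\<^sub>R v x \<in> U}
        = {x \<in> ?W. u x *\<^sub>R v x \<in> U} \<union> {x \<in> topspace X. u x \<in> ball 0 d}"
      by auto
    with openin_Un [OF 1 \<open>openin X {x \<in> topspace X. u x \<in> ball 0 d}\<close>] show ?thesis
      by simp
  qed
qed auto

lemma continuous_on_scaleR_bounded:
  fixes v :: "'a::topological_space \<Rightarrow> 'b::real_normed_vector"
  assumes "continuous_on S u" "continuous_on {x \<in> S. u x \<noteq> 0} v" "\<And>x. x \<in> S \<Longrightarrow> norm (v x) \<le> B"
  shows "continuous_on S (\<lambda>x. u x *\<^sub>R v x)"
proof -
  have "S \<inter> {x. u x \<noteq> 0} = {x \<in> S. u x \<noteq> 0}" by auto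
  then show ?thesis
    using continuous_map_scaleR_bounded [of "top_of_set S" u v B] assms
    by (simp add: subtopology_subtopology)
qed

lemma homotopic_withI:
  assumes "continuous_map (prod_topology (top_of_set {0..1::real}) X) Y h"
    and "\<And>x. x \<in> topspace X \<Longrightarrow> h (0, x) = f x" "\<And>x. x \<in> topspace X \<Longrightarrow> h (1, x) = g x"
  shows "homotopic_maps X Y f g"
  using assms by (subst homotopic_with) auto

text \<open>
  Radial projection of the straight-line homotopy. With a proper subspace \<open>L\<close> it yields homotopies inside
  great subspheres.
\<close>

lemma homotopic_sgn_segment:
  fixes P Q :: "'a \<Rightarrow> 'v::real_normed_vector"
  assumes L: "subspace L"
    and P: "continuous_map T euclidean P" "\<And>x. x \<in> topspace T \<Longrightarrow> P x \<in> L"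
    and Q: "continuous_map T euclidean Q" "\<And>x. x \<in> topspace T \<Longrightarrow> Q x \<in> L"
    and seg: "\<And>x. x \<in> topspace T \<Longrightarrow> 0 \<notin> closed_segment (P x) (Q x)"
  shows "homotopic_maps T (top_of_set (sphere 0 1 \<inter> L)) (\<lambda>x. sgn (P x)) (\<lambda>x. sgn (Q x))"
proof -
  let ?I = "prod_topology (top_of_set {0..1::real}) T"
  let ?k = "\<lambda>z. (1 - fst z) *\<^sub>R P (snd z) + fst z *\<^sub>R Q (snd z)"
  have f: "continuous_map ?I euclideanreal fst"
    using continuous_map_fst [of "top_of_set {0..1::real}" T] continuous_map_into_fulltopology by blast
  have s: "continuous_map ?I T snd" by (rule continuous_map_snd)
  have k: "continuous_map ?I euclidean ?k"
    using continuous_map_compose [OF s P(1)] continuous_map_compose [OF s Q(1)] f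
    by (intro continuous_map_add continuous_map_scaleR continuous_map_diff) (auto simp: o_def)
  have nz: "?k z \<noteq> 0" "?k z \<in> L" if "z \<in> topspace ?I" for z
  proof -
    have z: "snd z \<in> topspace T" "fst z \<in> {0..1}" using that by auto
    then have "?k z \<in> closed_segment (P (snd z)) (Q (snd z))"
      unfolding in_segment by auto
    with seg z show "?k z \<noteq> 0" by force
    show "?k z \<in> L" using P(2) Q(2) z L by (simp add: subspace_add subspace_scale)
  qed
  have "continuous_map ?I (top_of_set (sphere 0 1 \<inter> L)) (\<lambda>z. sgn (?k z))"
    unfolding continuous_map_in_subtopology
  proof (intro conjI)
    have sg: "continuous_map (top_of_set (- {0})) euclidean (sgn :: 'v \<Rightarrow> 'v)"
      using continuous_on_sgn [of "- {0}" "\<lambda>x::'v. x"] by simp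
    have "continuous_map ?I (top_of_set (- {0})) ?k"
      using k nz by (simp add: continuous_map_in_subtopology image_subset_iff Pi_iff)
    from continuous_map_compose [OF this sg]
    show "continuous_map ?I euclidean (\<lambda>z. sgn (?k z))" by (simp add: o_def)
    show "(\<lambda>z. sgn (?k z)) \<in> topspace ?I \<rightarrow> sphere 0 1 \<inter> L"
    proof
      fix z assume "z \<in> topspace ?I"
      from nz [OF this] show "sgn (?k z) \<in> sphere 0 1 \<inter> L"
        using L by (auto simp: norm_sgn sgn_div_norm subspace_scale)
    qed
  qed
  then show ?thesis
    unfolding homotopic_with_def by (intro exI [of _ "\<lambda>z. sgn (?k z)"]) auto
qed

text \<open>
  A segment between unit vectors meets the origin only if they are antipodal.
\<close>

lemma homotopic_non_antipodal:
  fixes f g :: "'a \<Rightarrow> 'v::real_normed_vector"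
  assumes L: "subspace L"
    and f: "continuous_map T (top_of_set (sphere 0 1 \<inter> L)) f"
    and g: "continuous_map T (top_of_set (sphere 0 1 \<inter> L)) g"
    and na: "\<And>x. x \<in> topspace T \<Longrightarrow> f x \<noteq> - g x"
  shows "homotopic_maps T (top_of_set (sphere 0 1 \<inter> L)) f g"
proof -
  have fx: "norm (f x) = 1" "f x \<in> L" and gx: "norm (g x) = 1" "g x \<in> L" if "x \<in> topspace T" for x
    using f g that by (auto simp: continuous_map_in_subtopology Pi_iff)
  have "homotopic_maps T (top_of_set (sphere 0 1 \<inter> L)) (\<lambda>x. sgn (f x)) (\<lambda>x. sgn (g x))"
  proof (rule homotopic_sgn_segment [OF L])
    fix x assume x: "x \<in> topspace T"
    show "0 \<notin> closed_segment (f x) (g x)"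
    proof
      assume "0 \<in> closed_segment (f x) (g x)"
      then obtain t where t: "0 \<le> t" "t \<le> 1" "(1 - t) *\<^sub>R f x = - (t *\<^sub>R g x)"
        by (auto simp: in_segment eq_neg_iff_add_eq_0)
      then have "norm ((1 - t) *\<^sub>R f x) = norm (t *\<^sub>R g x)" by simp
      with fx(1) [OF x] gx(1) [OF x] have "\<bar>1 - t\<bar> = \<bar>t\<bar>" by simp
      then have "t = 1/2" using t(1,2) by linarith
      with t(3) have "(1/2) *\<^sub>R f x = (1/2) *\<^sub>R (- g x)" by simp
      then have "f x = - g x" by (rule scaleR_left_imp_eq [rotated]) simp
      with na x show False by simp
    qed
  next
    show "continuous_map T euclidean f" "continuous_map T euclidean g"
      using f g by (simp_all add: continuous_map_in_subtopology)
  qed (simp_all add: fx gx)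
  then show ?thesis
    by (rule homotopic_with_eq) (simp_all add: sgn_div_norm fx(1) gx(1))
qed

lemma subspace_orthogonal_to:
  fixes N :: "'v::real_inner"
  assumes "subspace L"
  shows "subspace {y \<in> L. y \<bullet> N = 0}"
  using assms unfolding subspace_def by (simp add: inner_add_left)

lemma aff_dim_subspace_orthogonal:
  fixes N :: "'v::euclidean_space"
  assumes L: "subspace L" and N: "N \<in> L" "norm N = 1"
  shows "aff_dim L = aff_dim {y \<in> L. y \<bullet> N = 0} + 1"
proof -
  define M where "M = {y \<in> L. y \<bullet> N = 0}"
  have M: "subspace M" unfolding M_def by (rule subspace_orthogonal_to [OF L])
  have NN: "N \<bullet> N = 1" using N by (simp add: dot_square_norm)
    have "dim (insert N M) = dim M + 1"
    proof -
      have "span M = M" using M by (simp add: span_eq_iff)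
      moreover have "N \<notin> M" using NN by (simp add: M_def)
      ultimately show ?thesis using dim_insert [of N M] by presburger
    qed
    moreover have "span (insert N M) = L"
    proof
      show "span (insert N M) \<subseteq> L" using L N by (intro span_minimal) (auto simp: M_def)
      show "L \<subseteq> span (insert N M)"
      proof
        fix y assume "y \<in> L"
        then have "y - (y \<bullet> N) *\<^sub>R N \<in> M"
          using L N NN by (simp add: M_def subspace_diff subspace_scale inner_diff_left)
        then have "(y - (y \<bullet> N) *\<^sub>R N) + (y \<bullet> N) *\<^sub>R N \<in> span (insert N M)"
          by (intro span_add span_scale) (auto intro: span_base)
        then show "y \<in> span (insert N M)" by simp
      qed
    qed
    ultimately show ?thesis
      unfolding M_def [symmetric] using L M by (metis aff_dim_subspace dim_span of_nat_1 of_nat_add)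
  qed

section \<open>Making the preimages of the poles finite\<close>

text \<open>
  Let \<open>E\<close> be the preimage of the equator orthogonal to \<open>N\<close>. Away from \<open>p\<close> the domain is a flat space \<open>M\<close> whose
  dimension is that of the ball bounded by the equator, so the map \<open>f\<close> from \<open>E\<close> to the equator extends to the
  complement of finitely many points of \<open>M\<close>. The new map uses this extension as direction along the
  equator and a height that has the sign of the height of \<open>f\<close> and is extremal only at the exceptional points
  and at \<open>p\<close>. It is nowhere antipodal to \<open>f\<close>: their heights can be opposite only on \<open>E\<close>, where the two maps
  agree.
\<close>

lemma finite_pole_preimages:
  fixes L :: "'v::euclidean_space set" and N :: 'v
  assumes L: "subspace L" and N: "N \<in> L" "norm N = 1"
    and f: "continuous_on (sphere 0 1 \<inter> L) f" "f \<in> sphere 0 1 \<inter> L \<rightarrow> sphere 0 1 \<inter> L"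
    and p: "p \<in> sphere 0 1 \<inter> L" "f p = N"
  obtains g where "homotopic_with_canon (\<lambda>_. True) (sphere 0 1 \<inter> L) (sphere 0 1 \<inter> L) f g"
    "finite {x \<in> sphere 0 1 \<inter> L. g x = N}" "finite {x \<in> sphere 0 1 \<inter> L. g x = - N}"
proof -
  define S where "S = sphere 0 1 \<inter> L"
  have cS: "compact S" unfolding S_def using L by (intro compact_Int_closed) (auto simp: closed_subspace)
  have NN: "N \<bullet> N = 1" using N by (simp add: dot_square_norm)
  define M where "M = {y \<in> L. y \<bullet> N = 0}"
  have M: "subspace M"
    using L unfolding M_def subspace_def by (simp add: inner_add_left)
  have dimM: "aff_dim L = aff_dim M + 1"
    unfolding M_def by (rule aff_dim_subspace_orthogonal [OF L N])
  obtain \<pi> \<rho> where hom: "homeomorphism (S - {p}) M \<pi> \<rho>"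
    using homeomorphic_punctured_affine_sphere_affine [of 1 p 0 L M] p L M dimM
    by (auto simp: S_def homeomorphic_def subspace_imp_affine subspace_0)
  have \<rho>\<pi>: "\<rho> (\<pi> x) = x" "\<pi> x \<in> M" if "x \<in> S" "x \<noteq> p" for x
    using hom that by (auto simp: homeomorphism_def)
  have \<pi>\<rho>: "\<pi> (\<rho> y) = y" "\<rho> y \<in> S" "\<rho> y \<noteq> p" if "y \<in> M" for y
  proof -
    show "\<pi> (\<rho> y) = y" by (rule homeomorphism_apply2 [OF hom that])
    have "\<rho> y \<in> S - {p}" using homeomorphism_image2 [OF hom] that by blast
    then show "\<rho> y \<in> S" "\<rho> y \<noteq> p" by auto
  qed
  define h0 where "h0 = (\<lambda>x. f x \<bullet> N)"
  have h0: "continuous_on S h0" unfolding h0_def by (intro continuous_intros) (use f S_def in auto)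
  have fS: "f x \<in> L" "norm (f x) = 1" if "x \<in> S" for x using f that by (auto simp: S_def)
  define E where "E = {x \<in> S. h0 x = 0}"
  have cE: "compact E"
    unfolding E_def by (metis cS closedin_compact continuous_closedin_preimage_constant h0)
  have pE: "p \<notin> E" using p NN by (auto simp: E_def h0_def)
  have ES: "E \<subseteq> S - {p}" using pE by (auto simp: E_def)
  let ?D = "cball 0 1 \<inter> M"
  have int0: "interior (cball (0::'v) 1) \<inter> M \<noteq> {}" using subspace_0 [OF M] by force
  have rf: "rel_frontier ?D = sphere 0 1 \<inter> M"
    using convex_affine_rel_frontier_Int [OF convex_cball subspace_imp_affine [OF M] int0]
    by (simp add: frontier_cball)
  have aD: "aff_dim ?D = aff_dim M"
    using aff_dim_convex_Int_nonempty_interior [OF subspace_imp_convex [OF M], of "cball 0 1"] int0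
    by (simp add: Int_commute)
  have Ein: "f x \<in> sphere 0 1 \<inter> M" if "x \<in> E" for x
    using that fS by (auto simp: E_def h0_def M_def)
  obtain K g where K: "finite K" "K \<subseteq> M" "disjnt K (\<pi> ` E)"
    and g: "continuous_on (M - K) g" "g \<in> M - K \<rightarrow> rel_frontier ?D"
    and gE: "\<And>y. y \<in> \<pi> ` E \<Longrightarrow> g y = (f \<circ> \<rho>) y"
  proof (rule extend_map_affine_to_sphere_cofinite_gen [of "\<pi> ` E" ?D M "f \<circ> \<rho>" UNIV])
    show "compact (\<pi> ` E)"
      using hom ES cE by (meson compact_continuous_image continuous_on_subset homeomorphism_cont1)
    have \<rho>E: "\<rho> ` (\<pi> ` E) = E"
      using \<rho>\<pi>(1) ES by (force simp: image_image)
    have "\<pi> ` E \<subseteq> M" using hom ES by (auto simp: homeomorphism_def)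
    then show "\<pi> ` E \<subseteq> M" .
    show "continuous_on (\<pi> ` E) (f \<circ> \<rho>)"
      using \<rho>E f ES hom \<open>\<pi> ` E \<subseteq> M\<close>
      by (intro continuous_on_compose) (auto intro: continuous_on_subset homeomorphism_cont2 simp: S_def)
    show "f \<circ> \<rho> \<in> \<pi> ` E \<rightarrow> rel_frontier ?D"
    proof
      fix z assume "z \<in> \<pi> ` E"
      then have "\<rho> z \<in> E" using \<rho>E by blast
      then show "(f \<circ> \<rho>) z \<in> rel_frontier ?D" using Ein by (simp add: rf)
    qed
    show "convex ?D" using M by (simp add: convex_Int subspace_imp_convex)
    show "bounded ?D" by (simp add: bounded_Int)
    show "affine M" using M by (rule subspace_imp_affine)
    show "aff_dim M \<le> aff_dim ?D" by (simp add: aD)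
    show "C \<inter> UNIV \<noteq> {}" if "C \<in> components (M - \<pi> ` E)" for C
      using that in_components_nonempty by auto
  qed (auto simp: that)
  \<comment> \<open>The puncture joins the exceptional points: the extension says nothing about it.\<close>
  define K' where "K' = insert p (\<rho> ` K)"
  have K': "finite K'" "K' \<subseteq> S" "K' \<inter> E = {}"
  proof -
    show "finite K'" using K by (simp add: K'_def)
    show "K' \<subseteq> S" using K(2) \<pi>\<rho>(2) p by (auto simp: K'_def S_def)
    have "\<rho> y \<notin> E" if "y \<in> K" for y
    proof
      assume "\<rho> y \<in> E"
      then have "\<pi> (\<rho> y) \<in> \<pi> ` E" by simp
      moreover have "\<pi> (\<rho> y) = y" using \<pi>\<rho>(1) K that by auto
      ultimately show False using K(3) that by (auto simp: disjnt_def)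
    qed
    then show "K' \<inter> E = {}" using pE by (auto simp: K'_def)
  qed
  have \<pi>K: "\<pi> x \<in> M - K" if "x \<in> S - K'" for x
    using that \<rho>\<pi> [of x] by (auto simp: K'_def) (metis image_eqI)
  define e where "e = g \<circ> \<pi>"
  have ce: "continuous_on (S - K') e"
    unfolding e_def
  proof (rule continuous_on_compose)
    show "continuous_on (S - K') \<pi>"
      using hom by (rule continuous_on_subset [OF homeomorphism_cont1]) (auto simp: K'_def)
    show "continuous_on (\<pi> ` (S - K')) g"
      using g(1) by (rule continuous_on_subset) (use \<pi>K in auto)
  qed
  have eM: "e x \<in> M" "norm (e x) = 1" if "x \<in> S - K'" for x
    using g(2) \<pi>K [OF that] rf by (auto simp: e_def)
  have eE: "e x = f x" if "x \<in> E" for x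
    using gE [of "\<pi> x"] that \<rho>\<pi>(1) [of x] ES by (auto simp: e_def subset_iff)
  define \<delta> where "\<delta> = (\<lambda>x. infdist x K')"
  have \<delta>: "continuous_on S \<delta>" unfolding \<delta>_def by (intro continuous_intros)
  have \<delta>0: "\<delta> x = 0 \<longleftrightarrow> x \<in> K'" "\<delta> x \<ge> 0" for x
    using K'(1) in_closed_iff_infdist_zero [of K'] by (auto simp: \<delta>_def finite_imp_closed K'_def infdist_nonneg)
  \<comment> \<open>Zero exactly on \<open>E\<close>, and \<open>1\<close> or \<open>-1\<close> exactly on \<open>K'\<close>, with the sign of \<open>h0\<close>.\<close>
  define h where "h = (\<lambda>x. h0 x / (\<bar>h0 x\<bar> + \<delta> x))"
  have pos: "\<bar>h0 x\<bar> + \<delta> x > 0" if "x \<in> S" for x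
    using \<delta>0 [of x] K'(3) that E_def by (cases "h0 x = 0") (auto simp: less_le)
  have ch: "continuous_on S h"
    unfolding h_def by (intro continuous_intros h0 \<delta>) (use pos in force)
  have habs: "\<bar>h x\<bar> = \<bar>h0 x\<bar> / (\<bar>h0 x\<bar> + \<delta> x)" if "x \<in> S" for x
    using pos [OF that] by (simp add: h_def)
  have h1: "\<bar>h x\<bar> \<le> 1" "\<bar>h x\<bar> = 1 \<longleftrightarrow> x \<in> K'" "sgn (h x) = sgn (h0 x)" if "x \<in> S" for x
    using pos [OF that] \<delta>0 [of x] habs [OF that] by (auto simp: h_def sgn_divide)
  define u where "u = (\<lambda>x. sqrt (1 - (h x)\<^sup>2))"
  have hsq: "(h x)\<^sup>2 \<le> 1" if "x \<in> S" for x using h1(1) [OF that] by (simp add: abs_square_le_1)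
  have u0: "u x = 0 \<longleftrightarrow> x \<in> K'" if "x \<in> S" for x
    using h1(2) [OF that] abs_square_eq_1 [of "h x"] by (auto simp: u_def abs_if power2_eq_1_iff split: if_splits)
  \<comment> \<open>The value \<open>0\<close> at the exceptional points is arbitrary, as \<open>u\<close> vanishes there.\<close>
  define w where "w = (\<lambda>x. if x \<in> K' then 0 else e x)"
  define k where "k = (\<lambda>x. u x *\<^sub>R w x + h x *\<^sub>R N)"
  have ck: "continuous_on S k"
    unfolding k_def
  proof (rule continuous_on_add [OF continuous_on_scaleR_bounded [where B = 1]])
    show "continuous_on S (\<lambda>x. h x *\<^sub>R N)" by (intro continuous_intros ch)
    show "continuous_on S u" unfolding u_def by (intro continuous_intros ch)
    have "continuous_on {x \<in> S. u x \<noteq> 0} e"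
      using ce by (rule continuous_on_subset) (use u0 in auto)
    then show "continuous_on {x \<in> S. u x \<noteq> 0} w"
      by (rule continuous_on_eq) (use u0 in \<open>auto simp: w_def\<close>)
    show "norm (w x) \<le> 1" if "x \<in> S" for x using eM that by (auto simp: w_def)
  qed
  have kN: "k x \<bullet> N = h x" if "x \<in> S" for x
    using eM(1) [of x] that NN by (auto simp: k_def w_def M_def inner_add_left)
  have kL: "k x \<in> L" if "x \<in> S" for x
    using eM(1) [of x] that L N by (auto simp: k_def w_def M_def subspace_add subspace_scale subspace_0)
  have kn: "norm (k x) = 1" if x: "x \<in> S" for x
  proof -
    have "(norm (k x))\<^sup>2 = (u x)\<^sup>2 * (norm (w x))\<^sup>2 + (h x)\<^sup>2"
    proof -
      have "w x \<bullet> N = 0" using eM(1) [of x] x by (auto simp: w_def M_def)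
      then show ?thesis
        using N(2) by (simp add: k_def norm_add_Pythagorean orthogonal_def power_mult_distrib)
    qed
    also have "\<dots> = 1"
    proof (cases "x \<in> K'")
      case True then show ?thesis using h1(2) [OF x] by (simp add: w_def abs_square_eq_1)
    next
      case False then show ?thesis using eM(2) [of x] x hsq [OF x] by (simp add: w_def u_def)
    qed
    finally show ?thesis by (simp add: abs_square_eq_1)
  qed
  have kpole: "x \<in> K'" if "x \<in> S" "k x = N \<or> k x = - N" for x
    using kN [OF that(1)] h1(2) [OF that(1)] that NN by auto
  have "homotopic_with_canon (\<lambda>_. True) S S f k"
    unfolding S_def
  proof (rule homotopic_non_antipodal [OF L])
    show "continuous_map (top_of_set (sphere 0 1 \<inter> L)) (top_of_set (sphere 0 1 \<inter> L)) f"
      using f by auto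
    show "continuous_map (top_of_set (sphere 0 1 \<inter> L)) (top_of_set (sphere 0 1 \<inter> L)) k"
      using ck kn kL by (auto simp: S_def)
    fix x assume "x \<in> topspace (top_of_set (sphere 0 1 \<inter> L))"
    then have x: "x \<in> S" by (simp add: S_def)
    show "f x \<noteq> - k x"
    proof
      assume eq: "f x = - k x"
      then have "h0 x = - h x" using kN [OF x] by (simp add: h0_def)
      then have "h x = 0" using h1(3) [OF x] by (auto simp: sgn_if split: if_splits)
      then have "x \<in> E" using \<open>h0 x = - h x\<close> x by (simp add: E_def)
      then have "k x = f x"
        using \<open>h x = 0\<close> K'(3) eE by (auto simp: k_def w_def u_def)
      then have "f x + f x = 0" using eq by (metis add.right_inverse)
      then show False using fS(2) [OF x] by (auto simp flip: scaleR_2)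
    qed
  qed
  moreover have "finite {x \<in> S. k x = N}" "finite {x \<in> S. k x = - N}"
    using kpole by (auto intro: finite_subset [OF _ K'(1)])
  ultimately show thesis using that unfolding S_def by blast
qed

section \<open>Making a self-map of a sphere preserve hemispheres\<close>

lemma inj_into_infinite:
  assumes "finite A" "infinite X"
  obtains f where "inj_on f A" "f ` A \<subseteq> X"
proof -
  obtain C where "finite C" "card C = card A" "C \<subseteq> X"
    using infinite_arbitrarily_large [OF assms(2)] by blast
  then obtain f where "bij_betw f A C"
    using finite_same_card_bij [OF assms(1), of C] by auto
  then show thesis using that \<open>C \<subseteq> X\<close> by (auto simp: bij_betw_def)
qed

text \<open>
  Puncturing the sphere at a point \<open>q\<close> outside \<open>A\<close> and \<open>B\<close> turns it into a flat space of dimension at least two.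
  There a homeomorphism that is the identity outside a bounded set moves the finitely many points to any
  prescribed places. By boundedness its inverse, and the straight-line homotopy from the identity to it,
  extend continuously over \<open>q\<close>; this inverse is \<open>\<phi>\<close>.
\<close>

lemma move_points_into_hemispheres:
  fixes L :: "'v::euclidean_space set" and N :: 'v
  assumes L: "subspace L" "3 \<le> dim L" and N: "N \<in> L" "norm N = 1"
    and AB: "finite A" "finite B" "A \<subseteq> sphere 0 1 \<inter> L" "B \<subseteq> sphere 0 1 \<inter> L" "A \<inter> B = {}"
  obtains \<phi> where "homotopic_with_canon (\<lambda>_. True) (sphere 0 1 \<inter> L) (sphere 0 1 \<inter> L) id \<phi>"
    "\<And>x. \<lbrakk>x \<in> sphere 0 1 \<inter> L; \<phi> x \<in> A\<rbrakk> \<Longrightarrow> 0 < x \<bullet> N"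
    "\<And>x. \<lbrakk>x \<in> sphere 0 1 \<inter> L; \<phi> x \<in> B\<rbrakk> \<Longrightarrow> x \<bullet> N < 0"
proof -
  define S where "S = sphere 0 1 \<inter> L"
  define M where "M = {y \<in> L. y \<bullet> N = 0}"
  have NN: "N \<bullet> N = 1" using N by (simp add: dot_square_norm)
  have M: "subspace M" unfolding M_def by (rule subspace_orthogonal_to [OF L(1)])
  have adM: "aff_dim L = aff_dim M + 1"
    unfolding M_def by (rule aff_dim_subspace_orthogonal [OF L(1) N])
  then have dM: "2 \<le> aff_dim M" using L by (simp add: aff_dim_subspace)
  obtain e where e: "e \<in> M" "norm e = 1"
  proof -
    have "M \<noteq> {0}" using dM by auto
    then obtain y where y: "y \<in> M" "y \<noteq> 0" using M subspace_0 by blast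
    show thesis
      by (rule that [of "sgn y"]) (use y M in \<open>auto simp: norm_sgn sgn_div_norm subspace_scale\<close>)
  qed
  \<comment> \<open>A half-circle of points of every height: both open hemispheres are infinite.\<close>
  define c where "c = (\<lambda>t. sqrt (1 - t\<^sup>2) *\<^sub>R e + t *\<^sub>R N)"
  have eN: "e \<bullet> N = 0" "e \<in> L" using e by (auto simp: M_def)
  have cN: "c t \<bullet> N = t" for t using eN NN by (simp add: c_def inner_add_left)
  have cS: "c t \<in> S" if "\<bar>t\<bar> < 1" for t
  proof -
    have "(norm (c t))\<^sup>2 = 1"
      using eN e N that by (simp add: c_def norm_add_Pythagorean orthogonal_def power_mult_distrib abs_square_le_1)
    then show ?thesis
      using L N eN by (simp add: S_def c_def abs_square_eq_1 subspace_add subspace_scale)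
  qed
  have injc: "inj c" by (metis cN injI)
  let ?U = "{x \<in> S. 0 < x \<bullet> N}" and ?V = "{x \<in> S. x \<bullet> N < 0}"
  have iU: "infinite ?U"
  proof
    assume "finite ?U"
    moreover have "c ` {0<..<1} \<subseteq> ?U" using cS cN by auto
    ultimately have "finite (c ` {0<..<1})" by (rule finite_subset [rotated])
    then have "finite {0<..<1::real}" using injc by (meson finite_imageD inj_on_subset subset_UNIV)
    then show False using infinite_Ioo [of "0::real" 1] by simp
  qed
  have iV: "infinite ?V"
  proof
    assume "finite ?V"
    moreover have "c ` {-1<..<0} \<subseteq> ?V" using cS cN by auto
    ultimately have "finite (c ` {-1<..<0})" by (rule finite_subset [rotated])
    then have "finite {-1<..<0::real}" using injc by (meson finite_imageD inj_on_subset subset_UNIV)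
    then show False using infinite_Ioo [of "-1::real" 0] by simp
  qed
  have "infinite (?U - (A \<union> B))" using iU AB by (simp add: Diff_infinite_finite)
  then obtain q where q: "q \<in> S" "q \<notin> A" "q \<notin> B"
    by (metis (no_types, lifting) Diff_iff Un_iff finite.emptyI equals0I mem_Collect_eq)
  obtain \<tau>A where \<tau>A: "inj_on \<tau>A A" "\<tau>A ` A \<subseteq> ?U - {q}"
    using inj_into_infinite [OF AB(1) infinite_remove [OF iU]] by metis
  obtain \<tau>B where \<tau>B: "inj_on \<tau>B B" "\<tau>B ` B \<subseteq> ?V - {q}"
    using inj_into_infinite [OF AB(2) infinite_remove [OF iV]] by metis
  define \<tau> where "\<tau> = (\<lambda>i. if i \<in> A then \<tau>A i else \<tau>B i)"
  have \<tau>a: "\<tau> i \<in> ?U - {q}" if "i \<in> A" for i using \<tau>A that by (auto simp: \<tau>_def)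
  have \<tau>b: "\<tau> i \<in> ?V - {q}" if "i \<in> B" for i using \<tau>B AB that by (auto simp: \<tau>_def)
  have \<tau>pos: "0 < \<tau> i \<bullet> N" if "i \<in> A" for i using \<tau>a [OF that] by simp
  have \<tau>neg: "\<tau> i \<bullet> N < 0" if "i \<in> B" for i using \<tau>b [OF that] by simp
  have inj\<tau>: "\<tau> i \<noteq> \<tau> j" if ij: "i \<in> A \<union> B" "j \<in> A \<union> B" "i \<noteq> j" for i j
  proof
    assume eq: "\<tau> i = \<tau> j"
    have inA: "i \<in> A \<longleftrightarrow> 0 < \<tau> i \<bullet> N" if "i \<in> A \<union> B" for i
      using that \<tau>pos [of i] \<tau>neg [of i] by fastforce
    have "i \<in> A \<longleftrightarrow> j \<in> A" using inA [OF ij(1)] inA [OF ij(2)] eq by simp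
    then consider "i \<in> A" "j \<in> A" | "i \<in> B" "j \<in> B" using ij by auto
    then show False
    proof cases
      case 1 then show ?thesis using eq \<tau>A(1) ij by (auto simp: \<tau>_def inj_on_def)
    next
      case 2
      then have "i \<notin> A" "j \<notin> A" using AB by auto
      with 2 show ?thesis using eq \<tau>B(1) ij by (auto simp: \<tau>_def inj_on_def)
    qed
  qed
  obtain \<pi> \<rho> where hom: "homeomorphism (S - {q}) M \<pi> \<rho>"
    using homeomorphic_punctured_affine_sphere_affine [of 1 q 0 L M] q L M adM
    by (auto simp: S_def homeomorphic_def subspace_imp_affine subspace_0)
  have \<rho>\<pi>: "\<rho> (\<pi> x) = x" "\<pi> x \<in> M" if "x \<in> S" "x \<noteq> q" for x
    using hom that by (auto simp: homeomorphism_def)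
  have \<pi>\<rho>: "\<pi> (\<rho> y) = y" "\<rho> y \<in> S" "\<rho> y \<noteq> q" if "y \<in> M" for y
  proof -
    show "\<pi> (\<rho> y) = y" by (rule homeomorphism_apply2 [OF hom that])
    have "\<rho> y \<in> S - {q}" using homeomorphism_image2 [OF hom] that by blast
    then show "\<rho> y \<in> S" "\<rho> y \<noteq> q" by auto
  qed
  have ABS: "i \<in> S" "i \<noteq> q" if "i \<in> A \<union> B" for i using that AB q by (auto simp: S_def)
  have \<tau>S: "\<tau> i \<in> S" "\<tau> i \<noteq> q" if "i \<in> A \<union> B" for i
    using that \<tau>a [of i] \<tau>b [of i] by auto
  have "\<exists>F G. homeomorphism M M F G \<and> (\<forall>i \<in> A \<union> B. F (\<pi> i) = \<pi> (\<tau> i)) \<and>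
               {x. \<not> (F x = x \<and> G x = x)} \<subseteq> M \<and> bounded {x. \<not> (F x = x \<and> G x = x)}"
  proof (rule homeomorphism_moving_points_exists_gen)
    show "pairwise (\<lambda>i j. \<pi> i \<noteq> \<pi> j \<and> \<pi> (\<tau> i) \<noteq> \<pi> (\<tau> j)) (A \<union> B)"
      unfolding pairwise_def by (metis ABS \<tau>S \<rho>\<pi>(1) inj\<tau>)
    show "\<pi> i \<in> M \<and> \<pi> (\<tau> i) \<in> M" if "i \<in> A \<union> B" for i
      using \<rho>\<pi>(2) ABS \<tau>S that by blast
    show "openin (top_of_set (affine hull M)) M" "M \<subseteq> affine hull M"
      by (simp_all add: hull_same [of affine M] subspace_imp_affine [OF M])
    show "connected M" using M by (simp add: subspace_imp_convex convex_connected)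
  qed (use AB dM in auto)
  then obtain F G where FG: "homeomorphism M M F G" "\<And>i. i \<in> A \<union> B \<Longrightarrow> F (\<pi> i) = \<pi> (\<tau> i)"
    and bd: "bounded {x. \<not> (F x = x \<and> G x = x)}" and sub: "{x. \<not> (F x = x \<and> G x = x)} \<subseteq> M"
    by blast
  have GM: "G y \<in> M" "F (G y) = y" if "y \<in> M" for y
    using FG(1) that by (auto simp: homeomorphism_def)
  define D where "D = closure {x. \<not> (F x = x \<and> G x = x)}"
  have D: "compact D" "D \<subseteq> M" "\<And>y. y \<notin> D \<Longrightarrow> G y = y"
  proof -
    show "compact D" using bd by (simp add: D_def)
    show "D \<subseteq> M" unfolding D_def using sub M by (simp add: closed_subspace closure_minimal)
    show "G y = y" if "y \<notin> D" for y using that unfolding D_def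
      by (metis (mono_tags, lifting) closure_subset mem_Collect_eq subsetD)
  qed
  have MG: "(1 - t) *\<^sub>R y + t *\<^sub>R G y \<in> M" if "y \<in> M" for t y
    using that GM M by (simp add: subspace_add subspace_scale)
  \<comment> \<open>Constant in time near \<open>q\<close>, because there \<open>G\<close> is the identity.\<close>
  define h where "h = (\<lambda>(t::real, x). if x = q then q else \<rho> ((1 - t) *\<^sub>R \<pi> x + t *\<^sub>R G (\<pi> x)))"
  let ?I = "{0..1::real}"
  let ?W = "?I \<times> (S - \<rho> ` D)" and ?P = "?I \<times> (S - {q})"
  have WP: "?W \<union> ?P = ?I \<times> S" using \<pi>\<rho>(3) D q by blast
  have "continuous_on (?W \<union> ?P) h"
  proof (rule continuous_on_Un_local_open)
    have "compact (\<rho> ` D)"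
      using compact_continuous_image [OF continuous_on_subset [OF homeomorphism_cont2 [OF hom]]] D by blast
    then have "openin (top_of_set S) (S - \<rho> ` D)"
      by (simp add: openin_diff closedin_closed_Int compact_imp_closed openin_open_Int Diff_eq open_Compl)
    then show "openin (top_of_set (?W \<union> ?P)) ?W"
      unfolding WP by (intro openin_Times) auto
    have "openin (top_of_set S) (S - {q})" by (simp add: openin_delete)
    then show "openin (top_of_set (?W \<union> ?P)) ?P"
      unfolding WP by (intro openin_Times) auto
    have "h z = snd z" if "z \<in> ?W" for z
    proof (cases "snd z = q")
      case False
      then have "\<pi> (snd z) \<notin> D" using that \<rho>\<pi>(1) [of "snd z"] by (metis DiffE image_eqI mem_Sigma_iff prod.collapse)
      then show ?thesis using that False \<rho>\<pi>(1) [of "snd z"] D(3)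
        by (auto simp: h_def case_prod_unfold simp flip: scaleR_add_left)
    qed (auto simp: h_def case_prod_unfold)
    then show "continuous_on ?W h"
      by (subst continuous_on_cong [OF refl, of ?W h snd]) (auto intro!: continuous_intros)
    have Pz: "\<pi> (snd z) \<in> M" if "z \<in> ?P" for z by (rule \<rho>\<pi>(2)) (use that in auto)
    have "continuous_on ?P (\<lambda>z. \<pi> (snd z))"
      by (rule continuous_on_compose2 [OF homeomorphism_cont1 [OF hom]]) (auto intro!: continuous_intros)
    moreover have "continuous_on ?P (\<lambda>z. G (\<pi> (snd z)))"
      by (rule continuous_on_compose2 [OF homeomorphism_cont2 [OF FG(1)] calculation]) (use Pz in blast)
    ultimately have "continuous_on ?P (\<lambda>z. (1 - fst z) *\<^sub>R \<pi> (snd z) + fst z *\<^sub>R G (\<pi> (snd z)))"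
      by (intro continuous_on_add continuous_on_scaleR) (auto intro!: continuous_intros)
    moreover have "(1 - fst z) *\<^sub>R \<pi> (snd z) + fst z *\<^sub>R G (\<pi> (snd z)) \<in> M" if "z \<in> ?P" for z
      using MG [OF Pz [OF that]] .
    ultimately have "continuous_on ?P (\<lambda>z. \<rho> ((1 - fst z) *\<^sub>R \<pi> (snd z) + fst z *\<^sub>R G (\<pi> (snd z))))"
      by (intro continuous_on_compose2 [OF homeomorphism_cont2 [OF hom]]) auto
    moreover have "h z = \<rho> ((1 - fst z) *\<^sub>R \<pi> (snd z) + fst z *\<^sub>R G (\<pi> (snd z)))" if "z \<in> ?P" for z
      using that by (cases z) (simp add: h_def)
    ultimately show "continuous_on ?P h" by (simp cong: continuous_on_cong)
  qed
  then have ch: "continuous_on (?I \<times> S) h" unfolding WP .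
  define \<phi> where "\<phi> = (\<lambda>x. h (1, x))"
  have "homotopic_with_canon (\<lambda>_. True) S S id \<phi>"
  proof (rule homotopic_withI)
    show "continuous_map (prod_topology (top_of_set ?I) (top_of_set S)) (top_of_set S) h"
      using ch \<pi>\<rho>(2) MG \<rho>\<pi>(2) q(1) by (auto simp: h_def)
  qed (use \<rho>\<pi> in \<open>auto simp: h_def \<phi>_def\<close>)
  moreover have key: "x = \<tau> i" if "x \<in> S" "\<phi> x = i" "i \<in> A \<union> B" for x i
  proof -
    have "x \<noteq> q" using that ABS(2) [of i] by (auto simp: \<phi>_def h_def)
    then have "i = \<rho> (G (\<pi> x))" using that by (simp add: \<phi>_def h_def)
    then have "\<pi> i = G (\<pi> x)" using \<pi>\<rho>(1) GM \<rho>\<pi>(2) \<open>x \<noteq> q\<close> that by simp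
    then have "\<pi> x = \<pi> (\<tau> i)" using FG(2) [OF that(3)] GM(2) \<rho>\<pi>(2) \<open>x \<noteq> q\<close> that(1) by metis
    then show ?thesis by (metis \<rho>\<pi>(1) \<open>x \<noteq> q\<close> that(1,3) \<tau>S)
  qed
  ultimately show thesis
  proof (intro that [of \<phi>])
    show "0 < x \<bullet> N" if "x \<in> sphere 0 1 \<inter> L" "\<phi> x \<in> A" for x
      using key [of x "\<phi> x"] \<tau>pos [OF that(2)] that by (simp add: S_def)
    show "x \<bullet> N < 0" if "x \<in> sphere 0 1 \<inter> L" "\<phi> x \<in> B" for x
      using key [of x "\<phi> x"] \<tau>neg [OF that(2)] that by (simp add: S_def)
  qed (simp add: S_def)
qed

text \<open>
  After composing with the map that moves the preimages, \<open>N\<close> is attained only in the open northern and \<open>- N\<close> only in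
  the open southern hemisphere. Now the height of the value can be replaced linearly by the height of the
  argument: the intermediate vectors could vanish only where the value is a pole, but there both heights
  have the same sign.
\<close>

lemma hemisphere_preserving_representative:
  fixes L :: "'v::euclidean_space set" and N :: 'v
  assumes L: "subspace L" "3 \<le> dim L" and N: "N \<in> L" "norm N = 1"
    and f: "continuous_on (sphere 0 1 \<inter> L) f" "f \<in> sphere 0 1 \<inter> L \<rightarrow> sphere 0 1 \<inter> L"
    and p: "p \<in> sphere 0 1 \<inter> L" "f p = N"
  obtains g where "homotopic_with_canon (\<lambda>_. True) (sphere 0 1 \<inter> L) (sphere 0 1 \<inter> L) f g"
    "\<And>x. x \<in> sphere 0 1 \<inter> L \<Longrightarrow> sgn (g x \<bullet> N) = sgn (x \<bullet> N)"
proof -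
  define S where "S = sphere 0 1 \<inter> L"
  have NN: "N \<bullet> N = 1" using N by (simp add: dot_square_norm)
  obtain f1 where f1: "homotopic_with_canon (\<lambda>_. True) S S f f1"
    and fin: "finite {x \<in> S. f1 x = N}" "finite {x \<in> S. f1 x = - N}"
    using finite_pole_preimages [OF L(1) N f p] unfolding S_def by blast
  have "N \<noteq> - N" using NN by (metis inner_minus_left one_neq_neg_one)
  then have dj: "{x \<in> S. f1 x = N} \<inter> {x \<in> S. f1 x = - N} = {}" by auto
  obtain \<phi> where \<phi>: "homotopic_with_canon (\<lambda>_. True) S S id \<phi>"
    and pos: "\<And>x. \<lbrakk>x \<in> S; \<phi> x \<in> {x \<in> S. f1 x = N}\<rbrakk> \<Longrightarrow> 0 < x \<bullet> N"
    and neg: "\<And>x. \<lbrakk>x \<in> S; \<phi> x \<in> {x \<in> S. f1 x = - N}\<rbrakk> \<Longrightarrow> x \<bullet> N < 0"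
    using move_points_into_hemispheres [OF L N fin] dj unfolding S_def
    by (metis (no_types, lifting) mem_Collect_eq subsetI)
  define f2 where "f2 = f1 \<circ> \<phi>"
  have cf1: "continuous_map (top_of_set S) (top_of_set S) f1"
    using f1 homotopic_with_imp_continuous_maps by blast
  have c\<phi>: "continuous_map (top_of_set S) (top_of_set S) \<phi>"
    using \<phi> homotopic_with_imp_continuous_maps by blast
  have hf2: "homotopic_with_canon (\<lambda>_. True) S S f f2"
  proof -
    have "homotopic_with_canon (\<lambda>_. True) S S (f1 \<circ> id) (f1 \<circ> \<phi>)"
      by (rule homotopic_with_compose_continuous_map_left [OF \<phi> cf1]) auto
    then show ?thesis using homotopic_with_trans [OF f1] by (simp add: f2_def)
  qed
  have cf2: "continuous_map (top_of_set S) (top_of_set S) f2"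
    using hf2 homotopic_with_imp_continuous_maps by blast
  then have f2S: "norm (f2 x) = 1" "f2 x \<in> L" if "x \<in> S" for x using that by (auto simp: S_def)
  have \<phi>S: "\<phi> x \<in> S" if "x \<in> S" for x using c\<phi> that by auto
  \<comment> \<open>The vector \<open>f2 x\<close> with its height replaced by the height of \<open>x\<close>.\<close>
  define Q where "Q = (\<lambda>x. f2 x + (x \<bullet> N - f2 x \<bullet> N) *\<^sub>R N)"
  have QN: "Q x \<bullet> N = x \<bullet> N" for x using NN by (simp add: Q_def inner_add_left)
  have seg: "0 \<notin> closed_segment (f2 x) (Q x)" if x: "x \<in> S" for x
  proof
    assume "0 \<in> closed_segment (f2 x) (Q x)"
    then obtain s where s: "0 \<le> s" "s \<le> 1" "0 = (1 - s) *\<^sub>R f2 x + s *\<^sub>R Q x"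
      by (auto simp: in_segment)
    then have s0: "f2 x = - ((s * (x \<bullet> N - f2 x \<bullet> N)) *\<^sub>R N)"
      by (simp add: Q_def algebra_simps eq_neg_iff_add_eq_0)
    define a where "a = f2 x \<bullet> N"
    have a: "f2 x = a *\<^sub>R N" unfolding a_def using s0 NN by (metis inner_scaleR_left mult.right_neutral scaleR_minus_left)
    then have "\<bar>a\<bar> = 1" using f2S(1) [OF x] N by simp
    then consider "a = 1" | "a = -1" by linarith
    then show False
    proof cases
      case 1
      then have "0 < x \<bullet> N" using pos [OF x] a \<phi>S [OF x] by (simp add: f2_def)
      moreover have "(1 - s) * a + s * (x \<bullet> N) = 0"
        using arg_cong [OF s(3), of "\<lambda>y. y \<bullet> N"] QN by (simp add: inner_add_left a_def)
      ultimately have XY: "s * (x \<bullet> N) + (1 - s) = 0" "0 < x \<bullet> N" using 1 by auto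
      moreover from XY have "0 \<le> s * (x \<bullet> N)" using s(1) by simp
      ultimately have "s = 1" using s(2) by linarith
      with XY show ?thesis by simp
    next
      case 2
      then have "x \<bullet> N < 0" using neg [OF x] a \<phi>S [OF x] by (simp add: f2_def)
      moreover have "(1 - s) * a + s * (x \<bullet> N) = 0"
        using arg_cong [OF s(3), of "\<lambda>y. y \<bullet> N"] QN by (simp add: inner_add_left a_def)
      ultimately have XY: "s * (- (x \<bullet> N)) + (1 - s) = 0" "0 < - (x \<bullet> N)" using 2 by auto
      moreover from XY have "0 \<le> s * (- (x \<bullet> N))" using s(1) by (intro mult_nonneg_nonneg) auto
      ultimately have "s = 1" using s(2) by linarith
      with XY show ?thesis by simp
    qed
  qed
  define g where "g = (\<lambda>x. sgn (Q x))"
  have "homotopic_with_canon (\<lambda>_. True) S S (\<lambda>x. sgn (f2 x)) g"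
    unfolding g_def S_def
  proof (rule homotopic_sgn_segment [OF L(1)])
    show c: "continuous_map (top_of_set (sphere 0 1 \<inter> L)) euclidean f2"
      using cf2 by (simp add: S_def)
    then show "continuous_map (top_of_set (sphere 0 1 \<inter> L)) euclidean Q"
      unfolding Q_def by (auto intro!: continuous_intros)
  qed (use seg f2S L N in \<open>auto simp: S_def Q_def subspace_add subspace_scale\<close>)
  then have "homotopic_with_canon (\<lambda>_. True) S S f2 g"
    by (rule homotopic_with_eq) (simp_all add: sgn_div_norm f2S)
  with hf2 have "homotopic_with_canon (\<lambda>_. True) S S f g" by (rule homotopic_with_trans)
  moreover have "sgn (g x \<bullet> N) = sgn (x \<bullet> N)" if x: "x \<in> S" for x
  proof -
    have "Q x \<noteq> 0" using seg [OF x] by auto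
    moreover have "g x \<bullet> N = inverse (norm (Q x)) * (x \<bullet> N)"
      by (simp add: g_def sgn_div_norm QN)
    ultimately show ?thesis by (simp add: sgn_mult)
  qed
  ultimately show thesis using that unfolding S_def by blast
qed

text \<open>
  The homotopy on the equator is suspended. Its suspension ends at the identity and starts at a map that agrees
  with \<open>g\<close> on the equator and has heights of the same sign elsewhere, so this map is nowhere antipodal to \<open>g\<close>.
\<close>

lemma homotopic_id_if_equator_homotopic_id:
  fixes L :: "'v::euclidean_space set" and N :: 'v
  assumes L: "subspace L" and N: "N \<in> L" "norm N = 1"
    and g: "continuous_map (top_of_set (sphere 0 1 \<inter> L)) (top_of_set (sphere 0 1 \<inter> L)) g"
    and sg: "\<And>x. x \<in> sphere 0 1 \<inter> L \<Longrightarrow> sgn (g x \<bullet> N) = sgn (x \<bullet> N)"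
    and eq: "homotopic_with_canon (\<lambda>_. True) (sphere 0 1 \<inter> {y \<in> L. y \<bullet> N = 0})
               (sphere 0 1 \<inter> {y \<in> L. y \<bullet> N = 0}) g id"
  shows "homotopic_with_canon (\<lambda>_. True) (sphere 0 1 \<inter> L) (sphere 0 1 \<inter> L) g id"
proof -
  define S where "S = sphere 0 1 \<inter> L"
  define E where "E = sphere 0 1 \<inter> {y \<in> L. y \<bullet> N = 0}"
  have NN: "N \<bullet> N = 1" using N by (simp add: dot_square_norm)
  let ?I = "{0..1::real}"
  obtain H where H: "continuous_on (?I \<times> E) H" "H ` (?I \<times> E) \<subseteq> E"
    and H0: "\<And>x. x \<in> E \<Longrightarrow> H (0, x) = g x" and H1: "\<And>x. x \<in> E \<Longrightarrow> H (1, x) = x"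
    using eq unfolding E_def [symmetric] homotopic_with_def by (auto simp: image_subset_iff)
  define x' where "x' = (\<lambda>x::'v. x - (x \<bullet> N) *\<^sub>R N)"
  have x'N: "x' x \<bullet> N = 0" "x' x + (x \<bullet> N) *\<^sub>R N = x" for x using NN by (simp_all add: x'_def inner_diff_left)
  have x'L: "x' x \<in> L" if "x \<in> L" for x using that L N by (simp add: x'_def subspace_diff subspace_scale)
  have x'E: "sgn (x' x) \<in> E" if "x \<in> L" "x' x \<noteq> 0" for x
    using that x'L x'N L by (auto simp: E_def norm_sgn sgn_div_norm subspace_scale)
  have nx': "(norm (x' x))\<^sup>2 + (x \<bullet> N)\<^sup>2 = (norm x)\<^sup>2" for x
    using norm_add_Pythagorean [of "x' x" "(x \<bullet> N) *\<^sub>R N"] x'N [of x] N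
    by (simp add: orthogonal_def)
  define w where "w = (\<lambda>z::real \<times> 'v. if x' (snd z) = 0 then 0 else H (fst z, sgn (x' (snd z))))"
  define K where "K = (\<lambda>z::real \<times> 'v. norm (x' (snd z)) *\<^sub>R w z + (snd z \<bullet> N) *\<^sub>R N)"
  have wE: "w z \<in> E" if "z \<in> ?I \<times> S" "x' (snd z) \<noteq> 0" for z
    using that H(2) x'E [of "snd z"] by (auto simp: w_def S_def image_subset_iff)
  have cx': "continuous_on A (\<lambda>z::real \<times> 'v. x' (snd z))" for A
    unfolding x'_def by (intro continuous_intros)
  have cK: "continuous_on (?I \<times> S) K"
    unfolding K_def
  proof (rule continuous_on_add [OF continuous_on_scaleR_bounded [where B = 1]])
    show "continuous_on (?I \<times> S) (\<lambda>z. norm (x' (snd z)))" by (intro continuous_intros cx')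
    show "continuous_on (?I \<times> S) (\<lambda>z. (snd z \<bullet> N) *\<^sub>R N)" by (intro continuous_intros)
    let ?A = "{z \<in> ?I \<times> S. norm (x' (snd z)) \<noteq> 0}"
    have "continuous_on ?A (\<lambda>z. H (fst z, sgn (x' (snd z))))"
      by (intro continuous_on_compose2 [OF H(1)] continuous_intros cx') (use x'E in \<open>auto simp: S_def\<close>)
    then show "continuous_on ?A w"
      by (rule continuous_on_eq) (auto simp: w_def)
    show "norm (w z) \<le> 1" if "z \<in> ?I \<times> S" for z
      using wE [OF that] by (cases "x' (snd z) = 0") (auto simp: w_def E_def)
  qed
  have KN: "K z \<bullet> N = snd z \<bullet> N" if "z \<in> ?I \<times> S" for z
    using wE [OF that] NN by (cases "x' (snd z) = 0") (auto simp: K_def E_def inner_add_left)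
  have KS: "K z \<in> S" if z: "z \<in> ?I \<times> S" for z
  proof -
    have s: "snd z \<in> L" "norm (snd z) = 1" using z by (auto simp: S_def)
    have wz: "w z \<in> L \<and> w z \<bullet> N = 0 \<and> (x' (snd z) \<noteq> 0 \<longrightarrow> norm (w z) = 1)"
    proof (cases "x' (snd z) = 0")
      case True then show ?thesis using subspace_0 [OF L] by (simp add: w_def)
    next
      case False then show ?thesis using wE [OF z] by (simp add: E_def)
    qed
    have "(norm (K z))\<^sup>2 = (norm (x' (snd z)))\<^sup>2 * (norm (w z))\<^sup>2 + (snd z \<bullet> N)\<^sup>2"
      using N(2) wz by (simp add: K_def norm_add_Pythagorean orthogonal_def power_mult_distrib)
    also have "\<dots> = (norm (x' (snd z)))\<^sup>2 + (snd z \<bullet> N)\<^sup>2"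
      using wz by (cases "x' (snd z) = 0") auto
    also have "\<dots> = 1" using nx' s by simp
    finally have "norm (K z) = 1" by (simp add: abs_square_eq_1)
    then show ?thesis using wz s L N by (simp add: S_def K_def subspace_add subspace_scale)
  qed
  have 1: "homotopic_with_canon (\<lambda>_. True) S S (\<lambda>x. K (0, x)) id"
  proof (rule homotopic_withI)
    show "continuous_map (prod_topology (top_of_set ?I) (top_of_set S)) (top_of_set S) K"
      using cK KS by auto
    show "K (1, x) = id x" if "x \<in> topspace (top_of_set S)" for x
    proof (cases "x' x = 0")
      case True then show ?thesis using x'N(2) [of x] by (simp add: K_def)
    next
      case False
      then have "w (1, x) = sgn (x' x)" using H1 [OF x'E] that by (simp add: w_def S_def)
      then show ?thesis using x'N(2) [of x] False by (simp add: K_def sgn_div_norm)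
    qed
  qed auto
  have 2: "homotopic_with_canon (\<lambda>_. True) S S g (\<lambda>x. K (0, x))"
    unfolding S_def
  proof (rule homotopic_non_antipodal [OF L g])
    have "continuous_map (top_of_set S) (top_of_set S) (\<lambda>x. K (0, x))"
      using homotopic_with_imp_continuous_maps [OF 1] by blast
    then show "continuous_map (top_of_set (sphere 0 1 \<inter> L)) (top_of_set (sphere 0 1 \<inter> L)) (\<lambda>x. K (0, x))"
      unfolding S_def .
    fix x assume "x \<in> topspace (top_of_set (sphere 0 1 \<inter> L))"
    then have x: "x \<in> S" by (simp add: S_def)
    show "g x \<noteq> - K (0, x)"
    proof
      assume gK: "g x = - K (0, x)"
      then have "g x \<bullet> N = - (x \<bullet> N)" using KN [of "(0, x)"] x by simp
      then have xN: "x \<bullet> N = 0" using sg [of x] x by (auto simp: S_def sgn_if split: if_splits)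
      then have xE: "x \<in> E" using x by (simp add: S_def E_def)
      have "x' x = x" using xN by (simp add: x'_def)
      moreover have "sgn x = x" "norm x = 1" "x \<noteq> 0" using x by (auto simp: S_def sgn_div_norm)
      ultimately have "K (0, x) = g x" using H0 [OF xE] xN by (simp add: K_def w_def)
      then have "g x + g x = 0" using gK by (metis add.right_inverse)
      moreover have "norm (g x) = 1" using g x by (auto simp: S_def)
      ultimately show False by (auto simp flip: scaleR_2)
    qed
  qed
  show ?thesis using homotopic_with_trans [OF 2 1] by (simp add: S_def)
qed

section \<open>Degree and suspension\<close>

text \<open>
  The suspension isomorphism is a composite of three maps: the boundary map of the pair (upper hemisphere,
  equator), the excision into the pair (sphere, lower hemisphere), and the map from the absolute homology of
  the sphere to the homology of the latter pair. All of them are natural for maps of these pairs.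
\<close>

lemma Brouwer_degree2_hemisphere_preserving:
  assumes cg: "continuous_map (nsphere (Suc n)) (nsphere (Suc n)) g"
    and up: "\<And>x. \<lbrakk>x \<in> topspace (nsphere (Suc n)); 0 \<le> x (Suc n)\<rbrakk> \<Longrightarrow> 0 \<le> g x (Suc n)"
    and lo: "\<And>x. \<lbrakk>x \<in> topspace (nsphere (Suc n)); x (Suc n) \<le> 0\<rbrakk> \<Longrightarrow> g x (Suc n) \<le> 0"
  shows "continuous_map (nsphere n) (nsphere n) g"
    and "Brouwer_degree2 (Suc n) g = Brouwer_degree2 n g"
proof -
  let ?S = "nsphere (Suc n)" and ?p = "int n"
  let ?U = "topspace ?S \<inter> {x. 0 \<le> x (Suc n)}" and ?D = "topspace ?S \<inter> {x. x (Suc n) \<le> 0}"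
    and ?E = "topspace ?S \<inter> {x. x (Suc n) = 0}"
  let ?sub = "subtopology ?S ?U"
  have gS: "g x \<in> topspace ?S" if "x \<in> topspace ?S" for x
    using cg that by (auto simp: continuous_map_def)
  have gU: "g \<in> ?U \<rightarrow> ?U" and gD: "g \<in> ?D \<rightarrow> ?D" using up lo gS by auto
  have gE: "g \<in> ?E \<rightarrow> ?E"
  proof
    fix x assume "x \<in> ?E"
    then show "g x \<in> ?E" using up [of x] lo [of x] gS by auto
  qed
  have eqn: "nsphere n = subtopology ?S ?E"
    using subtopology_nsphere_equator [of n] by (metis subtopology_restrict)
  have eqn2: "nsphere n = subtopology ?sub ?E"
  proof -
    have "?U \<inter> ?E = ?E" by auto
    then show ?thesis by (simp add: eqn subtopology_subtopology)
  qed
  show cgn: "continuous_map (nsphere n) (nsphere n) g"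
    unfolding eqn using gE
    by (auto simp: continuous_map_in_subtopology intro!: continuous_map_from_subtopology [OF cg])
  have cgs: "continuous_map ?sub ?sub g"
    using gU by (auto simp: continuous_map_in_subtopology intro!: continuous_map_from_subtopology [OF cg])
  let ?G = "reduced_homology_group ?p (nsphere n)"
  let ?G2 = "relative_homology_group (1 + ?p) ?sub ?E"
  let ?H2 = "relative_homology_group (1 + ?p) ?S ?D"
  let ?G1 = "reduced_homology_group (1 + ?p) ?S"
  let ?g = "hom_induced ?p (nsphere n) {} (nsphere n) {} g"
  let ?g1 = "hom_induced (1 + ?p) ?S {} ?S {} g"
  let ?r2 = "hom_induced (1 + ?p) ?sub ?E ?sub ?E g"
  let ?s2 = "hom_induced (1 + ?p) ?S ?D ?S ?D g"
  let ?bd = "hom_boundary (1 + ?p) ?sub ?E"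
  let ?inc = "hom_induced (1 + ?p) ?sub ?E ?S ?D id"
  let ?h = "hom_induced (1 + ?p) ?S {} ?S ?D id"
  have subU: "?sub = subtopology ?S {x. 0 \<le> x (Suc n)}" by (metis subtopology_restrict)
  have restE: "topspace ?sub \<inter> {x. x (Suc n) = 0} = ?E" by auto
  have iso_bd: "?bd \<in> iso ?G2 ?G"
    using iso_upper_hemisphere_reduced_homology_group [of ?p n]
    by (metis (no_types, lifting) hom_boundary_restrict relative_homology_group_restrict restE subU)
  have iso_inc: "?inc \<in> iso ?G2 ?H2"
    using iso_relative_homology_group_upper_hemisphere [of "1 + ?p" "Suc n" "Suc n"]
    by (metis (no_types, lifting) hom_induced_restrict relative_homology_group_restrict restE subU)
  have iso_h: "?h \<in> iso ?G1 ?H2"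
    using iso_reduced_homology_group_lower_hemisphere [of "Suc n" "Suc n" "1 + ?p"]
      hom_induced_restrict [of "1 + ?p" ?S "{}" ?S "{x. x (Suc n) \<le> 0}"]
      relative_homology_group_restrict [of "1 + ?p" ?S "{x. x (Suc n) \<le> 0}"]
    by simp
  have nat_bd: "?g (?bd c) = ?bd (?r2 c)" for c
    using naturality_hom_induced [OF cgs gE, of "1 + ?p"]
    by (simp add: fun_eq_iff flip: eqn2)
  have nat_inc: "?s2 (?inc c) = ?inc (?r2 c)" for c
  proof -
    have i: "continuous_map ?sub ?S id" "id \<in> ?E \<rightarrow> ?D"
      by (auto intro: continuous_map_from_subtopology)
    show ?thesis
      using hom_induced_compose' [OF i cg gD, of "1 + ?p" c]
        hom_induced_compose' [OF cgs gE i, of "1 + ?p" c] by simp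
  qed
  have nat_h: "?s2 (?h c) = ?h (?g1 c)" for c
  proof -
    have i: "continuous_map ?S ?S id" "id \<in> {} \<rightarrow> ?D" by auto
    show ?thesis
      using hom_induced_compose' [OF i cg gD, of "1 + ?p" c]
        hom_induced_compose' [OF cg _ i, of "{}" "1 + ?p" c] by simp
  qed
  show "Brouwer_degree2 (Suc n) g = Brouwer_degree2 n g"
  proof (rule Brouwer_degree2_unique [OF cg])
    fix c assume "c \<in> carrier (reduced_homology_group (int (Suc n)) ?S)"
    then have c: "c \<in> carrier ?G1" by (simp add: add.commute)
    let ?d = "Brouwer_degree2 n g"
    have hc: "?h c \<in> carrier ?H2" using iso_h c by (auto simp: iso_def hom_def)
    then have "?h c \<in> ?inc ` carrier ?G2" using iso_inc by (simp only: iso_iff)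
    then obtain b where b: "b \<in> carrier ?G2" "?inc b = ?h c" by auto
    have bdb: "?bd b \<in> carrier ?G" using iso_bd b(1) by (auto simp: iso_def hom_def)
    have hom_bd: "group_hom ?G2 ?G ?bd" and hom_inc: "group_hom ?G2 ?H2 ?inc" and hom_h: "group_hom ?G1 ?H2 ?h"
      using iso_bd iso_inc iso_h by (auto simp: group_hom_def group_hom_axioms_def iso_def)
    have r2b: "?r2 b \<in> carrier ?G2" by (rule hom_induced_carrier)
    have "?bd (?r2 b) = ?bd b [^]\<^bsub>?G\<^esub> ?d"
      using Brouwer_degree2 [OF bdb, of g] nat_bd [of b] by (simp only:)
    also have "\<dots> = ?bd (b [^]\<^bsub>?G2\<^esub> ?d)"
      using group_hom.hom_int_pow [OF hom_bd b(1)] by simp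
    finally have "?r2 b = b [^]\<^bsub>?G2\<^esub> ?d"
      using iso_bd r2b group.int_pow_closed [OF _ b(1)] by (simp add: iso_iff inj_on_def)
    then have "?h (?g1 c) = ?inc (b [^]\<^bsub>?G2\<^esub> ?d)"
      using nat_h [of c] nat_inc [of b] b(2) by simp
    also have "\<dots> = ?h c [^]\<^bsub>?H2\<^esub> ?d"
      using group_hom.hom_int_pow [OF hom_inc b(1)] b(2) by simp
    also have "\<dots> = ?h (c [^]\<^bsub>?G1\<^esub> ?d)"
      using group_hom.hom_int_pow [OF hom_h c] by simp
    finally have "?g1 c = c [^]\<^bsub>?G1\<^esub> ?d"
      using iso_h hom_induced_reduced [OF c, of ?S g] group.int_pow_closed [OF _ c]
      by (simp add: iso_iff inj_on_def)
    then show "hom_induced (int (Suc n)) ?S {} ?S {} g c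
        = c [^]\<^bsub>reduced_homology_group (int (Suc n)) ?S\<^esub> ?d"
      by (simp add: add.commute)
  qed
qed

section \<open>Self-maps of the circle\<close>

lemma homotopic_with_conjugate:
  assumes hm: "homeomorphic_maps X Y \<phi> \<psi>"
    and h: "homotopic_maps Y Y (\<phi> \<circ> f \<circ> \<psi>) (\<phi> \<circ> g \<circ> \<psi>)"
    and f: "continuous_map X X f" and g: "continuous_map X X g"
  shows "homotopic_maps X X f g"
proof -
  have c: "continuous_map X Y \<phi>" "continuous_map Y X \<psi>" and inv: "\<And>x. x \<in> topspace X \<Longrightarrow> \<psi> (\<phi> x) = x"
    using hm by (auto simp: homeomorphic_maps_def)
  have "homotopic_maps X Y ((\<phi> \<circ> f \<circ> \<psi>) \<circ> \<phi>) ((\<phi> \<circ> g \<circ> \<psi>) \<circ> \<phi>)"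
    by (rule homotopic_with_compose_continuous_map_right [OF h c(1)]) auto
  then have "homotopic_maps X X (\<psi> \<circ> ((\<phi> \<circ> f \<circ> \<psi>) \<circ> \<phi>)) (\<psi> \<circ> ((\<phi> \<circ> g \<circ> \<psi>) \<circ> \<phi>))"
    by (rule homotopic_with_compose_continuous_map_left [OF _ c(2)]) auto
  moreover have "f x \<in> topspace X" "g x \<in> topspace X" if "x \<in> topspace X" for x
    using f g that by (auto simp: continuous_map_def)
  ultimately show ?thesis
    by (elim homotopic_with_eq) (simp_all add: inv)
qed

text \<open>
  For paths in the unit circle, which have a lift \<open>\<theta>\<close>; the value does not depend on it.
\<close>

definition angle_change :: "(real \<Rightarrow> complex) \<Rightarrow> real"
  where "angle_change p =
    (SOME d. \<exists>\<theta>. continuous_on {0..1} \<theta> \<and> (\<forall>t\<in>{0..1}. p t = cis (\<theta> t)) \<and> d = \<theta> 1 - \<theta> 0)"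

text \<open>
  Two lifts differ by a continuous function with values in the multiples of \<open>2 * pi\<close>, which is constant.
\<close>

lemma angle_change_eq:
  assumes \<theta>: "continuous_on {0..1} \<theta>" "\<And>t. t \<in> {0..1} \<Longrightarrow> p t = cis (\<theta> t)"
  shows "angle_change p = \<theta> 1 - \<theta> 0"
  unfolding angle_change_def
proof (rule someI2_ex)
  fix d assume "\<exists>\<theta>. continuous_on {0..1} \<theta> \<and> (\<forall>t\<in>{0..1}. p t = cis (\<theta> t)) \<and> d = \<theta> 1 - \<theta> 0"
  then obtain \<eta> where \<eta>: "continuous_on {0..1} \<eta>" "\<And>t. t \<in> {0..1} \<Longrightarrow> p t = cis (\<eta> t)" "d = \<eta> 1 - \<eta> 0"
    by blast
  have "(\<lambda>t. \<eta> t - \<theta> t) constant_on {0..1}"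
  proof (rule continuous_discrete_range_constant)
    fix x :: real assume x: "x \<in> {0..1}"
    have int: "\<exists>n::int. \<eta> y - \<theta> y = 2 * pi * n" if "y \<in> {0..1}" for y
    proof -
      have "cis (\<eta> y) = cis (\<theta> y)" using \<eta>(2) \<theta>(2) that by simp
      then have "cis (\<eta> y - \<theta> y) = 1" by (simp flip: cis_divide)
      then have "cos (\<eta> y - \<theta> y) = 1" by (simp add: complex_eq_iff)
      then show ?thesis by (auto simp: cos_one_2pi_int mult_ac)
    qed
    show "\<exists>e>0. \<forall>y. y \<in> {0..1} \<and> \<eta> y - \<theta> y \<noteq> \<eta> x - \<theta> x \<longrightarrow> e \<le> norm (\<eta> y - \<theta> y - (\<eta> x - \<theta> x))"
    proof (intro exI [of _ "2 * pi"] conjI allI impI)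
      fix y assume y: "y \<in> {0..1} \<and> \<eta> y - \<theta> y \<noteq> \<eta> x - \<theta> x"
      obtain n k :: int where nk: "\<eta> x - \<theta> x = 2 * pi * n" "\<eta> y - \<theta> y = 2 * pi * k"
        using int x y by blast
      then have "n \<noteq> k" using y by auto
      then have "1 \<le> \<bar>real_of_int (k - n)\<bar>" by linarith
      then have "2 * pi * 1 \<le> 2 * pi * \<bar>real_of_int (k - n)\<bar>" by (intro mult_left_mono) auto
      also have "\<dots> = norm (\<eta> y - \<theta> y - (\<eta> x - \<theta> x))"
        unfolding nk by (simp add: abs_mult flip: right_diff_distrib)
      finally show "2 * pi \<le> norm (\<eta> y - \<theta> y - (\<eta> x - \<theta> x))" by simp
    qed simp
  qed (use \<theta> \<eta> in \<open>auto intro: continuous_intros\<close>)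
  then have "\<eta> 1 - \<theta> 1 = \<eta> 0 - \<theta> 0" by (force simp: constant_on_def)
  then show "d = \<theta> 1 - \<theta> 0" using \<eta> by simp
qed (use \<theta> in blast)

lemma cis_lift_exists:
  fixes F :: "'a::real_normed_vector \<Rightarrow> complex"
  assumes "continuous_on S F" "convex S" "\<And>x. x \<in> S \<Longrightarrow> norm (F x) = 1"
  obtains \<theta> where "continuous_on S \<theta>" "\<And>x. x \<in> S \<Longrightarrow> F x = cis (\<theta> x)"
proof -
  have "F x \<noteq> 0" if "x \<in> S" for x using assms(3) [OF that] by auto
  then obtain g where g: "continuous_on S g" "\<And>x. x \<in> S \<Longrightarrow> F x = exp (g x)"
    using continuous_logarithm_on_contractible [OF assms(1) convex_imp_contractible [OF assms(2)]] by metis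
  have "F x = cis (Im (g x))" if "x \<in> S" for x
  proof -
    have "exp (Re (g x)) = 1" using g(2) [OF that] assms(3) [OF that] by (metis norm_exp_eq_Re)
    then have "Re (g x) = 0" by simp
    then show ?thesis using g(2) [OF that] by (simp add: exp_eq_polar)
  qed
  moreover have "continuous_on S (\<lambda>x. Im (g x))" using g(1) by (intro continuous_intros)
  ultimately show thesis by (rule that [rotated])
qed

definition simplex_edge :: "real \<Rightarrow> nat \<Rightarrow> real"
  where "simplex_edge t = (\<lambda>i. if i = 0 then 1 - t else if i = 1 then t else 0)"

definition circle_complex :: "(nat \<Rightarrow> real) \<Rightarrow> complex"
  where "circle_complex x = Complex (x 0) (x 1)"

definition edge_angle :: "((nat \<Rightarrow> real) \<Rightarrow> nat \<Rightarrow> real) \<Rightarrow> real"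
  where "edge_angle \<sigma> = angle_change (\<lambda>t. circle_complex (\<sigma> (simplex_edge t)))"

text \<open>
  The linear extension of \<open>edge_angle\<close>, a cocycle that is \<open>2 * pi\<close> times a generator of the first cohomology of the circle.
\<close>

definition chain_angle :: "(nat \<Rightarrow> real) chain \<Rightarrow> real"
  where "chain_angle c = (\<Sum>\<sigma> \<in> Poly_Mapping.keys c. of_int (Poly_Mapping.lookup c \<sigma>) * edge_angle \<sigma>)"

lemma chain_angle_superset:
  assumes "finite A" "Poly_Mapping.keys c \<subseteq> A"
  shows "chain_angle c = (\<Sum>\<sigma> \<in> A. of_int (Poly_Mapping.lookup c \<sigma>) * edge_angle \<sigma>)"
  unfolding chain_angle_def
  by (rule sum.mono_neutral_left) (use assms in \<open>auto simp: in_keys_iff\<close>)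

lemma chain_angle_diff: "chain_angle (a - b) = chain_angle a - chain_angle b"
proof -
  let ?A = "Poly_Mapping.keys a \<union> Poly_Mapping.keys b"
  have "Poly_Mapping.keys (a - b) \<subseteq> ?A" by (rule keys_diff)
  then have "chain_angle (a - b) = (\<Sum>\<sigma> \<in> ?A. of_int (Poly_Mapping.lookup (a - b) \<sigma>) * edge_angle \<sigma>)"
    by (intro chain_angle_superset) auto
  also have "\<dots> = (\<Sum>\<sigma> \<in> ?A. of_int (Poly_Mapping.lookup a \<sigma>) * edge_angle \<sigma>)
      - (\<Sum>\<sigma> \<in> ?A. of_int (Poly_Mapping.lookup b \<sigma>) * edge_angle \<sigma>)"
    by (simp add: lookup_minus left_diff_distrib sum_subtractf)
  also have "\<dots> = chain_angle a - chain_angle b"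
    using chain_angle_superset [of ?A a] chain_angle_superset [of ?A b] by simp
  finally show ?thesis .
qed

lemma chain_angle_0 [simp]: "chain_angle 0 = 0" by (simp add: chain_angle_def)

lemma chain_angle_of [simp]: "chain_angle (frag_of \<sigma>) = edge_angle \<sigma>"
  by (simp add: chain_angle_def)

lemma chain_angle_minus: "chain_angle (- a) = - chain_angle a"
  using chain_angle_diff [of 0 a] by simp

lemma chain_angle_add: "chain_angle (a + b) = chain_angle a + chain_angle b"
  using chain_angle_diff [of a "- b"] by (simp add: chain_angle_minus)

lemma topspace_nsphere_1_circle:
  "x \<in> topspace (nsphere 1) \<longleftrightarrow> norm (circle_complex x) = 1 \<and> (\<forall>i>1. x i = 0)"
  by (auto simp: nsphere circle_complex_def cmod_def)

lemma continuous_map_circle_complex: "continuous_map (nsphere 1) euclidean circle_complex"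
proof -
  have "continuous_map (nsphere 1) euclidean (\<lambda>x. x 0 *\<^sub>R 1 + x 1 *\<^sub>R \<i>)"
    by (simp add: continuous_map_atin limitin_canonical_iff)
       (intro ballI tendsto_intros, use continuous_map_nsphere_projection in \<open>auto simp: continuous_map_atin limitin_canonical_iff\<close>)
  moreover have "(\<lambda>x. x 0 *\<^sub>R 1 + x 1 *\<^sub>R \<i>) = circle_complex"
    by (auto simp: circle_complex_def complex_eq_iff)
  ultimately show ?thesis by simp
qed

lemma simplex_param_continuous:
  fixes w :: "'a::real_normed_vector \<Rightarrow> nat \<Rightarrow> real"
  assumes \<sigma>: "singular_simplex p (nsphere 1) \<sigma>"
    and w: "\<And>i. continuous_on S (\<lambda>z. w z i)" "\<And>z. z \<in> S \<Longrightarrow> w z \<in> standard_simplex p"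
  shows "continuous_on S (\<lambda>z. circle_complex (\<sigma> (w z)))"
    and "\<And>z. z \<in> S \<Longrightarrow> norm (circle_complex (\<sigma> (w z))) = 1"
proof -
  have "continuous_map (top_of_set S) (subtopology (powertop_real UNIV) (standard_simplex p)) w"
    using w by (auto simp: continuous_map_in_subtopology continuous_map_componentwise_UNIV)
  moreover have \<sigma>c: "continuous_map (subtopology (powertop_real UNIV) (standard_simplex p)) (nsphere 1) \<sigma>"
    using \<sigma> by (simp add: singular_simplex_def)
  ultimately have 1: "continuous_map (top_of_set S) (nsphere 1) (\<sigma> \<circ> w)"
    by (rule continuous_map_compose)
  from continuous_map_compose [OF 1 continuous_map_circle_complex]
  show "continuous_on S (\<lambda>z. circle_complex (\<sigma> (w z)))" by (simp add: o_def)
  have "(\<sigma> \<circ> w) z \<in> topspace (nsphere 1)" if "z \<in> S" for z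
    using 1 that by (auto simp: continuous_map_def)
  then show "norm (circle_complex (\<sigma> (w z))) = 1" if "z \<in> S" for z
    using that topspace_nsphere_1_circle by auto
qed

lemma simplex_edge_in: "t \<in> {0..1} \<Longrightarrow> simplex_edge t \<in> standard_simplex 1"
  by (auto simp: simplex_edge_def standard_simplex_def)

text \<open>
  The argument has a continuous choice on a whole triangle, so the changes along the sides cancel.
\<close>

lemma edge_angle_boundary_triangle:
  assumes \<tau>: "singular_simplex 2 (nsphere 1) \<tau>"
  shows "edge_angle (singular_face 2 0 \<tau>) - edge_angle (singular_face 2 1 \<tau>)
       + edge_angle (singular_face 2 2 \<tau>) = 0"
proof -
  define \<Delta> where "\<Delta> = {z::real \<times> real. 0 \<le> fst z \<and> 0 \<le> snd z \<and> fst z + snd z \<le> 1}"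
  define w where "w = (\<lambda>(z::real \<times> real) i::nat. if i = 0 then 1 - fst z - snd z else if i = 1 then fst z
      else if i = 2 then snd z else 0)"
  have "convex \<Delta>"
  proof -
    have "\<Delta> = {z. inner (-1, 0) z \<le> 0} \<inter> {z. inner (0, -1) z \<le> 0} \<inter> {z. inner (1, 1) z \<le> 1}"
      by (auto simp: \<Delta>_def inner_prod_def)
    then show ?thesis by (simp only:) (intro convex_Int convex_halfspace_le)
  qed
  have wc: "continuous_on \<Delta> (\<lambda>z. w z i)" for i
    unfolding w_def by (cases "i = 0"; cases "i = 1"; cases "i = 2") (auto intro!: continuous_intros)
  have wS: "w z \<in> standard_simplex 2" if "z \<in> \<Delta>" for z
    using that by (auto simp: w_def \<Delta>_def standard_simplex_def numeral_2_eq_2)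
  obtain \<theta> where \<theta>: "continuous_on \<Delta> \<theta>" "\<And>z. z \<in> \<Delta> \<Longrightarrow> circle_complex (\<tau> (w z)) = cis (\<theta> z)"
    using cis_lift_exists [OF simplex_param_continuous(1) [OF \<tau> wc wS] \<open>convex \<Delta>\<close>
        simplex_param_continuous(2) [OF \<tau> wc wS]] by metis
  have side: "edge_angle (singular_face 2 k \<tau>) = \<theta> (c 1) - \<theta> (c 0)"
    if c: "continuous_on {0..1} c" "\<And>t. t \<in> {0..1} \<Longrightarrow> c t \<in> \<Delta>"
      and k: "\<And>t. t \<in> {0..1} \<Longrightarrow> simplical_face k (simplex_edge t) = w (c t)" for k c
    unfolding edge_angle_def
  proof (rule angle_change_eq)
    show "continuous_on {0..1} (\<lambda>t. \<theta> (c t))"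
      by (rule continuous_on_compose2 [OF \<theta>(1) c(1)]) (use c in auto)
    show "circle_complex (singular_face 2 k \<tau> (simplex_edge t)) = cis (\<theta> (c t))" if "t \<in> {0..1}" for t
      using \<theta>(2) [OF c(2)] k simplex_edge_in that by (simp add: singular_face_def)
  qed
  have "edge_angle (singular_face 2 0 \<tau>) = \<theta> (0, 1) - \<theta> (1, 0)"
    using side [of "\<lambda>t. (1 - t, t)" 0]
    by (force simp: \<Delta>_def w_def simplical_face_def simplex_edge_def fun_eq_iff intro!: continuous_intros)
  moreover have "edge_angle (singular_face 2 1 \<tau>) = \<theta> (0, 1) - \<theta> (0, 0)"
    using side [of "\<lambda>t. (0, t)" 1]
    by (force simp: \<Delta>_def w_def simplical_face_def simplex_edge_def fun_eq_iff intro!: continuous_intros)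
  moreover have "edge_angle (singular_face 2 2 \<tau>) = \<theta> (1, 0) - \<theta> (0, 0)"
    using side [of "\<lambda>t. (t, 0)" 2]
    by (force simp: \<Delta>_def w_def simplical_face_def simplex_edge_def fun_eq_iff intro!: continuous_intros)
  ultimately show ?thesis by simp
qed

lemma chain_angle_boundary:
  assumes "singular_chain 2 (nsphere 1) d"
  shows "chain_angle (chain_boundary 2 d) = 0"
proof -
  have "Poly_Mapping.keys d \<subseteq> singular_simplex_set 2 (nsphere 1)"
    using assms by (simp add: singular_chain_def)
  then show ?thesis
  proof (induction rule: frag_induction)
    case (one \<tau>)
    then show ?case
      using edge_angle_boundary_triangle [of \<tau>]
      by (simp add: chain_boundary_of numeral_2_eq_2 chain_angle_add chain_angle_diff)
  next
    case (diff a b)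
    then show ?case by (simp add: chain_boundary_diff chain_angle_diff)
  qed auto
qed

definition circle_point :: "real \<Rightarrow> nat \<Rightarrow> real"
  where "circle_point s = (\<lambda>i. if i = 0 then cos (2 * pi * s) else if i = 1 then sin (2 * pi * s) else 0)"

lemma circle_complex_point: "circle_complex (circle_point s) = cis (2 * pi * s)"
  by (simp add: circle_complex_def circle_point_def complex_eq_iff)

text \<open>
  The class of the loop \<open>c\<close> that runs once around the circle is fixed by \<open>f\<close>, so \<open>c\<close> and its image differ by a
  boundary, on which the cochain \<open>chain_angle\<close> vanishes.
\<close>

lemma degree_one_circle_lift:
  assumes f: "continuous_map (nsphere 1) (nsphere 1) f" and deg: "Brouwer_degree2 1 f = 1"
  obtains \<theta> where "continuous_on {0..1} \<theta>" "\<And>t. t \<in> {0..1} \<Longrightarrow> circle_complex (f (circle_point t)) = cis (\<theta> t)"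
    "\<theta> 1 - \<theta> 0 = 2 * pi"
proof -
  let ?X = "nsphere 1"
  define \<sigma> where "\<sigma> = restrict (\<lambda>x. circle_point (x 1)) (standard_simplex 1)"
  define c where "c = frag_of \<sigma>"
  have pt: "circle_point s \<in> topspace ?X" for s
    unfolding topspace_nsphere_1_circle circle_complex_point by (simp add: circle_point_def)
  have cont_pt: "continuous_map euclideanreal ?X circle_point"
    unfolding nsphere continuous_map_in_subtopology continuous_map_componentwise_UNIV
  proof (intro conjI allI)
    show "continuous_map euclideanreal euclideanreal (\<lambda>s. circle_point s k)" for k
      by (cases "k = 0"; cases "k = 1") (auto simp: circle_point_def intro!: continuous_intros)
    show "circle_point \<in> topspace euclideanreal \<rightarrow> {x. (\<Sum>i\<le>1. (x i)\<^sup>2) = 1 \<and> (\<forall>i>1. x i = 0)}"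
      using pt by (auto simp: nsphere)
  qed
  have "continuous_map (subtopology (powertop_real UNIV) (standard_simplex 1)) ?X (\<lambda>x. circle_point (x 1))"
  proof -
    have "continuous_map (subtopology (powertop_real UNIV) (standard_simplex 1)) euclideanreal (\<lambda>x. x 1)"
      by (intro continuous_map_from_subtopology continuous_map_product_projection) auto
    from continuous_map_compose [OF this cont_pt] show ?thesis by (simp add: o_def)
  qed
  then have \<sigma>: "singular_simplex 1 ?X \<sigma>"
    unfolding singular_simplex_def \<sigma>_def by (auto elim: continuous_map_eq)
  have edge_face: "simplical_face k x \<in> standard_simplex 1" if "x \<in> standard_simplex 0" "k \<le> 1" for k x
    using simplical_face_in_standard_simplex [of 1 k x] that by simp
  have face: "singular_face 1 0 \<sigma> = singular_face 1 1 \<sigma>"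
  proof
    fix x
    show "singular_face 1 0 \<sigma> x = singular_face 1 1 \<sigma> x"
    proof (cases "x \<in> standard_simplex 0")
      case True
      then have "x 0 = 1" by (simp add: standard_simplex_0)
      then have "circle_point (simplical_face 0 x 1) = circle_point (simplical_face 1 x 1)"
        by (simp add: simplical_face_def circle_point_def fun_eq_iff)
      moreover have "simplical_face 0 x \<in> standard_simplex 1" "simplical_face 1 x \<in> standard_simplex 1"
        using True edge_face by auto
      ultimately show ?thesis
        using True by (simp add: singular_face_def \<sigma>_def)
    qed (simp add: singular_face_def)
  qed
  have cyc: "singular_relcycle 1 ?X {} c"
    using face \<sigma> by (simp add: singular_cycle c_def singular_chain_of chain_boundary_of)
  have "homologous_rel_set 1 ?X {} c \<in> carrier (reduced_homology_group 1 ?X)"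
    using cyc carrier_relative_homology_group [of 1 ?X "{}"] by (auto simp: un_reduced_homology_group)
  from Brouwer_degree2 [of "homologous_rel_set 1 ?X {} c" 1 f] this
  have "homologous_rel_set 1 ?X {} (chain_map 1 f c) = homologous_rel_set 1 ?X {} c"
    using hom_induced_chain_map [OF f _ cyc, of "{}"] deg
    by (simp add: group.int_pow_1)
  then have "singular_relboundary 1 ?X {} (chain_map 1 f c - c)"
    unfolding homologous_rel_set_eq by (simp add: homologous_rel_def)
  then obtain d where "singular_chain 2 ?X d" "chain_boundary 2 d = chain_map 1 f c - c"
    by (auto simp: singular_boundary numeral_2_eq_2)
  then have eq: "edge_angle (simplex_map 1 f \<sigma>) = edge_angle \<sigma>"
    using chain_angle_boundary [of d] by (simp add: c_def chain_angle_diff)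
  have \<sigma>e: "\<sigma> (simplex_edge t) = circle_point t" if "t \<in> {0..1}" for t
    using simplex_edge_in [OF that] by (simp add: \<sigma>_def simplex_edge_def)
  have "edge_angle \<sigma> = (\<lambda>t. 2 * pi * t) 1 - (\<lambda>t. 2 * pi * t) 0"
    unfolding edge_angle_def
    by (rule angle_change_eq) (auto simp: \<sigma>e circle_complex_point intro!: continuous_intros)
  then have turn: "edge_angle \<sigma> = 2 * pi" by simp
  have "continuous_map euclideanreal euclidean (\<lambda>t. circle_complex (f (circle_point t)))"
    using continuous_map_compose [OF continuous_map_compose [OF cont_pt f] continuous_map_circle_complex]
    by (simp add: o_def)
  then have "continuous_on {0..1} (\<lambda>t. circle_complex (f (circle_point t)))"
    using continuous_on_subset by force
  moreover have "norm (circle_complex (f (circle_point t))) = 1" for t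
    using f pt topspace_nsphere_1_circle by (auto simp: continuous_map_def Pi_iff)
  ultimately obtain \<theta> where \<theta>: "continuous_on {0..1} \<theta>"
    "\<And>t. t \<in> {0..1} \<Longrightarrow> circle_complex (f (circle_point t)) = cis (\<theta> t)"
    using cis_lift_exists [of "{0..1::real}" "\<lambda>t. circle_complex (f (circle_point t))"] by auto
  have "edge_angle (simplex_map 1 f \<sigma>) = \<theta> 1 - \<theta> 0"
    unfolding edge_angle_def
    by (rule angle_change_eq [OF \<theta>(1)]) (simp add: simplex_map_def simplex_edge_in \<sigma>e \<theta>(2) del: One_nat_def)
  then show thesis using that \<theta> eq turn by simp
qed

text \<open>
  Interpolating linearly between the lift and \<open>\<lambda>t. 2 * pi * t\<close> gives closed loops throughout, since both
  increase by the same amount.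
\<close>

lemma degree_one_circle_homotopic_id:
  assumes f: "continuous_map (nsphere 1) (nsphere 1) f" and deg: "Brouwer_degree2 1 f = 1"
  shows "homotopic_maps (nsphere 1) (nsphere 1) f id"
proof -
  define \<kappa> where "\<kappa> = (\<lambda>z i::nat. if i = 0 then Re z else if i = 1 then Im z else 0)"
  have hm: "homeomorphic_maps (nsphere 1) (top_of_set (sphere 0 1)) circle_complex \<kappa>"
    unfolding homeomorphic_maps_def
  proof (intro conjI ballI)
    show "continuous_map (nsphere 1) (top_of_set (sphere 0 1)) circle_complex"
      using continuous_map_circle_complex topspace_nsphere_1_circle
      by (auto simp: continuous_map_in_subtopology)
    have "continuous_map (top_of_set (sphere 0 1)) euclideanreal (\<lambda>z. \<kappa> z k)" for k
      by (cases "k = 0"; cases "k = 1") (auto simp: \<kappa>_def intro!: continuous_intros)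
    then show "continuous_map (top_of_set (sphere 0 1)) (nsphere 1) \<kappa>"
      unfolding nsphere
      by (auto simp: continuous_map_in_subtopology continuous_map_componentwise_UNIV \<kappa>_def cmod_def)
    show "\<kappa> (circle_complex x) = x" if "x \<in> topspace (nsphere 1)" for x
      using that unfolding topspace_nsphere_1_circle
      by (auto simp: \<kappa>_def circle_complex_def fun_eq_iff)
    show "circle_complex (\<kappa> z) = z" for z
      by (simp add: \<kappa>_def circle_complex_def)
  qed
  obtain \<theta> where \<theta>: "continuous_on {0..1} \<theta>"
    "\<And>t. t \<in> {0..1} \<Longrightarrow> circle_complex (f (circle_point t)) = cis (\<theta> t)" "\<theta> 1 - \<theta> 0 = 2 * pi"
    using degree_one_circle_lift [OF f deg] by blast
  let ?p = "\<lambda>t. cis (\<theta> t)" and ?q = "\<lambda>t. cis (2 * pi * t)"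
  have loops: "homotopic_loops (sphere 0 1) ?p ?q"
    unfolding homotopic_loops
  proof (intro exI conjI)
    let ?h = "\<lambda>z::real \<times> real. cis ((1 - fst z) * \<theta> (snd z) + fst z * (2 * pi * snd z))"
    have "continuous_on ({0..1} \<times> {0..1}) (\<lambda>z::real \<times> real. \<theta> (snd z))"
      by (rule continuous_on_compose2 [OF \<theta>(1)]) (auto intro!: continuous_intros)
    then show "continuous_on ({0..1} \<times> {0..1}) ?h"
      unfolding cis_conv_exp by (intro continuous_intros)
    have "cis ((1 - s) * \<theta> 1 + s * (2 * pi)) = cis ((1 - s) * \<theta> 0)" for s
    proof -
      have "(1 - s) * \<theta> 1 + s * (2 * pi) = (1 - s) * \<theta> 0 + 2 * pi"
        using \<theta>(3) by (simp add: algebra_simps)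
      then show ?thesis by (simp flip: cis_mult)
    qed
    then show "\<forall>t\<in>{0..1}. pathfinish (?h \<circ> Pair t) = pathstart (?h \<circ> Pair t)"
      by (simp add: pathfinish_def pathstart_def)
  qed auto
  have arg: "?q (Arg2pi z / (2 * pi)) = z" "Arg2pi z / (2 * pi) \<in> {0..1}" if "norm z = 1" for z
    using Arg2pi [of z] that by (auto simp: cis_conv_exp is_Arg_def)
  have "homotopic_with_canon (\<lambda>_. True) (sphere 0 1) (sphere 0 1)
      (?p \<circ> (\<lambda>z. Arg2pi z / (2 * pi))) (?q \<circ> (\<lambda>z. Arg2pi z / (2 * pi)))"
    by (rule homotopic_loops_imp_homotopic_circlemaps [OF loops])
  then have "homotopic_with_canon (\<lambda>_. True) (sphere 0 1) (sphere 0 1)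
      (circle_complex \<circ> f \<circ> \<kappa>) (circle_complex \<circ> id \<circ> \<kappa>)"
  proof (rule homotopic_with_eq)
    fix z :: complex assume "z \<in> topspace (top_of_set (sphere 0 1))"
    then have z: "norm z = 1" by simp
    have ck: "circle_complex (\<kappa> z) = z" by (simp add: \<kappa>_def circle_complex_def)
    have "\<kappa> z = circle_point (Arg2pi z / (2 * pi))"
    proof -
      have eq: "circle_complex (circle_point (Arg2pi z / (2 * pi))) = z"
        using arg(1) [OF z] by (simp only: circle_complex_point)
      have "circle_point (Arg2pi z / (2 * pi)) 0 = Re z" "circle_point (Arg2pi z / (2 * pi)) 1 = Im z"
        using arg_cong [OF eq, of Re] arg_cong [OF eq, of Im] unfolding circle_complex_def by simp_all
      then show ?thesis by (auto simp: \<kappa>_def circle_point_def fun_eq_iff)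
    qed
    then show "(circle_complex \<circ> f \<circ> \<kappa>) z = (?p \<circ> (\<lambda>z. Arg2pi z / (2 * pi))) z"
      using \<theta>(2) [OF arg(2) [OF z]] by simp
    show "(circle_complex \<circ> id \<circ> \<kappa>) z = (?q \<circ> (\<lambda>z. Arg2pi z / (2 * pi))) z"
      using arg(1) [OF z] ck by simp
  qed auto
  then show ?thesis
    by (rule homotopic_with_conjugate [OF hm]) (use f in auto)
qed

section \<open>Maps of degree one are homotopic to the identity\<close>

context
  fixes b :: "nat \<Rightarrow> 'v::euclidean_space"
  assumes b: "bij_betw b {..<DIM('v)} Basis"
begin

text \<open>
  The induction on the dimension runs over the spheres in coordinate spaces, on which the degree is defined, whereas the
  deformations above take place in subspaces of a Euclidean space. An enumeration of the basis translates.
\<close>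

definition coord_space :: "nat \<Rightarrow> 'v set"
  where "coord_space n = span (b ` {..n})"

definition nsphere_to_euclidean :: "nat \<Rightarrow> (nat \<Rightarrow> real) \<Rightarrow> 'v"
  where "nsphere_to_euclidean n x = (\<Sum>i\<le>n. x i *\<^sub>R b i)"

definition euclidean_to_nsphere :: "nat \<Rightarrow> 'v \<Rightarrow> nat \<Rightarrow> real"
  where "euclidean_to_nsphere n y = (\<lambda>i. if i \<le> n then y \<bullet> b i else 0)"

lemma inner_basis_enumeration: "\<lbrakk>i < DIM('v); j < DIM('v)\<rbrakk> \<Longrightarrow> b i \<bullet> b j = (if i = j then 1 else 0)"
proof -
  assume ij: "i < DIM('v)" "j < DIM('v)"
  then have "b i \<in> Basis" "b j \<in> Basis" using b by (auto simp: bij_betw_def)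
  moreover have "b i = b j \<longleftrightarrow> i = j" using b ij by (auto simp: bij_betw_def inj_on_def)
  ultimately show ?thesis by (auto simp: inner_Basis)
qed

lemma subspace_coord_space: "subspace (coord_space n)"
  by (simp add: coord_space_def)

lemma dim_coord_space:
  assumes "n < DIM('v)"
  shows "dim (coord_space n) = Suc n"
proof -
  have sub: "b ` {..n} \<subseteq> Basis" using b assms by (auto simp: bij_betw_def)
  have "inj_on b {..n}" using b assms by (auto simp: bij_betw_def intro: inj_on_subset)
  then have "card (b ` {..n}) = Suc n" by (simp add: card_image)
  then show ?thesis
    using independent_mono [OF independent_Basis sub] by (simp add: coord_space_def dim_span dim_eq_card_independent)
qed

lemma inner_nsphere_to_euclidean:
  "\<lbrakk>n < DIM('v); j < DIM('v)\<rbrakk> \<Longrightarrow> nsphere_to_euclidean n x \<bullet> b j = (if j \<le> n then x j else 0)"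
proof -
  assume n: "n < DIM('v)" and j: "j < DIM('v)"
  have "nsphere_to_euclidean n x \<bullet> b j = (\<Sum>i\<le>n. if i = j then x i else 0)"
    unfolding nsphere_to_euclidean_def inner_sum_left
    by (rule sum.cong) (use n j in \<open>auto simp: inner_basis_enumeration\<close>)
  then show ?thesis by simp
qed

lemma coord_space_expansion:
  assumes n: "n < DIM('v)" and y: "y \<in> coord_space n"
  shows "nsphere_to_euclidean n (euclidean_to_nsphere n y) = y"
proof -
  let ?T = "{y. (\<Sum>i\<le>n. (y \<bullet> b i) *\<^sub>R b i) = y}"
  have "coord_space n \<subseteq> ?T"
    unfolding coord_space_def
  proof (rule span_minimal)
    show "subspace ?T"
      by (auto simp: subspace_def inner_add_left scaleR_add_left sum.distrib simp flip: scaleR_scaleR scaleR_sum_right)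
    show "b ` {..n} \<subseteq> ?T"
    proof clarify
      fix j assume j: "j \<le> n"
      have "(\<Sum>i\<le>n. (b j \<bullet> b i) *\<^sub>R b i) = (\<Sum>i\<le>n. if j = i then b i else 0)"
        by (rule sum.cong) (use j n in \<open>auto simp: inner_basis_enumeration\<close>)
      then show "(\<Sum>i\<le>n. (b j \<bullet> b i) *\<^sub>R b i) = b j" using j by simp
    qed
  qed
  then show ?thesis
    using y by (auto simp: nsphere_to_euclidean_def euclidean_to_nsphere_def)
qed

lemma nsphere_to_euclidean_in: "nsphere_to_euclidean n x \<in> coord_space n"
  unfolding nsphere_to_euclidean_def coord_space_def by (intro span_sum span_scale span_base) auto

lemma norm_nsphere_to_euclidean:
  assumes "n < DIM('v)"
  shows "(norm (nsphere_to_euclidean n x))\<^sup>2 = (\<Sum>i\<le>n. (x i)\<^sup>2)"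
proof -
  have "nsphere_to_euclidean n x \<bullet> nsphere_to_euclidean n x = (\<Sum>i\<le>n. x i * (nsphere_to_euclidean n x \<bullet> b i))"
    unfolding nsphere_to_euclidean_def [of n x] inner_sum_right by simp
  also have "\<dots> = (\<Sum>i\<le>n. x i * x i)"
    by (rule sum.cong) (use assms in \<open>auto simp: inner_nsphere_to_euclidean\<close>)
  finally show ?thesis unfolding power2_norm_eq_inner by (simp add: power2_eq_square)
qed

lemma homeomorphic_maps_nsphere_coord:
  assumes n: "n < DIM('v)"
  shows "homeomorphic_maps (nsphere n) (top_of_set (sphere 0 1 \<inter> coord_space n))
           (nsphere_to_euclidean n) (euclidean_to_nsphere n)"
  unfolding homeomorphic_maps_def
proof (intro conjI ballI)
  have "continuous_map (nsphere n) euclidean (nsphere_to_euclidean n)"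
    unfolding nsphere_to_euclidean_def
    by (intro continuous_map_sum continuous_map_scaleR continuous_map_nsphere_projection) auto
  moreover have "norm (nsphere_to_euclidean n x) = 1" if "x \<in> topspace (nsphere n)" for x
    using norm_nsphere_to_euclidean [OF n, of x] that by (simp add: nsphere abs_square_eq_1)
  ultimately show "continuous_map (nsphere n) (top_of_set (sphere 0 1 \<inter> coord_space n)) (nsphere_to_euclidean n)"
    by (auto simp: continuous_map_in_subtopology nsphere_to_euclidean_in)
  have "continuous_map (top_of_set (sphere 0 1 \<inter> coord_space n)) euclideanreal (\<lambda>y. euclidean_to_nsphere n y k)" for k
    by (cases "k \<le> n") (auto simp: euclidean_to_nsphere_def intro!: continuous_intros)
  moreover have "(\<Sum>i\<le>n. (euclidean_to_nsphere n y i)\<^sup>2) = 1" if "norm y = 1" "y \<in> coord_space n" for y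
    using norm_nsphere_to_euclidean [OF n, of "euclidean_to_nsphere n y"] coord_space_expansion [OF n that(2)] that
    by simp
  ultimately show "continuous_map (top_of_set (sphere 0 1 \<inter> coord_space n)) (nsphere n) (euclidean_to_nsphere n)"
    unfolding nsphere
    by (auto simp: continuous_map_in_subtopology continuous_map_componentwise_UNIV euclidean_to_nsphere_def)
  show "euclidean_to_nsphere n (nsphere_to_euclidean n x) = x" if "x \<in> topspace (nsphere n)" for x
    using that n by (auto simp: nsphere euclidean_to_nsphere_def inner_nsphere_to_euclidean fun_eq_iff)
  show "nsphere_to_euclidean n (euclidean_to_nsphere n y) = y"
    if "y \<in> topspace (top_of_set (sphere 0 1 \<inter> coord_space n))" for y
    using that coord_space_expansion [OF n] by simp
qed

lemma coord_space_Suc: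
  assumes n: "Suc n < DIM('v)"
  shows "coord_space n = {y \<in> coord_space (Suc n). y \<bullet> b (Suc n) = 0}"
proof
  have "coord_space n \<subseteq> coord_space (Suc n)"
    unfolding coord_space_def by (intro span_mono) auto
  moreover have "y \<bullet> b (Suc n) = 0" if "y \<in> coord_space n" for y
    using inner_nsphere_to_euclidean [of n "Suc n" "euclidean_to_nsphere n y"] coord_space_expansion [OF _ that] n
    by simp
  ultimately show "coord_space n \<subseteq> {y \<in> coord_space (Suc n). y \<bullet> b (Suc n) = 0}" by auto
  show "{y \<in> coord_space (Suc n). y \<bullet> b (Suc n) = 0} \<subseteq> coord_space n"
  proof clarify
    fix y assume y: "y \<in> coord_space (Suc n)" "y \<bullet> b (Suc n) = 0"
    have "y = nsphere_to_euclidean n (euclidean_to_nsphere (Suc n) y)"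
      using coord_space_expansion [OF n y(1)] y(2)
      by (simp add: nsphere_to_euclidean_def euclidean_to_nsphere_def)
    then show "y \<in> coord_space n" using nsphere_to_euclidean_in by metis
  qed
qed

text \<open>
  A map of degree one is onto, so it takes the value \<open>N\<close> and has a representative that preserves hemispheres. On the
  equator this has degree one as well, and the homotopy given by the induction hypothesis is suspended.
  The sphere must have dimension at least two since points on a circle cannot be moved past each other.
\<close>

lemma degree_one_imp_homotopic_id_step:
  assumes n: "Suc n < DIM('v)" "1 \<le> n"
    and IH: "\<And>g. \<lbrakk>continuous_map (nsphere n) (nsphere n) g; Brouwer_degree2 n g = 1\<rbrakk>
               \<Longrightarrow> homotopic_maps (nsphere n) (nsphere n) g id"
    and f: "continuous_map (nsphere (Suc n)) (nsphere (Suc n)) f" and deg: "Brouwer_degree2 (Suc n) f = 1"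
  shows "homotopic_maps (nsphere (Suc n)) (nsphere (Suc n)) f id"
proof -
  let ?X = "nsphere (Suc n)" and ?L = "coord_space (Suc n)" and ?M = "coord_space n"
  let ?\<phi> = "nsphere_to_euclidean (Suc n)" and ?\<psi> = "euclidean_to_nsphere (Suc n)"
  let ?S = "sphere 0 1 \<inter> ?L" and ?E = "sphere 0 1 \<inter> ?M"
  define N where "N = b (Suc n)"
  have N: "N \<in> ?L" "norm N = 1"
    using n inner_basis_enumeration [of "Suc n" "Suc n"]
    by (auto simp: N_def coord_space_def norm_eq_sqrt_inner intro: span_base)
  have hm: "homeomorphic_maps ?X (top_of_set ?S) ?\<phi> ?\<psi>"
    by (rule homeomorphic_maps_nsphere_coord) (use n in auto)
  have c\<phi>: "continuous_map ?X (top_of_set ?S) ?\<phi>" and c\<psi>: "continuous_map (top_of_set ?S) ?X ?\<psi>"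
    and \<psi>\<phi>: "\<And>x. x \<in> topspace ?X \<Longrightarrow> ?\<psi> (?\<phi> x) = x" and \<phi>\<psi>: "\<And>y. y \<in> ?S \<Longrightarrow> ?\<phi> (?\<psi> y) = y"
    using hm by (auto simp: homeomorphic_maps_def)
  have \<phi>S: "?\<phi> x \<in> ?S" if "x \<in> topspace ?X" for x using c\<phi> that by (auto simp: continuous_map_def)
  have \<psi>X: "?\<psi> y \<in> topspace ?X" if "y \<in> ?S" for y using c\<psi> that by (auto simp: continuous_map_def)
  define F where "F = ?\<phi> \<circ> f \<circ> ?\<psi>"
  have cF: "continuous_map (top_of_set ?S) (top_of_set ?S) F"
    unfolding F_def by (intro continuous_map_compose [OF c\<psi>] continuous_map_compose [OF f] c\<phi>)
  have "f ` topspace ?X = topspace ?X"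
    using Brouwer_degree2_nonsurjective [OF f] deg by auto
  moreover have "N \<in> ?S" using N by simp
  ultimately obtain x where x: "x \<in> topspace ?X" "f x = ?\<psi> N" using \<psi>X by (metis imageE)
  then have p: "?\<phi> x \<in> ?S" "F (?\<phi> x) = N"
    using \<phi>S \<psi>\<phi> \<phi>\<psi> \<open>N \<in> ?S\<close> by (auto simp: F_def)
  have "3 \<le> dim ?L" using dim_coord_space [OF n(1)] n(2) by simp
  have cF': "continuous_on ?S F" "F \<in> ?S \<rightarrow> ?S" using cF by auto
  obtain G where G: "homotopic_with_canon (\<lambda>_. True) ?S ?S F G"
    and sg: "\<And>y. y \<in> ?S \<Longrightarrow> sgn (G y \<bullet> N) = sgn (y \<bullet> N)"
    using hemisphere_preserving_representative [OF subspace_coord_space \<open>3 \<le> dim ?L\<close> N cF' p] by blast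
  have cG: "continuous_map (top_of_set ?S) (top_of_set ?S) G"
    using G homotopic_with_imp_continuous_maps by blast
  then have GS: "G y \<in> ?S" if "y \<in> ?S" for y using that by auto
  define g where "g = ?\<psi> \<circ> G \<circ> ?\<phi>"
  have cg: "continuous_map ?X ?X g"
    unfolding g_def by (intro continuous_map_compose [OF c\<phi>] continuous_map_compose [OF cG] c\<psi>)
  have G_eq: "(?\<phi> \<circ> g \<circ> ?\<psi>) y = G y" if "y \<in> ?S" for y
    using that \<phi>\<psi> GS by (simp add: g_def)
  have fg: "homotopic_maps ?X ?X f g"
  proof (rule homotopic_with_conjugate [OF hm _ f cg])
    show "homotopic_maps (top_of_set ?S) (top_of_set ?S) (?\<phi> \<circ> f \<circ> ?\<psi>) (?\<phi> \<circ> g \<circ> ?\<psi>)"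
      using G by (rule homotopic_with_eq) (use G_eq in \<open>auto simp: F_def\<close>)
  qed
  have height: "?\<phi> x \<bullet> N = x (Suc n)" for x
    using inner_nsphere_to_euclidean [OF n(1) n(1)] by (simp add: N_def)
  have sgx: "sgn (g x (Suc n)) = sgn (x (Suc n))" if "x \<in> topspace ?X" for x
    using sg [OF \<phi>S [OF that]] height [of x] by (simp add: g_def euclidean_to_nsphere_def N_def)
  have up: "0 \<le> g x (Suc n)" if "x \<in> topspace ?X" "0 \<le> x (Suc n)" for x
    using sgx [OF that(1)] that(2) by (metis zero_le_sgn_iff)
  have lo: "g x (Suc n) \<le> 0" if "x \<in> topspace ?X" "x (Suc n) \<le> 0" for x
    using sgx [OF that(1)] that(2) by (metis sgn_le_0_iff)
  have cgn: "continuous_map (nsphere n) (nsphere n) g" and degn: "Brouwer_degree2 (Suc n) g = Brouwer_degree2 n g"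
    using Brouwer_degree2_hemisphere_preserving [OF cg up lo] by auto
  have "Brouwer_degree2 n g = 1"
    using deg degn Brouwer_degree2_homotopic [OF fg] by simp
  with IH cgn have gid: "homotopic_maps (nsphere n) (nsphere n) g id" by blast
  have "homotopic_with_canon (\<lambda>_. True) ?E ?E G id"
  proof -
    have hmn: "homeomorphic_maps (nsphere n) (top_of_set ?E) (nsphere_to_euclidean n) (euclidean_to_nsphere n)"
      by (rule homeomorphic_maps_nsphere_coord) (use n in auto)
    then have c: "continuous_map (nsphere n) (top_of_set ?E) (nsphere_to_euclidean n)"
      "continuous_map (top_of_set ?E) (nsphere n) (euclidean_to_nsphere n)"
      by (auto simp: homeomorphic_maps_def)
    have "homotopic_maps (top_of_set ?E) (nsphere n)
        (g \<circ> euclidean_to_nsphere n) (id \<circ> euclidean_to_nsphere n)"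
      by (rule homotopic_with_compose_continuous_map_right [OF gid c(2)]) auto
    then have "homotopic_maps (top_of_set ?E) (top_of_set ?E)
        (nsphere_to_euclidean n \<circ> (g \<circ> euclidean_to_nsphere n)) (nsphere_to_euclidean n \<circ> (id \<circ> euclidean_to_nsphere n))"
      by (rule homotopic_with_compose_continuous_map_left [OF _ c(1)]) auto
    then show ?thesis
    proof (rule homotopic_with_eq)
      fix y assume "y \<in> topspace (top_of_set ?E)"
      then have y: "y \<in> ?E" by simp
      then have yS: "y \<in> ?S" "y \<bullet> N = 0" using coord_space_Suc [OF n(1)] by (auto simp: N_def)
      then have "G y \<bullet> N = 0" using sg [OF yS(1)] by (simp add: sgn_0_0)
      then have GM: "G y \<in> ?M" using GS [OF yS(1)] coord_space_Suc [OF n(1)] by (auto simp: N_def)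
      have e1: "euclidean_to_nsphere n z = ?\<psi> z" if "z \<bullet> N = 0" for z
        using that by (auto simp: euclidean_to_nsphere_def N_def fun_eq_iff le_Suc_eq)
      have "nsphere_to_euclidean n (g (euclidean_to_nsphere n y)) = nsphere_to_euclidean n (?\<psi> (G y))"
        using e1 [OF yS(2)] \<phi>\<psi> [OF yS(1)] by (simp add: g_def)
      also have "\<dots> = G y"
        using e1 [OF \<open>G y \<bullet> N = 0\<close>] coord_space_expansion [OF _ GM] n by simp
      finally show "G y = (nsphere_to_euclidean n \<circ> (g \<circ> euclidean_to_nsphere n)) y" by simp
      show "id y = (nsphere_to_euclidean n \<circ> (id \<circ> euclidean_to_nsphere n)) y"
        using coord_space_expansion [of n y] y n by simp
    qed auto
  qed
  then have "homotopic_with_canon (\<lambda>_. True) ?S ?S G id"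
    using homotopic_id_if_equator_homotopic_id [OF subspace_coord_space N cG sg]
    unfolding coord_space_Suc [OF n(1)] N_def by simp
  then have "homotopic_maps (top_of_set ?S) (top_of_set ?S) (?\<phi> \<circ> g \<circ> ?\<psi>) (?\<phi> \<circ> id \<circ> ?\<psi>)"
    by (rule homotopic_with_eq) (use G_eq \<phi>\<psi> in auto)
  then have "homotopic_maps ?X ?X g id"
    by (rule homotopic_with_conjugate [OF hm]) (use cg in auto)
  then show ?thesis by (rule homotopic_with_trans [OF fg])
qed

end

text \<open>
  Apart from the identity, the only map of two points onto themselves is the swap, which has degree \<open>-1\<close>.
\<close>

lemma degree_one_nsphere_0:
  assumes f: "continuous_map (nsphere 0) (nsphere 0) f" and deg: "Brouwer_degree2 0 f = 1"
  shows "homotopic_maps (nsphere 0) (nsphere 0) f id"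
proof -
  define P where "P = (\<lambda>i::nat. if i = 0 then 1 else 0::real)"
  define Q where "Q = (\<lambda>i::nat. if i = 0 then -1 else 0::real)"
  have top: "topspace (nsphere 0) = {P, Q}"
    by (auto simp: nsphere P_def Q_def fun_eq_iff power2_eq_1_iff split: if_split_asm)
  have PQ: "P \<noteq> Q" by (auto simp: P_def Q_def fun_eq_iff)
  have surj: "f ` {P, Q} = {P, Q}"
    using Brouwer_degree2_nonsurjective [OF f] deg top by auto
  have "f x = x" if "x \<in> topspace (nsphere 0)" for x
  proof (rule ccontr)
    assume "f x \<noteq> x"
    then have "f P = Q" "f Q = P" using surj that PQ top by (auto simp: doubleton_eq_iff)
    then have "f y = (\<lambda>i. if i = 0 then - y i else y i)" if "y \<in> topspace (nsphere 0)" for y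
    proof -
      have "Q = (\<lambda>i. if i = 0 then - P i else P i)" "P = (\<lambda>i. if i = 0 then - Q i else Q i)"
        by (auto simp: P_def Q_def)
      then show ?thesis using that top \<open>f P = Q\<close> \<open>f Q = P\<close> by auto
    qed
    then have "Brouwer_degree2 0 f = Brouwer_degree2 0 (\<lambda>x i. if i = 0 then - x i else x i)"
      by (rule Brouwer_degree2_eq)
    then show False using deg by (simp add: Brouwer_degree2_reflection)
  qed
  then show ?thesis by (intro homotopic_with_equal) (use f in auto)
qed

text \<open>
  The type \<open>'v\<close> only serves as a Euclidean space that contains the sphere.
\<close>

theorem degree_one_imp_homotopic_id:
  assumes "n < DIM('v::euclidean_space)"
    and "continuous_map (nsphere n) (nsphere n) f" "Brouwer_degree2 n f = 1"
  shows "homotopic_maps (nsphere n) (nsphere n) f id"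
  using assms
proof (induction n arbitrary: f)
  case 0
  then show ?case by (intro degree_one_nsphere_0)
next
  case (Suc n)
  show ?case
  proof (cases "n = 0")
    case True
    then show ?thesis using degree_one_circle_homotopic_id [of f] Suc.prems by (simp only: One_nat_def)
  next
    case False
    obtain b :: "nat \<Rightarrow> 'v" where b: "bij_betw b {..<DIM('v)} Basis"
      using ex_bij_betw_nat_finite [OF finite_Basis] by (auto simp: atLeast0LessThan)
    show ?thesis
    proof (rule degree_one_imp_homotopic_id_step [OF b])
      show "homotopic_maps (nsphere n) (nsphere n) g id"
        if "continuous_map (nsphere n) (nsphere n) g" "Brouwer_degree2 n g = 1" for g
        by (rule Suc.IH [OF _ that]) (use Suc.prems in simp)
    qed (use Suc.prems False in auto)
  qed
qed

section \<open>Degree on the unit sphere\<close>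

lemma unit_sphere_nsphere_maps:
  obtains \<phi> :: "(nat \<Rightarrow> real) \<Rightarrow> 'v::euclidean_space" and \<psi>
  where "homeomorphic_maps (nsphere (DIM('v) - 1)) unit_sphere \<phi> \<psi>"
proof -
  have "DIM('v) \<noteq> 0" by simp
  then obtain \<phi> :: "(nat \<Rightarrow> real) \<Rightarrow> 'v" and \<psi>
    where "homeomorphic_maps (nsphere (DIM('v) - 1)) (top_of_set (sphere 0 1 \<inter> span Basis)) \<phi> \<psi>"
    using homeomorphic_maps_nsphere_euclidean_sphere [OF independent_Basis orthogonal_Basis refl _ norm_Basis, where 'n = 'v]
    by blast
  then show thesis by (intro that) (simp add: unit_sphere_def)
qed

lemma infinite_cyclic_generator:
  assumes G: "group G" "G \<cong> integer_group" and a: "a \<in> carrier G" "subgroup_generated G {a} = G"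
  shows "a [^]\<^bsub>G\<^esub> (k::int) = a [^]\<^bsub>G\<^esub> l \<longleftrightarrow> k = l"
    and "x \<in> carrier G \<Longrightarrow> \<exists>k::int. x = a [^]\<^bsub>G\<^esub> k"
proof -
  interpret group G by (rule G(1))
  have "group.ord G a = 0"
    using iso_finite [OF G(2)] infinite_cyclic_subgroup_order [OF a(1)] a(2) by simp
  then show "a [^]\<^bsub>G\<^esub> (k::int) = a [^]\<^bsub>G\<^esub> l \<longleftrightarrow> k = l"
    using int_pow_eq [OF a(1)] by auto
  show "\<exists>k::int. x = a [^]\<^bsub>G\<^esub> k" if "x \<in> carrier G"
    using carrier_subgroup_generated_by_singleton [OF a(1)] a(2) that by auto
qed

lemma reduced_homology_homeomorphic_nsphere:
  assumes hm: "homeomorphic_maps (nsphere n) Y \<phi> \<psi>"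
  shows "reduced_homology_group (int n) Y \<cong> integer_group"
proof -
  have "Y homeomorphic_space nsphere n"
    unfolding homeomorphic_space_def using hm homeomorphic_maps_sym by blast
  from iso_trans [OF homeomorphic_space_imp_isomorphic_reduced_homology_groups [OF this]
      reduced_homology_group_nsphere(1)]
  show ?thesis .
qed

lemma hom_induced_homeomorphic_nsphere:
  assumes hm: "homeomorphic_maps (nsphere n) Y \<phi> \<psi>"
    and f: "continuous_map Y Y f" and x: "x \<in> carrier (reduced_homology_group (int n) Y)"
  shows "hom_induced (int n) Y {} Y {} f x
       = x [^]\<^bsub>reduced_homology_group (int n) Y\<^esub> Brouwer_degree2 n (\<psi> \<circ> f \<circ> \<phi>)"
proof -
  let ?X = "nsphere n"
  let ?G = "reduced_homology_group (int n) Y" and ?H = "reduced_homology_group (int n) ?X"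
  have c: "continuous_map ?X Y \<phi>" "continuous_map Y ?X \<psi>" and inv: "\<And>y. y \<in> topspace Y \<Longrightarrow> \<phi> (\<psi> y) = y"
    and inv': "\<And>x. x \<in> topspace ?X \<Longrightarrow> \<psi> (\<phi> x) = x"
    using hm by (auto simp: homeomorphic_maps_def)
  let ?\<psi> = "hom_induced (int n) Y {} ?X {} \<psi>"
  let ?f = "hom_induced (int n) Y {} Y {} f"
  let ?d = "Brouwer_degree2 n (\<psi> \<circ> f \<circ> \<phi>)"
  have 1: "homotopic_maps Y Y (\<phi> \<circ> \<psi>) id"
    using c inv by (intro homotopic_with_equal) (auto intro: continuous_map_compose)
  have 2: "homotopic_maps ?X ?X (\<psi> \<circ> \<phi>) id"
    using c inv' by (intro homotopic_with_equal) (auto intro: continuous_map_compose)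
  have iso: "?\<psi> \<in> iso ?G ?H"
    by (rule homotopy_equivalence_reduced_homology_group_isomorphism [OF c(2,1) 1 2])
  interpret group_hom ?G ?H ?\<psi>
    using iso by (auto simp: group_hom_def group_hom_axioms_def iso_def)
  have \<psi>x: "?\<psi> x \<in> carrier ?H" by (rule hom_induced_reduced [OF x])
  have "?\<psi> (?f x) = hom_induced (int n) Y {} ?X {} (\<psi> \<circ> f) x"
    using hom_induced_compose_empty [OF f c(2), of "int n"] by (simp add: fun_eq_iff)
  also have "\<dots> = hom_induced (int n) Y {} ?X {} ((\<psi> \<circ> f \<circ> \<phi>) \<circ> \<psi>) x"
    by (rule fun_cong [OF hom_induced_eq]) (simp add: inv)
  also have "\<dots> = hom_induced (int n) ?X {} ?X {} (\<psi> \<circ> f \<circ> \<phi>) (?\<psi> x)"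
  proof -
    have "continuous_map ?X ?X (\<psi> \<circ> f \<circ> \<phi>)"
      using c f by (intro continuous_map_compose [OF c(1)] continuous_map_compose [OF f] c)
    then show ?thesis
      using hom_induced_compose_empty [OF c(2), of ?X "\<psi> \<circ> f \<circ> \<phi>" "int n"] by (simp add: fun_eq_iff)
  qed
  also have "\<dots> = ?\<psi> x [^]\<^bsub>?H\<^esub> ?d" by (rule Brouwer_degree2 [OF \<psi>x])
  also have "\<dots> = ?\<psi> (x [^]\<^bsub>?G\<^esub> ?d)" using hom_int_pow [OF x] by simp
  finally have eq: "?\<psi> (?f x) = ?\<psi> (x [^]\<^bsub>?G\<^esub> ?d)" .
  have "inj_on ?\<psi> (carrier ?G)" using iso unfolding iso_def bij_betw_def by blast
  from inj_onD [OF this eq hom_induced_reduced [OF x] G.int_pow_closed [OF x]] show ?thesis .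
qed

lemma sphere_degree_conjugate:
  fixes \<phi> :: "(nat \<Rightarrow> real) \<Rightarrow> 'v::euclidean_space"
  assumes hm: "homeomorphic_maps (nsphere n) unit_sphere \<phi> \<psi>" and n: "n = DIM('v) - 1"
    and f: "continuous_map unit_sphere unit_sphere f"
  shows "sphere_degree f = Brouwer_degree2 n (\<psi> \<circ> f \<circ> \<phi>)"
proof -
  let ?Y = "unit_sphere :: 'v topology"
  let ?G = "reduced_homology_group (int n) ?Y"
  have iso: "?G \<cong> integer_group" by (rule reduced_homology_homeomorphic_nsphere [OF hm])
  have "cyclic_group ?G" using isomorphic_group_cyclicity [OF iso] by simp
  then obtain a where a: "a \<in> carrier ?G" "subgroup_generated ?G {a} = ?G" by (auto simp: cyclic_group_def)
  note uniq = infinite_cyclic_generator(1) [OF _ iso a]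
  show ?thesis
    unfolding sphere_degree_def Let_def n [symmetric]
  proof (rule the_equality)
    show "\<forall>x\<in>carrier ?G. hom_induced (int n) ?Y {} ?Y {} f x = x [^]\<^bsub>?G\<^esub> Brouwer_degree2 n (\<psi> \<circ> f \<circ> \<phi>)"
      using hom_induced_homeomorphic_nsphere [OF hm f] by blast
    fix k :: int assume "\<forall>x\<in>carrier ?G. hom_induced (int n) ?Y {} ?Y {} f x = x [^]\<^bsub>?G\<^esub> k"
    then have "a [^]\<^bsub>?G\<^esub> k = a [^]\<^bsub>?G\<^esub> Brouwer_degree2 n (\<psi> \<circ> f \<circ> \<phi>)"
      using hom_induced_homeomorphic_nsphere [OF hm f a(1)] a(1) by metis
    then show "k = Brouwer_degree2 n (\<psi> \<circ> f \<circ> \<phi>)" using uniq by simp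
  qed
qed

lemma sphere_degree_compose:
  fixes f g :: "'v::euclidean_space \<Rightarrow> 'v"
  assumes f: "continuous_map unit_sphere unit_sphere f" and g: "continuous_map unit_sphere unit_sphere g"
  shows "sphere_degree (g \<circ> f) = sphere_degree g * sphere_degree f"
proof -
  obtain \<phi> :: "(nat \<Rightarrow> real) \<Rightarrow> 'v" and \<psi> where hm: "homeomorphic_maps (nsphere (DIM('v) - 1)) unit_sphere \<phi> \<psi>"
    by (rule unit_sphere_nsphere_maps [where 'v = 'v], rule that)
  then have c: "continuous_map (nsphere (DIM('v) - 1)) unit_sphere \<phi>"
    "continuous_map unit_sphere (nsphere (DIM('v) - 1)) \<psi>" "\<And>y. y \<in> topspace unit_sphere \<Longrightarrow> \<phi> (\<psi> y) = y"
    by (auto simp: homeomorphic_maps_def)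
  have cc: "continuous_map (nsphere (DIM('v) - 1)) (nsphere (DIM('v) - 1)) (\<psi> \<circ> h \<circ> \<phi>)"
    if "continuous_map unit_sphere unit_sphere h" for h
    by (intro continuous_map_compose [OF c(1)] continuous_map_compose [OF that] c)
  have "Brouwer_degree2 (DIM('v) - 1) (\<psi> \<circ> (g \<circ> f) \<circ> \<phi>)
      = Brouwer_degree2 (DIM('v) - 1) ((\<psi> \<circ> g \<circ> \<phi>) \<circ> (\<psi> \<circ> f \<circ> \<phi>))"
  proof (rule Brouwer_degree2_eq)
    fix x assume "x \<in> topspace (nsphere (DIM('v) - 1))"
    then have "f (\<phi> x) \<in> topspace unit_sphere" using c(1) f by (auto simp: continuous_map_def)
    then show "(\<psi> \<circ> (g \<circ> f) \<circ> \<phi>) x = ((\<psi> \<circ> g \<circ> \<phi>) \<circ> (\<psi> \<circ> f \<circ> \<phi>)) x" using c(3) by simp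
  qed
  then show ?thesis
    using sphere_degree_conjugate [OF hm refl] f g continuous_map_compose [OF f g]
      Brouwer_degree2_compose [OF cc [OF f] cc [OF g]] by simp
qed

lemma sphere_degree_homotopic:
  fixes f g :: "'v::euclidean_space \<Rightarrow> 'v"
  assumes h: "homotopic_maps unit_sphere unit_sphere f g"
  shows "sphere_degree f = sphere_degree g"
  unfolding sphere_degree_def using homology_homotopy_empty [OF h] by simp

lemma sphere_degree_id: "sphere_degree (id :: 'v::euclidean_space \<Rightarrow> 'v) = 1"
proof -
  obtain \<phi> :: "(nat \<Rightarrow> real) \<Rightarrow> 'v" and \<psi> where hm: "homeomorphic_maps (nsphere (DIM('v) - 1)) unit_sphere \<phi> \<psi>"
    by (rule unit_sphere_nsphere_maps [where 'v = 'v], rule that)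
  have "Brouwer_degree2 (DIM('v) - 1) (\<psi> \<circ> id \<circ> \<phi>) = Brouwer_degree2 (DIM('v) - 1) id"
    by (rule Brouwer_degree2_eq) (use hm in \<open>auto simp: homeomorphic_maps_def\<close>)
  then show ?thesis using sphere_degree_conjugate [OF hm refl, of id] by (simp only: continuous_map_id Brouwer_degree2_id)
qed

lemma sphere_degree_one_imp_homotopic_id:
  fixes f :: "'v::euclidean_space \<Rightarrow> 'v"
  assumes f: "continuous_map unit_sphere unit_sphere f" and deg: "sphere_degree f = 1"
  shows "homotopic_maps unit_sphere unit_sphere f id"
proof -
  obtain \<phi> :: "(nat \<Rightarrow> real) \<Rightarrow> 'v" and \<psi> where hm: "homeomorphic_maps (nsphere (DIM('v) - 1)) unit_sphere \<phi> \<psi>"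
    by (rule unit_sphere_nsphere_maps [where 'v = 'v], rule that)
  let ?X = "nsphere (DIM('v) - 1)"
  have c: "continuous_map ?X unit_sphere \<phi>" "continuous_map unit_sphere ?X \<psi>"
    "\<And>x. x \<in> topspace ?X \<Longrightarrow> \<psi> (\<phi> x) = x" "\<And>y. y \<in> topspace unit_sphere \<Longrightarrow> \<phi> (\<psi> y) = y"
    using hm by (auto simp: homeomorphic_maps_def)
  have "continuous_map ?X ?X (\<psi> \<circ> f \<circ> \<phi>)"
    by (intro continuous_map_compose [OF c(1)] continuous_map_compose [OF f] c)
  moreover have "Brouwer_degree2 (DIM('v) - 1) (\<psi> \<circ> f \<circ> \<phi>) = 1"
    using sphere_degree_conjugate [OF hm refl f] deg by simp
  ultimately have "homotopic_maps ?X ?X (\<psi> \<circ> f \<circ> \<phi>) id"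
    by (intro degree_one_imp_homotopic_id [where 'v = 'v]) auto
  then have "homotopic_maps ?X ?X (\<psi> \<circ> f \<circ> \<phi>) (\<psi> \<circ> id \<circ> \<phi>)"
    by (rule homotopic_with_eq) (auto simp: c(3))
  then show ?thesis
    by (rule homotopic_with_conjugate [OF iffD1 [OF homeomorphic_maps_sym hm] _ f continuous_map_id])
qed

definition reflect_in :: "'v::euclidean_space \<Rightarrow> 'v \<Rightarrow> 'v"
  where "reflect_in u y = y - (2 * (y \<bullet> u)) *\<^sub>R u"

lemma reflect_in_involution:
  assumes "norm u = 1"
  shows "reflect_in u (reflect_in u y) = y"
proof -
  have "u \<bullet> u = 1" using assms by (simp add: dot_square_norm)
  then have "reflect_in u y \<bullet> u = - (y \<bullet> u)" by (simp add: reflect_in_def inner_diff_left)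
  then have "reflect_in u (reflect_in u y) = reflect_in u y + (2 * (y \<bullet> u)) *\<^sub>R u"
    unfolding reflect_in_def [of u "reflect_in u y"] by simp
  then show ?thesis by (simp add: reflect_in_def)
qed

lemma continuous_map_reflect_in:
  assumes "norm u = 1"
  shows "continuous_map unit_sphere unit_sphere (reflect_in u)"
proof -
  have uu: "u \<bullet> u = 1" using assms by (simp add: dot_square_norm)
  have "norm (reflect_in u y) = norm y" for y
  proof -
    have "(y - c *\<^sub>R u) \<bullet> (y - c *\<^sub>R u) = y \<bullet> y + c * (c - 2 * (y \<bullet> u))" for c
      using uu by (simp add: inner_diff_left inner_diff_right inner_commute [of u y] right_diff_distrib)
    then have "(norm (reflect_in u y))\<^sup>2 = (norm y)\<^sup>2"
      unfolding power2_norm_eq_inner reflect_in_def by simp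
    then show ?thesis by (simp add: power2_eq_iff_nonneg)
  qed
  moreover have "continuous_on UNIV (reflect_in u)"
    unfolding reflect_in_def by (intro continuous_intros)
  ultimately show ?thesis
    by (auto simp: unit_sphere_def intro: continuous_on_subset)
qed

text \<open>
  In coordinates with respect to a basis containing \<open>u\<close> the map changes the sign of one coordinate.
\<close>

lemma sphere_degree_reflection:
  obtains u :: "'v::euclidean_space" where "norm u = 1" "sphere_degree (reflect_in u) = -1"
proof -
  obtain b :: "nat \<Rightarrow> 'v" where b: "bij_betw b {..<DIM('v)} Basis"
    using ex_bij_betw_nat_finite [OF finite_Basis] by (auto simp: atLeast0LessThan)
  let ?n = "DIM('v) - 1"
  have n: "?n < DIM('v)" by simp
  let ?\<phi> = "nsphere_to_euclidean b ?n" and ?\<psi> = "euclidean_to_nsphere b ?n"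
  have "b 0 \<in> Basis" using b DIM_positive [where 'a = 'v] by (auto simp: bij_betw_def)
  then have u: "norm (b 0) = 1" by (rule norm_Basis)
  have "{..?n} = {..<DIM('v)}"
    unfolding lessThan_Suc_atMost [symmetric] by simp
  then have "coord_space b ?n = UNIV" using b by (simp add: coord_space_def bij_betw_def)
  then have hm: "homeomorphic_maps (nsphere ?n) unit_sphere ?\<phi> ?\<psi>"
    using homeomorphic_maps_nsphere_coord [OF b n] by (simp add: unit_sphere_def)
  have "Brouwer_degree2 ?n (?\<psi> \<circ> reflect_in (b 0) \<circ> ?\<phi>) = Brouwer_degree2 ?n (\<lambda>x i. if i = 0 then - x i else x i)"
  proof (rule Brouwer_degree2_eq)
    fix x assume x: "x \<in> topspace (nsphere ?n)"
    have "reflect_in (b 0) (?\<phi> x) \<bullet> b i = (if i = 0 then - x i else x i)" if "i \<le> ?n" for i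
    proof -
      have "i < DIM('v)" using that DIM_positive [where 'a='v] by linarith
      then show ?thesis
        using that inner_nsphere_to_euclidean [OF b n] inner_basis_enumeration [OF b] 
        by (simp add: reflect_in_def inner_diff_left)
    qed
    moreover have "x i = 0" if "i > ?n" for i using x that by (simp add: nsphere)
    ultimately show "(?\<psi> \<circ> reflect_in (b 0) \<circ> ?\<phi>) x = (\<lambda>i. if i = 0 then - x i else x i)"
      by (auto simp: euclidean_to_nsphere_def [OF b] fun_eq_iff)
  qed
  then have "sphere_degree (reflect_in (b 0)) = -1"
    using sphere_degree_conjugate [OF hm refl continuous_map_reflect_in [OF u]]
    by (simp only: Brouwer_degree2_reflection)
  then show thesis using that u by blast
qed

text \<open>
  The degrees of \<open>h\<close> and \<open>k\<close> have product \<open>1\<close>. If \<open>h\<close> has degree \<open>-1\<close> and \<open>f'\<close> is a homotopy inverse of \<open>f\<close>, then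
  \<open>f' \<circ> h\<close> has degree \<open>1\<close>, whence \<open>h \<simeq> f \<circ> (f' \<circ> h) \<simeq> f\<close>.
\<close>

lemma homotopy_equivalence_homotopic_id_or_reversing:
  fixes h k :: "'v::euclidean_space \<Rightarrow> 'v"
  assumes h: "continuous_map unit_sphere unit_sphere h" and k: "continuous_map unit_sphere unit_sphere k"
    and kh: "homotopic_maps unit_sphere unit_sphere (k \<circ> h) id"
    and f: "homotopy_equivalence_map unit_sphere unit_sphere f" "sphere_degree f = -1"
  shows "homotopic_maps unit_sphere unit_sphere h id \<or>
         homotopic_maps unit_sphere unit_sphere h f"
proof -
  have "sphere_degree k * sphere_degree h = 1"
    using sphere_degree_compose [OF h k] sphere_degree_homotopic [OF kh] sphere_degree_id [where 'v='v] by simp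
  then consider "sphere_degree h = 1" | "sphere_degree h = -1" by (auto simp: zmult_eq_1_iff)
  then show ?thesis
  proof cases
    case 1 then show ?thesis using sphere_degree_one_imp_homotopic_id [OF h] by blast
  next
    case 2
    obtain f' where cf: "continuous_map unit_sphere unit_sphere f" and f': "continuous_map unit_sphere unit_sphere f'"
      and f'f: "homotopic_maps unit_sphere unit_sphere (f' \<circ> f) id"
      and ff': "homotopic_maps unit_sphere unit_sphere (f \<circ> f') id"
      using f(1) by (auto simp: homotopy_equivalence_map_def)
    have "sphere_degree f' * sphere_degree f = 1"
      using sphere_degree_compose [OF cf f'] sphere_degree_homotopic [OF f'f] sphere_degree_id [where 'v='v] by simp
    then have "sphere_degree (f' \<circ> h) = 1"
      using f(2) 2 sphere_degree_compose [OF h f'] by simp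
    from sphere_degree_one_imp_homotopic_id [OF continuous_map_compose [OF h f'] this]
    have "homotopic_maps unit_sphere unit_sphere (f \<circ> (f' \<circ> h)) (f \<circ> id)"
      by (rule homotopic_with_compose_continuous_map_left [OF _ cf]) auto
    moreover have "homotopic_maps unit_sphere unit_sphere ((f \<circ> f') \<circ> h) (id \<circ> h)"
      by (rule homotopic_with_compose_continuous_map_right [OF ff' h]) auto
    ultimately have "homotopic_maps unit_sphere unit_sphere h f"
      by (metis comp_assoc comp_id homotopic_with_sym homotopic_with_trans id_comp)
    then show ?thesis ..
  qed
qed

section \<open>Finite covers of normal spaces\<close>

text \<open>
  In a locally finite refinement of the cover by the sets \<open>U a\<close> and the complement of \<open>A\<close>, consider the members that
  meet \<open>A\<close>. The closure of each of them misses \<open>B\<close>, and by local finiteness so does the closure of their union.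
\<close>

lemma paracompact_separation:
  assumes P: "paracompact_space X" and A: "closedin X A"
    and sep: "\<And>a. a \<in> A \<Longrightarrow> \<exists>U W. openin X U \<and> openin X W \<and> a \<in> U \<and> B \<subseteq> W \<and> disjnt U W"
    and B: "B \<subseteq> topspace X"
  obtains G H where "openin X G" "openin X H" "A \<subseteq> G" "B \<subseteq> H" "disjnt G H"
proof -
  obtain U W where UW: "\<And>a. a \<in> A \<Longrightarrow> openin X (U a) \<and> openin X (W a) \<and> a \<in> U a \<and> B \<subseteq> W a \<and> disjnt (U a) (W a)"
    using sep by metis
  let ?\<U> = "insert (topspace X - A) (U ` A)"
  have AX: "A \<subseteq> topspace X" using A closedin_subset by blast
  have "\<forall>U \<in> ?\<U>. openin X U" using UW A by auto
  moreover have "\<Union>?\<U> = topspace X"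
  proof
    show "\<Union>?\<U> \<subseteq> topspace X" using UW openin_subset [of X] by fastforce
    show "topspace X \<subseteq> \<Union>?\<U>" using UW by auto
  qed
  ultimately have "\<exists>\<V>. (\<forall>V \<in> \<V>. openin X V) \<and> \<Union>\<V> = topspace X \<and>
      (\<forall>V \<in> \<V>. \<exists>U \<in> ?\<U>. V \<subseteq> U) \<and> locally_finite_in X \<V>"
    using P [unfolded paracompact_space_def, rule_format, of ?\<U>] by simp
  then obtain \<V> where \<V>: "\<forall>V \<in> \<V>. openin X V" "\<Union>\<V> = topspace X"
    "\<forall>V \<in> \<V>. \<exists>U \<in> ?\<U>. V \<subseteq> U" "locally_finite_in X \<V>"
    by metis
  define \<V>' where "\<V>' = {V \<in> \<V>. V \<inter> A \<noteq> {}}"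
  have lf: "locally_finite_in X \<V>'" by (rule locally_finite_in_subset [OF \<V>(4)]) (auto simp: \<V>'_def)
  have disj: "X closure_of V \<inter> B = {}" if V: "V \<in> \<V>'" for V
  proof -
    obtain a where a: "a \<in> A" "V \<subseteq> U a" using \<V>(3) V by (auto simp: \<V>'_def)
    have "V \<inter> W a = {}" using a UW [OF a(1)] by (auto simp: disjnt_def)
    then have "X closure_of V \<inter> W a = {}"
      using openin_Int_closure_of_eq_empty [of X "W a" V] UW [OF a(1)] by (metis Int_commute)
    then show ?thesis using UW [OF a(1)] by blast
  qed
  let ?G = "\<Union>\<V>'"
  have "X closure_of ?G = (\<Union>V \<in> \<V>'. X closure_of V)"
    using closure_of_locally_finite_Union [OF lf] by simp
  then have "X closure_of ?G \<inter> B = {}" using disj by auto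
  moreover have "openin X ?G" using \<V>(1) by (auto simp: \<V>'_def)
  moreover have "A \<subseteq> ?G" using AX \<V>(2) unfolding \<V>'_def by blast
  moreover have "disjnt ?G (topspace X - X closure_of ?G)"
    using closure_of_subset [of ?G X] openin_subset [OF \<open>openin X ?G\<close>] by (auto simp: disjnt_def)
  ultimately show thesis
    using B by (intro that [of ?G "topspace X - X closure_of ?G"]) auto
qed

text \<open>
  The separation lemma is used twice: for a closed set and a point, which gives regularity, and then for two closed
  sets.
\<close>

lemma paracompact_Hausdorff_imp_normal:
  assumes P: "paracompact_space X" and H: "Hausdorff_space X"
  shows "normal_space X"
  unfolding normal_space_def
proof (intro allI impI, elim conjE)
  have reg: "\<exists>U W. openin X U \<and> openin X W \<and> b \<in> U \<and> A \<subseteq> W \<and> disjnt U W"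
    if A: "closedin X A" and b: "b \<in> topspace X" "b \<notin> A" for A b
  proof -
    have "\<exists>U W. openin X U \<and> openin X W \<and> a \<in> U \<and> {b} \<subseteq> W \<and> disjnt U W" if "a \<in> A" for a
    proof -
      have "a \<in> topspace X" "a \<noteq> b" using that b closedin_subset [OF A] by auto
      then show ?thesis using H [unfolded Hausdorff_space_def, rule_format, of a b] b(1) by auto
    qed
    from paracompact_separation [OF P A this] b(1)
    obtain G H where "openin X G" "openin X H" "A \<subseteq> G" "{b} \<subseteq> H" "disjnt G H" by auto
    then show ?thesis by (metis disjnt_sym insert_subset)
  qed
  fix S T assume S: "closedin X S" and T: "closedin X T" and ST: "disjnt S T"
  have "\<exists>U W. openin X U \<and> openin X W \<and> a \<in> U \<and> T \<subseteq> W \<and> disjnt U W" if "a \<in> S" for a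
    using reg [OF T, of a] that ST closedin_subset [OF S] by (auto simp: disjnt_iff)
  from paracompact_separation [OF P S this closedin_subset [OF T]]
  obtain G H where "openin X G" "openin X H" "S \<subseteq> G" "T \<subseteq> H" "disjnt G H" by blast
  then show "\<exists>U V. openin X U \<and> openin X V \<and> S \<subseteq> U \<and> T \<subseteq> V \<and> disjnt U V" by blast
qed

text \<open>
  The sets are shrunk one at a time: the points that the others leave uncovered form a closed set.
\<close>

lemma normal_space_shrink_cover:
  assumes N: "normal_space X" and F: "open_cover X m F"
  obtains V where "open_cover X m V" "\<And>i. i \<in> {1..m} \<Longrightarrow> X closure_of V i \<subseteq> F i"
proof -
  have "\<exists>V. open_cover X m V \<and> (\<forall>i \<in> J. X closure_of V i \<subseteq> F i) \<and> (\<forall>i \<in> {1..m} - J. V i = F i)"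
    if "J \<subseteq> {1..m}" for J
    using finite_subset [OF that finite_atLeastAtMost] that
  proof (induction J rule: finite_induct)
    case empty
    show ?case using F by (intro exI [of _ F]) auto
  next
    case (insert j J)
    then obtain V where V: "open_cover X m V" "\<forall>i \<in> J. X closure_of V i \<subseteq> F i" "\<forall>i \<in> {1..m} - J. V i = F i"
      by auto
    have j: "j \<in> {1..m}" "V j = F j" using insert V(3) by auto
    define A where "A = topspace X - (\<Union>i \<in> {1..m} - {j}. V i)"
    have opV: "openin X (V i)" if "i \<in> {1..m}" for i using V(1) that by (simp add: open_cover_def)
    have "closedin X A" unfolding A_def using opV by (intro closedin_diff openin_Union) auto
    moreover have "A \<subseteq> V j" using V(1) by (auto simp: A_def open_cover_def)
    ultimately obtain W where W: "openin X W" "A \<subseteq> W" "X closure_of W \<subseteq> F j"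
      using N opV [OF j(1)] j(2) unfolding normal_space_alt by metis
    have "open_cover X m (V(j := W))"
      unfolding open_cover_def
    proof (intro conjI ballI)
      show op: "openin X ((V(j := W)) i)" if "i \<in> {1..m}" for i using opV [OF that] W(1) by simp
      show "(\<Union>i \<in> {1..m}. (V(j := W)) i) = topspace X"
      proof
        show "(\<Union>i \<in> {1..m}. (V(j := W)) i) \<subseteq> topspace X" using op openin_subset by blast
        show "topspace X \<subseteq> (\<Union>i \<in> {1..m}. (V(j := W)) i)"
        proof
          fix x assume x: "x \<in> topspace X"
          show "x \<in> (\<Union>i \<in> {1..m}. (V(j := W)) i)"
          proof (cases "x \<in> A")
            case True then show ?thesis using W(2) j(1) by (intro UN_I [of j]) auto
          next
            case False
            then obtain i where "i \<in> {1..m}" "i \<noteq> j" "x \<in> V i" using x unfolding A_def by blast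
            then show ?thesis by (intro UN_I [of i]) auto
          qed
        qed
      qed
    qed
    moreover have "\<forall>i \<in> insert j J. X closure_of (V(j := W)) i \<subseteq> F i"
      using V(2) W(3) by simp
    moreover have "\<forall>i \<in> {1..m} - insert j J. (V(j := W)) i = F i"
      using V(3) by simp
    ultimately show ?case by blast
  qed
  from this [OF order_refl] show thesis using that by auto
qed

text \<open>
  Two shrinkings are needed: the functions equal \<open>1\<close> on the sets of the second, so that their sum is positive, and
  vanish outside the sets of the first, so that even the closures of their supports lie in the cover.
\<close>

lemma partition_of_unity_exists:
  assumes N: "normal_space X" and F: "open_cover X m F"
  obtains \<phi> where "partition_of_unity X m F \<phi>"
proof -
  obtain V where V: "open_cover X m V" "\<And>i. i \<in> {1..m} \<Longrightarrow> X closure_of V i \<subseteq> F i"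
    using normal_space_shrink_cover [OF N F] by blast
  obtain W where W: "open_cover X m W" "\<And>i. i \<in> {1..m} \<Longrightarrow> X closure_of W i \<subseteq> V i"
    using normal_space_shrink_cover [OF N V(1)] by blast
  have "\<exists>f. continuous_map X (top_of_set {0..1::real}) f \<and> f ` (topspace X - V i) \<subseteq> {0} \<and> f ` (X closure_of W i) \<subseteq> {1}"
    if i: "i \<in> {1..m}" for i
  proof -
    have "closedin X (topspace X - V i)" using V(1) i by (auto simp: open_cover_def)
    moreover have "disjnt (topspace X - V i) (X closure_of W i)" using W(2) [OF i] by (auto simp: disjnt_def)
    ultimately show ?thesis using Urysohn_lemma [OF N _ closedin_closure_of, of "topspace X - V i" "W i" 0 1] by (metis zero_le_one)
  qed
  then obtain f where f: "\<And>i. i \<in> {1..m} \<Longrightarrow> continuous_map X (top_of_set {0..1::real}) (f i)"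
    and f0: "\<And>i. i \<in> {1..m} \<Longrightarrow> f i ` (topspace X - V i) \<subseteq> {0}"
    and f1: "\<And>i. i \<in> {1..m} \<Longrightarrow> f i ` (X closure_of W i) \<subseteq> {1}"
    by metis
  have fc: "continuous_map X euclideanreal (f i)" and fge: "\<And>x. x \<in> topspace X \<Longrightarrow> 0 \<le> f i x"
    if "i \<in> {1..m}" for i
    using f [OF that] by (auto simp: continuous_map_in_subtopology Pi_iff)
  define s where "s = (\<lambda>x. \<Sum>i = 1..m. f i x)"
  have sc: "continuous_map X euclideanreal s" unfolding s_def using fc by (intro continuous_map_sum) auto
  have spos: "0 < s x" if x: "x \<in> topspace X" for x
  proof -
    obtain i where i: "i \<in> {1..m}" "x \<in> W i" using W(1) x unfolding open_cover_def by blast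
    have "W i \<subseteq> X closure_of W i"
      using W(1) i(1) by (intro closure_of_subset openin_subset) (simp add: open_cover_def)
    then have "x \<in> X closure_of W i" using i(2) by blast
    then have "f i x = 1" using f1 [OF i(1)] by auto
    then show ?thesis unfolding s_def using i fge x by (intro sum_pos2 [of _ i]) auto
  qed
  have "partition_of_unity X m F (\<lambda>i x. f i x / s x)"
    unfolding partition_of_unity_def
  proof (intro conjI ballI)
    fix i assume i: "i \<in> {1..m}"
    show "continuous_map X euclideanreal (\<lambda>x. f i x / s x)"
      using fc [OF i] sc spos by (intro continuous_map_real_divide) (auto simp: less_le)
    show "0 \<le> f i x / s x" if "x \<in> topspace X" for x using fge [OF i that] spos [OF that] by simp
    have "{x \<in> topspace X. f i x / s x \<noteq> 0} \<subseteq> V i" using f0 [OF i] by auto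
    then show "X closure_of {x \<in> topspace X. f i x / s x \<noteq> 0} \<subseteq> F i"
      using V(2) [OF i] closure_of_mono by blast
  next
    show "(\<Sum>i = 1..m. f i x / s x) = 1" if "x \<in> topspace X" for x
      using spos [OF that] by (simp add: s_def flip: sum_divide_distrib)
  qed
  then show thesis by (rule that)
qed

text \<open>
  The sets are enlarged one at a time. For the nerve to stay the same, the neighbourhood of the next set \<open>D j\<close> must have
  a closure that avoids all those intersections of the current sets which are disjoint from \<open>D j\<close>; there are
  finitely many of them, so their union \<open>A\<close> is closed.
\<close>

lemma normal_space_swell_closed_cover:
  assumes N: "normal_space X" and F: "closed_cover X m F"
  obtains U where "open_cover X m U" "\<And>i. i \<in> {1..m} \<Longrightarrow> F i \<subseteq> U i" "nerve X m U = nerve X m F"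
proof -
  have nerve_mono: "nerve X m D \<subseteq> nerve X m D'" if "\<And>i. i \<in> {1..m} \<Longrightarrow> D i \<subseteq> D' i" for D D'
  proof
    fix \<sigma> assume "\<sigma> \<in> nerve X m D"
    then obtain x where "\<sigma> \<subseteq> {1..m}" "x \<in> topspace X" "\<And>i. i \<in> \<sigma> \<Longrightarrow> x \<in> D i"
      unfolding nerve_def by blast
    moreover from this have "x \<in> D' i" if "i \<in> \<sigma>" for i
      using that \<open>\<And>i. i \<in> {1..m} \<Longrightarrow> D i \<subseteq> D' i\<close> by blast
    ultimately show "\<sigma> \<in> nerve X m D'" unfolding nerve_def by blast
  qed
  have clF: "closedin X (F i)" if "i \<in> {1..m}" for i using F that by (simp add: closed_cover_def)
  have "\<exists>U. (\<forall>i \<in> J. openin X (U i) \<and> F i \<subseteq> U i) \<and>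
      nerve X m (\<lambda>i. if i \<in> J then X closure_of U i else F i) = nerve X m F"
    if "J \<subseteq> {1..m}" for J
    using finite_subset [OF that finite_atLeastAtMost] that
  proof (induction J rule: finite_induct)
    case empty
    show ?case by simp
  next
    case (insert j J)
    then obtain U where U: "\<forall>i \<in> J. openin X (U i) \<and> F i \<subseteq> U i"
      and eq: "nerve X m (\<lambda>i. if i \<in> J then X closure_of U i else F i) = nerve X m F"
      by auto
    have j: "j \<in> {1..m}" "j \<notin> J" using insert by auto
    define D where "D = (\<lambda>i. if i \<in> J then X closure_of U i else F i)"
    have clD: "closedin X (D i)" if "i \<in> {1..m}" for i using clF [OF that] by (simp add: D_def)
    define \<Sigma> where "\<Sigma> = {\<sigma>. \<sigma> \<subseteq> {1..m} \<and> D j \<inter> (topspace X \<inter> (\<Inter>i \<in> \<sigma>. D i)) = {}}"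
    define A where "A = (\<Union>\<sigma> \<in> \<Sigma>. topspace X \<inter> (\<Inter>i \<in> \<sigma>. D i))"
    have "closedin X (topspace X \<inter> (\<Inter>i \<in> \<sigma>. D i))" if "\<sigma> \<in> \<Sigma>" for \<sigma>
    proof (cases "\<sigma> = {}")
      case False
      then have "closedin X (\<Inter>i \<in> \<sigma>. D i)" using clD that by (intro closedin_INT) (auto simp: \<Sigma>_def)
      then show ?thesis by (intro closedin_Int) auto
    qed simp
    moreover have "finite \<Sigma>" unfolding \<Sigma>_def by (rule finite_subset [of _ "Pow {1..m}"]) auto
    ultimately have clA: "closedin X A" unfolding A_def by (intro closedin_Union) auto
    have "D j \<subseteq> topspace X - A" using closedin_subset [OF clD [OF j(1)]] by (auto simp: A_def \<Sigma>_def)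
    then obtain W where W: "openin X W" "D j \<subseteq> W" "X closure_of W \<subseteq> topspace X - A"
      using N clD [OF j(1)] openin_diff [OF openin_topspace clA] unfolding normal_space_alt by metis
    define D' where "D' = D(j := X closure_of W)"
    have DD': "D i \<subseteq> D' i" for i
      using W(2) closure_of_subset [OF openin_subset [OF W(1)]] by (auto simp: D'_def)
    have "nerve X m D' \<subseteq> nerve X m D"
    proof
      fix \<tau> assume \<tau>: "\<tau> \<in> nerve X m D'"
      show "\<tau> \<in> nerve X m D"
      proof (cases "j \<in> \<tau>")
        case False
        then have "(\<Inter>i \<in> \<tau>. D' i) = (\<Inter>i \<in> \<tau>. D i)" by (intro INF_cong) (auto simp: D'_def)
        then show ?thesis using \<tau> by (simp add: nerve_def)
      next
        case True
        obtain x where x: "x \<in> topspace X" "\<And>i. i \<in> \<tau> \<Longrightarrow> x \<in> D' i" and \<tau>m: "\<tau> \<subseteq> {1..m}"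
          using \<tau> unfolding nerve_def by blast
        have "x \<notin> A" using x(2) [OF True] W(3) by (auto simp: D'_def)
        moreover have "x \<in> topspace X \<inter> (\<Inter>i \<in> \<tau> - {j}. D i)"
        proof -
          have "x \<in> D i" if "i \<in> \<tau> - {j}" for i using x(2) [of i] that by (simp add: D'_def)
          then show ?thesis using x(1) by blast
        qed
        ultimately have "\<tau> - {j} \<notin> \<Sigma>" by (auto simp: A_def)
        then have "D j \<inter> (topspace X \<inter> (\<Inter>i \<in> \<tau> - {j}. D i)) \<noteq> {}" using \<tau>m by (auto simp: \<Sigma>_def)
        then obtain y where y: "y \<in> D j" "y \<in> topspace X" "\<And>i. i \<in> \<tau> - {j} \<Longrightarrow> y \<in> D i" by blast
        then have "y \<in> D i" if "i \<in> \<tau>" for i using that by (cases "i = j") auto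
        then show ?thesis using \<tau>m y(2) unfolding nerve_def by blast
      qed
    qed
    then have "nerve X m D' = nerve X m F"
      using nerve_mono [of D D'] DD' eq unfolding D_def by blast
    moreover have "D' = (\<lambda>i. if i \<in> insert j J then X closure_of (U(j := W)) i else F i)"
      by (rule ext) (simp add: D'_def D_def)
    moreover have "F j \<subseteq> W" using W(2) j by (simp add: D_def)
    ultimately show ?case
      using U W(1) by (intro exI [of _ "U(j := W)"]) auto
  qed
  from this [OF order_refl] obtain U where U: "\<forall>i \<in> {1..m}. openin X (U i) \<and> F i \<subseteq> U i"
    and eq: "nerve X m (\<lambda>i. if i \<in> {1..m} then X closure_of U i else F i) = nerve X m F" by blast
  have "nerve X m U \<subseteq> nerve X m F"
    unfolding eq [symmetric]
  proof (rule nerve_mono)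
    show "U i \<subseteq> (if i \<in> {1..m} then X closure_of U i else F i)" if "i \<in> {1..m}" for i
      using that U closure_of_subset [OF openin_subset, of X "U i"] by simp
  qed
  moreover have "nerve X m F \<subseteq> nerve X m U" by (rule nerve_mono) (use U in auto)
  moreover have "open_cover X m U"
  proof -
    have "(\<Union>i \<in> {1..m}. U i) \<subseteq> topspace X" using U openin_subset by blast
    moreover have "topspace X \<subseteq> (\<Union>i \<in> {1..m}. U i)" using F U unfolding closed_cover_def by blast
    ultimately show ?thesis using U by (auto simp: open_cover_def)
  qed
  ultimately show thesis using that U by blast
qed

section \<open>Weighted sums and the comparison map\<close>

text \<open>
  The total weight need not be \<open>1\<close>, because only the direction of a weighted sum matters.
\<close>

definition weight_family :: "'a topology \<Rightarrow> nat \<Rightarrow> (nat \<Rightarrow> 'a \<Rightarrow> real) \<Rightarrow> bool"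
  where "weight_family T m \<phi> \<longleftrightarrow>
    (\<forall>i \<in> {1..m}. continuous_map T euclideanreal (\<phi> i) \<and> (\<forall>x \<in> topspace T. 0 \<le> \<phi> i x)) \<and>
    (\<forall>x \<in> topspace T. 0 < (\<Sum>i = 1..m. \<phi> i x))"

definition weight_support :: "nat \<Rightarrow> (nat \<Rightarrow> 'a \<Rightarrow> real) \<Rightarrow> 'a \<Rightarrow> nat set"
  where "weight_support m \<phi> x = {i \<in> {1..m}. \<phi> i x \<noteq> 0}"

definition weighted_sum :: "nat \<Rightarrow> (nat \<Rightarrow> 'v::euclidean_space) \<Rightarrow> (nat \<Rightarrow> 'a \<Rightarrow> real) \<Rightarrow> 'a \<Rightarrow> 'v"
  where "weighted_sum m a \<phi> x = (\<Sum>i = 1..m. \<phi> i x *\<^sub>R a i)"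

text \<open>
  For \<open>a i = v i - r\<close> these are the sets \<open>\<sigma>\<close> that are not \<open>r\<close>-balanced.
\<close>

definition origin_free :: "(nat \<Rightarrow> 'v::euclidean_space) \<Rightarrow> nat set \<Rightarrow> bool"
  where "origin_free a \<sigma> \<longleftrightarrow> 0 \<notin> convex hull (a ` \<sigma>)"

lemma origin_free_subset: "\<lbrakk>origin_free a \<sigma>; \<tau> \<subseteq> \<sigma>\<rbrakk> \<Longrightarrow> origin_free a \<tau>"
  unfolding origin_free_def using hull_mono [of "a ` \<tau>" "a ` \<sigma>" convex] by blast

lemma positive_combination_nonzero:
  fixes a :: "nat \<Rightarrow> 'v::euclidean_space"
  assumes free: "origin_free a \<sigma>" and c: "\<And>i. i \<in> {1..m} \<Longrightarrow> 0 \<le> c i" "\<And>i. \<lbrakk>i \<in> {1..m}; c i \<noteq> 0\<rbrakk> \<Longrightarrow> i \<in> \<sigma>"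
    and pos: "0 < (\<Sum>i = 1..m. c i)"
  shows "(\<Sum>i = 1..m. c i *\<^sub>R a i) \<noteq> 0"
proof
  assume 0: "(\<Sum>i = 1..m. c i *\<^sub>R a i) = 0"
  define s where "s = (\<Sum>i = 1..m. c i)"
  let ?J = "{i \<in> {1..m}. c i \<noteq> 0}"
  have s: "(\<Sum>i \<in> ?J. c i) = s" unfolding s_def by (rule sum.mono_neutral_left) auto
  have "(\<Sum>i \<in> ?J. (c i / s) *\<^sub>R a i) \<in> convex hull (a ` \<sigma>)"
  proof (rule convex_sum)
    show "(\<Sum>i \<in> ?J. c i / s) = 1" using s pos by (simp add: s_def flip: sum_divide_distrib)
    show "0 \<le> c i / s" if "i \<in> ?J" for i using c(1) that pos by (simp add: s_def)
    show "a i \<in> convex hull (a ` \<sigma>)" if "i \<in> ?J" for i using c(2) that by (intro hull_inc) auto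
  qed auto
  moreover have "(\<Sum>i \<in> ?J. (c i / s) *\<^sub>R a i) = (1 / s) *\<^sub>R (\<Sum>i \<in> ?J. c i *\<^sub>R a i)"
    by (simp add: scaleR_sum_right)
  moreover have "(\<Sum>i \<in> ?J. c i *\<^sub>R a i) = (\<Sum>i = 1..m. c i *\<^sub>R a i)"
    by (rule sum.mono_neutral_left) auto
  ultimately show False using 0 free by (simp add: origin_free_def)
qed

lemma weighted_sum_continuous:
  assumes "weight_family T m \<phi>"
  shows "continuous_map T euclidean (weighted_sum m a \<phi>)"
  unfolding weighted_sum_def
  using assms by (intro continuous_map_sum continuous_map_scaleR) (auto simp: weight_family_def)

lemma weight_support_subset: "weight_support m \<phi> x \<subseteq> {1..m}"
  by (auto simp: weight_support_def)

lemma weighted_sum_in_span: "weighted_sum m a \<phi> x \<in> span (a ` {1..m})"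
  unfolding weighted_sum_def by (intro span_sum span_scale span_base) auto

text \<open>
  All convex combinations of the two families of weights have their supports in a common origin-free set.
\<close>

lemma weighted_sums_homotopic:
  fixes a :: "nat \<Rightarrow> 'v::euclidean_space"
  assumes L: "subspace L" "\<And>i. i \<in> {1..m} \<Longrightarrow> a i \<in> L"
    and \<phi>: "weight_family T m \<phi>" and \<psi>: "weight_family T m \<psi>"
    and free: "\<And>x. x \<in> topspace T \<Longrightarrow> \<exists>\<sigma>. origin_free a \<sigma> \<and> weight_support m \<phi> x \<subseteq> \<sigma> \<and> weight_support m \<psi> x \<subseteq> \<sigma>"
  shows "homotopic_maps T (top_of_set (sphere 0 1 \<inter> L))
           (\<lambda>x. sgn (weighted_sum m a \<phi> x)) (\<lambda>x. sgn (weighted_sum m a \<psi> x))"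
proof (rule homotopic_sgn_segment [OF L(1)])
  show "continuous_map T euclidean (weighted_sum m a \<phi>)" "continuous_map T euclidean (weighted_sum m a \<psi>)"
    using \<phi> \<psi> by (auto intro: weighted_sum_continuous)
  have "weighted_sum m a \<eta> x \<in> L" for \<eta> and x :: 'a
    unfolding weighted_sum_def using L by (intro subspace_sum subspace_scale) auto
  then show "weighted_sum m a \<phi> x \<in> L" "weighted_sum m a \<psi> x \<in> L" for x by auto
  fix x assume x: "x \<in> topspace T"
  obtain \<sigma> where \<sigma>: "origin_free a \<sigma>" "weight_support m \<phi> x \<subseteq> \<sigma>" "weight_support m \<psi> x \<subseteq> \<sigma>"
    using free [OF x] by blast
  show "0 \<notin> closed_segment (weighted_sum m a \<phi> x) (weighted_sum m a \<psi> x)"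
  proof
    assume "0 \<in> closed_segment (weighted_sum m a \<phi> x) (weighted_sum m a \<psi> x)"
    then obtain t where t: "0 \<le> t" "t \<le> 1"
      "0 = (1 - t) *\<^sub>R weighted_sum m a \<phi> x + t *\<^sub>R weighted_sum m a \<psi> x" by (auto simp: in_segment)
    define c where "c = (\<lambda>i. (1 - t) * \<phi> i x + t * \<psi> i x)"
    have "(\<Sum>i = 1..m. c i *\<^sub>R a i) \<noteq> 0"
    proof (rule positive_combination_nonzero [OF \<sigma>(1)])
      show "0 \<le> c i" if "i \<in> {1..m}" for i
        using that \<phi> \<psi> x t by (simp add: c_def weight_family_def)
      show "i \<in> \<sigma>" if "i \<in> {1..m}" "c i \<noteq> 0" for i
      proof (rule ccontr)
        assume "i \<notin> \<sigma>"
        then have "\<phi> i x = 0" "\<psi> i x = 0" using \<sigma> that(1) by (auto simp: weight_support_def)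
        with that(2) show False by (simp add: c_def)
      qed
      have "(\<Sum>i = 1..m. c i) = (1 - t) * (\<Sum>i = 1..m. \<phi> i x) + t * (\<Sum>i = 1..m. \<psi> i x)"
        by (simp add: c_def sum.distrib sum_distrib_left)
      moreover have "0 < (\<Sum>i = 1..m. \<phi> i x)" "0 < (\<Sum>i = 1..m. \<psi> i x)"
        using \<phi> \<psi> x by (auto simp: weight_family_def)
      ultimately show "0 < (\<Sum>i = 1..m. c i)"
        using t(1,2) by (cases "t = 0") (auto intro: add_nonneg_pos)
    qed
    moreover have "(\<Sum>i = 1..m. c i *\<^sub>R a i) = (1 - t) *\<^sub>R weighted_sum m a \<phi> x + t *\<^sub>R weighted_sum m a \<psi> x"
      by (simp add: c_def weighted_sum_def scaleR_add_left sum.distrib scaleR_sum_right)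
    ultimately show False using t(3) by simp
  qed
qed

text \<open>
  Up to a factor, a partition of unity for the cover of the sphere by the open hemispheres \<open>{x. 0 < x \<bullet> a i}\<close>. The nerve
  of this cover consists of origin-free sets.
\<close>

definition positive_part_weight :: "(nat \<Rightarrow> 'v::euclidean_space) \<Rightarrow> nat \<Rightarrow> 'v \<Rightarrow> real"
  where "positive_part_weight a i x = max 0 (x \<bullet> a i)"

definition comparison_map :: "nat \<Rightarrow> (nat \<Rightarrow> 'v::euclidean_space) \<Rightarrow> (nat \<Rightarrow> 'v) \<Rightarrow> 'v \<Rightarrow> 'v"
  where "comparison_map m a a' x = sgn (weighted_sum m a' (positive_part_weight a) x)"

text \<open>
  If this fails, then \<open>a\<close> positively spans its linear span.
\<close>

definition separates_some :: "nat \<Rightarrow> (nat \<Rightarrow> 'v::euclidean_space) \<Rightarrow> bool"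
  where "separates_some m a \<longleftrightarrow> (\<exists>w. \<exists>j \<in> {1..m}. 0 < w \<bullet> a j \<and> (\<forall>i \<in> {1..m}. 0 \<le> w \<bullet> a i))"

text \<open>
  If \<open>x\<close> were nowhere positive on the family, then \<open>- x\<close> would witness \<open>separates_some\<close>.
\<close>

lemma exists_positive_inner:
  assumes ns: "\<not> separates_some m a" and x: "x \<in> span (a ` {1..m})" "x \<noteq> 0"
  obtains i where "i \<in> {1..m}" "0 < x \<bullet> a i"
proof -
  obtain j where j: "j \<in> {1..m}" "x \<bullet> a j \<noteq> 0"
  proof (rule ccontr)
    assume "\<not> thesis"
    then have "x \<bullet> y = 0" if "y \<in> a ` {1..m}" for y using that \<open>\<And>j. \<lbrakk>j \<in> {1..m}; x \<bullet> a j \<noteq> 0\<rbrakk> \<Longrightarrow> thesis\<close> by blast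
    then have "orthogonal x x" using orthogonal_to_span [OF x(1), of x] by (simp add: orthogonal_def)
    then show False using x(2) by (simp add: orthogonal_def)
  qed
  show thesis
  proof (rule ccontr)
    assume "\<not> thesis"
    then have le: "x \<bullet> a i \<le> 0" if "i \<in> {1..m}" for i using that \<open>\<And>i. \<lbrakk>i \<in> {1..m}; 0 < x \<bullet> a i\<rbrakk> \<Longrightarrow> thesis\<close> by force
    then have "0 < (- x) \<bullet> a j \<and> (\<forall>i \<in> {1..m}. 0 \<le> (- x) \<bullet> a i)" using j by force
    then show False using ns j(1) unfolding separates_some_def by blast
  qed
qed

lemma positive_side_origin_free: "(\<And>i. i \<in> \<sigma> \<Longrightarrow> 0 < x \<bullet> a i) \<Longrightarrow> origin_free a \<sigma>"
proof -
  assume pos: "\<And>i. i \<in> \<sigma> \<Longrightarrow> 0 < x \<bullet> a i"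
  have "convex hull (a ` \<sigma>) \<subseteq> {y. 0 < x \<bullet> y}"
    by (rule hull_minimal) (use pos in \<open>auto simp: convex_halfspace_gt\<close>)
  then show ?thesis by (auto simp: origin_free_def)
qed

text \<open>
  The point of the hull nearest to the origin has positive inner product with the whole hull.
\<close>

lemma origin_free_positive_side:
  fixes a :: "nat \<Rightarrow> 'v::euclidean_space"
  assumes free: "origin_free a \<sigma>" and \<sigma>: "finite \<sigma>"
  obtains x where "x \<in> span (a ` \<sigma>)" "\<And>i. i \<in> \<sigma> \<Longrightarrow> 0 < x \<bullet> a i"
proof (cases "\<sigma> = {}")
  case True
  then show ?thesis using that [of 0] by simp
next
  case False
  let ?C = "convex hull (a ` \<sigma>)"
  have C: "closed ?C" "convex ?C" "?C \<noteq> {}"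
    using \<sigma> False by (auto simp: compact_imp_closed finite_imp_compact_convex_hull)
  define p where "p = closest_point ?C 0"
  have p: "p \<in> ?C" unfolding p_def by (rule closest_point_in_set [OF C(1,3)])
  then have "p \<noteq> 0" using free by (auto simp: origin_free_def)
  have "0 < p \<bullet> a i" if "i \<in> \<sigma>" for i
  proof -
    have "a i \<in> ?C" using that by (intro hull_inc) auto
    then have "inner (0 - p) (a i - p) \<le> 0"
      unfolding p_def by (rule closest_point_dot [OF C(2,1)])
    then have "p \<bullet> p \<le> p \<bullet> a i" by (simp add: inner_diff_right)
    then show ?thesis using \<open>p \<noteq> 0\<close> by (meson inner_gt_zero_iff less_le_trans)
  qed
  moreover have "p \<in> span (a ` \<sigma>)" using p convex_hull_subset_span by blast
  ultimately show ?thesis by (rule that [rotated])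
qed

lemma positive_part_weight_family:
  fixes a :: "nat \<Rightarrow> 'v::euclidean_space"
  assumes ns: "\<not> separates_some m a" and L: "L \<subseteq> span (a ` {1..m})"
  shows "weight_family (top_of_set (sphere 0 1 \<inter> L)) m (positive_part_weight a)"
  unfolding weight_family_def
proof (intro conjI ballI)
  show "continuous_map (top_of_set (sphere 0 1 \<inter> L)) euclideanreal (positive_part_weight a i)" for i
    unfolding positive_part_weight_def by (auto intro!: continuous_intros)
  show "0 \<le> positive_part_weight a i x" for i x by (simp add: positive_part_weight_def)
  fix x assume "x \<in> topspace (top_of_set (sphere 0 1 \<inter> L))"
  then have "x \<in> span (a ` {1..m})" "x \<noteq> 0" using L by auto
  then obtain i where "i \<in> {1..m}" "0 < x \<bullet> a i" using exists_positive_inner [OF ns] by blast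
  then show "0 < (\<Sum>i = 1..m. positive_part_weight a i x)"
    by (intro sum_pos2 [of _ i]) (auto simp: positive_part_weight_def)
qed

lemma positive_part_support:
  "weight_support m (positive_part_weight a) x = {i \<in> {1..m}. 0 < x \<bullet> a i}"
  by (auto simp: weight_support_def positive_part_weight_def max_def)

text \<open>
  For each point \<open>x\<close> of \<open>T\<close> a vector \<open>X x\<close> of the span is chosen, continuously, that has positive inner product with
  \<open>a i\<close> for every index \<open>i\<close> of large weight. Small weights have to be ignored: at nearby points more indices may
  have positive weight, so that positivity for all of them cannot be had continuously by gluing local
  choices. Truncating the small weights to zero changes neither map up to homotopy. For the truncated weights
  \<open>\<phi>'\<close>, the weighted sum of the \<open>a i\<close> has positive inner product with \<open>X x\<close>, so \<open>g \<simeq> sgn \<circ> X\<close>; and the comparison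
  map sends \<open>X x\<close> to a combination of the \<open>a' i\<close> over an origin-free set that contains the support
  of \<open>\<phi>'\<close>, so \<open>h \<circ> (sgn \<circ> X) \<simeq> g'\<close>.
\<close>

lemma comparison_map_homotopic:
  fixes a a' :: "nat \<Rightarrow> 'v::euclidean_space"
  assumes equiv: "\<And>\<sigma>. \<sigma> \<subseteq> {1..m} \<Longrightarrow> origin_free a \<sigma> \<longleftrightarrow> origin_free a' \<sigma>"
    and ns: "\<not> separates_some m a"
    and \<phi>: "weight_family T m \<phi>"
    and free: "\<And>x. x \<in> topspace T \<Longrightarrow> origin_free a (weight_support m \<phi> x)"
  shows "continuous_map (top_of_set (sphere 0 1 \<inter> span (a ` {1..m}))) unit_sphere (comparison_map m a a')"
    and "continuous_map T (top_of_set (sphere 0 1 \<inter> span (a ` {1..m}))) (\<lambda>x. sgn (weighted_sum m a \<phi> x))"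
    and "homotopic_maps T unit_sphere (\<lambda>x. sgn (weighted_sum m a' \<phi> x))
           (comparison_map m a a' \<circ> (\<lambda>x. sgn (weighted_sum m a \<phi> x)))"
proof -
  let ?L = "span (a ` {1..m})"
  let ?SL = "top_of_set (sphere 0 1 \<inter> ?L)"
  have L: "subspace ?L" "\<And>i. i \<in> {1..m} \<Longrightarrow> a i \<in> ?L" by (auto intro: span_base)
  have us: "unit_sphere = top_of_set (sphere 0 1 \<inter> (UNIV :: 'v set))" by (simp add: unit_sphere_def)
  have wf: "weight_family ?SL m (positive_part_weight a)"
    by (rule positive_part_weight_family [OF ns order_refl])
  have supp_free: "origin_free a (weight_support m (positive_part_weight a) x)" for x
    unfolding positive_part_support by (rule positive_side_origin_free) auto
  then have supp_free': "origin_free a' (weight_support m (positive_part_weight a) x)" for x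
    by (rule iffD1 [OF equiv [OF weight_support_subset]])
  have "homotopic_maps ?SL unit_sphere (\<lambda>x. sgn (weighted_sum m a' (positive_part_weight a) x))
      (\<lambda>x. sgn (weighted_sum m a' (positive_part_weight a) x))"
    unfolding us by (rule weighted_sums_homotopic [OF _ _ wf wf]) (use supp_free' in auto)
  then have "continuous_map ?SL unit_sphere (\<lambda>x. sgn (weighted_sum m a' (positive_part_weight a) x))"
    using homotopic_with_imp_continuous_maps by blast
  then show ch: "continuous_map ?SL unit_sphere (comparison_map m a a')"
    unfolding comparison_map_def [abs_def] .
  have "homotopic_maps T ?SL (\<lambda>x. sgn (weighted_sum m a \<phi> x)) (\<lambda>x. sgn (weighted_sum m a \<phi> x))"
    by (rule weighted_sums_homotopic [OF L \<phi> \<phi>]) (use free in auto)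
  then show "continuous_map T ?SL (\<lambda>x. sgn (weighted_sum m a \<phi> x))"
    using homotopic_with_imp_continuous_maps by blast

  define s where "s = (\<lambda>x. \<Sum>i = 1..m. \<phi> i x)"
  \<comment> \<open>Less than \<open>1 / m\<close>, so that some weight exceeds \<open>\<epsilon>\<close> times the total.\<close>
  define \<epsilon> where "\<epsilon> = 1 / (real m + 1)"
  define K where "K = {\<sigma>. \<sigma> \<subseteq> {1..m} \<and> origin_free a \<sigma>}"
  have finK: "finite K" unfolding K_def by (rule finite_subset [of _ "Pow {1..m}"]) auto
  have "\<exists>x. x \<in> ?L \<and> (\<forall>i \<in> \<sigma>. 0 < x \<bullet> a i)" if "\<sigma> \<in> K" for \<sigma>
  proof -
    have \<sigma>: "\<sigma> \<subseteq> {1..m}" "origin_free a \<sigma>" using that by (auto simp: K_def)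
    obtain x where "x \<in> span (a ` \<sigma>)" "\<And>i. i \<in> \<sigma> \<Longrightarrow> 0 < x \<bullet> a i"
      using origin_free_positive_side [OF \<sigma>(2) finite_subset [OF \<sigma>(1) finite_atLeastAtMost]] by blast
    then show ?thesis using span_mono [of "a ` \<sigma>" "a ` {1..m}"] \<sigma>(1) by blast
  qed
  then obtain w where w: "\<And>\<sigma>. \<sigma> \<in> K \<Longrightarrow> w \<sigma> \<in> ?L" "\<And>\<sigma> i. \<lbrakk>\<sigma> \<in> K; i \<in> \<sigma>\<rbrakk> \<Longrightarrow> 0 < w \<sigma> \<bullet> a i"
    by metis
  \<comment> \<open>Positive iff every index of relative weight at least \<open>\<epsilon>\<close> belongs to \<open>\<sigma>\<close>; this holds for the full support.\<close>
  define \<psi> where "\<psi> = (\<lambda>\<sigma> x. \<Prod>i \<in> {1..m} - \<sigma>. max 0 (\<epsilon> * s x - \<phi> i x))"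
  define X where "X = (\<lambda>x. \<Sum>\<sigma> \<in> K. \<psi> \<sigma> x *\<^sub>R w \<sigma>)"
  define \<phi>' where "\<phi>' = (\<lambda>i x. max 0 (\<phi> i x - \<epsilon> * s x))"
  have \<phi>c: "continuous_map T euclideanreal (\<phi> i)" and \<phi>0: "\<And>x. x \<in> topspace T \<Longrightarrow> 0 \<le> \<phi> i x"
    if "i \<in> {1..m}" for i using \<phi> that by (auto simp: weight_family_def)
  have sc: "continuous_map T euclideanreal s"
    unfolding s_def using \<phi>c by (intro continuous_map_sum) auto
  have spos: "0 < s x" if "x \<in> topspace T" for x using \<phi> that by (simp add: weight_family_def s_def)
  have \<psi>c: "continuous_map T euclideanreal (\<psi> \<sigma>)" for \<sigma>
    unfolding \<psi>_def using \<phi>c sc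
    by (intro continuous_map_prod continuous_map_real_max continuous_map_diff continuous_map_real_mult) auto
  have Xc: "continuous_map T euclidean X"
    unfolding X_def using finK by (intro continuous_map_sum continuous_map_scaleR \<psi>c) auto
  have XL: "X x \<in> ?L" for x unfolding X_def using w(1) by (intro span_sum span_scale) auto
  have big: "\<exists>i \<in> {1..m}. \<epsilon> * s x < \<phi> i x" if x: "x \<in> topspace T" for x
  proof (rule ccontr)
    assume "\<not> ?thesis"
    then have "s x \<le> (\<Sum>i = 1..m. \<epsilon> * s x)" unfolding s_def by (intro sum_mono) force
    also have "\<dots> = (real m * \<epsilon>) * s x" by simp
    also have "\<dots> < 1 * s x" using spos [OF x] by (intro mult_strict_right_mono) (auto simp: \<epsilon>_def)
    finally show False by simp
  qed
  have \<phi>': "weight_family T m \<phi>'"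
    unfolding weight_family_def
  proof (intro conjI ballI)
    show "continuous_map T euclideanreal (\<phi>' i)" if "i \<in> {1..m}" for i
      unfolding \<phi>'_def using \<phi>c [OF that] sc
      by (intro continuous_map_real_max continuous_map_diff continuous_map_real_mult) auto
    show "0 \<le> \<phi>' i x" for i x by (simp add: \<phi>'_def)
    fix x assume "x \<in> topspace T"
    then obtain i where "i \<in> {1..m}" "\<epsilon> * s x < \<phi> i x" using big by blast
    then show "0 < (\<Sum>i = 1..m. \<phi>' i x)" by (intro sum_pos2 [of _ i]) (auto simp: \<phi>'_def)
  qed
  have supp': "weight_support m \<phi>' x \<subseteq> weight_support m \<phi> x" if x: "x \<in> topspace T" for x
  proof
    fix i assume "i \<in> weight_support m \<phi>' x"
    then have "i \<in> {1..m}" "\<epsilon> * s x < \<phi> i x" by (auto simp: weight_support_def \<phi>'_def max_def split: if_splits)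
    moreover have "0 < \<epsilon> * s x" using spos [OF x] by (simp add: \<epsilon>_def)
    ultimately show "i \<in> weight_support m \<phi> x" by (auto simp: weight_support_def)
  qed
  have Xpos: "0 < X x \<bullet> a i" if x: "x \<in> topspace T" and i: "i \<in> weight_support m \<phi>' x" for x i
  proof -
    have i': "i \<in> {1..m}" "\<epsilon> * s x < \<phi> i x" using i by (auto simp: weight_support_def \<phi>'_def max_def split: if_splits)
    let ?\<tau> = "weight_support m \<phi> x"
    have \<tau>K: "?\<tau> \<in> K" using free [OF x] by (auto simp: K_def weight_support_def)
    have "0 < \<epsilon> * s x" using spos [OF x] by (simp add: \<epsilon>_def)
    then have \<psi>\<tau>: "0 < \<psi> ?\<tau> x" unfolding \<psi>_def by (intro prod_pos) (auto simp: weight_support_def)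
    have \<psi>0: "0 \<le> \<psi> \<sigma> x" for \<sigma> unfolding \<psi>_def by (intro prod_nonneg) auto
    have ge: "0 \<le> \<psi> \<sigma> x * (w \<sigma> \<bullet> a i)" if "\<sigma> \<in> K" for \<sigma>
    proof (cases "i \<in> \<sigma>")
      case True then show ?thesis using w(2) [OF that True] \<psi>0 by simp
    next
      case False
      then have "\<psi> \<sigma> x = 0" unfolding \<psi>_def using i' by (intro prod_zero) (auto intro!: bexI [of _ i])
      then show ?thesis by simp
    qed
    have "0 < \<psi> ?\<tau> x * (w ?\<tau> \<bullet> a i)"
      using \<psi>\<tau> w(2) [OF \<tau>K] supp' [OF x] i by auto
    then have "0 < (\<Sum>\<sigma> \<in> K. \<psi> \<sigma> x * (w \<sigma> \<bullet> a i))"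
      using finK \<tau>K ge by (intro sum_pos2 [of _ ?\<tau>]) auto
    then show ?thesis by (simp add: X_def inner_sum_left)
  qed
  have wsX: "0 < weighted_sum m a \<phi>' x \<bullet> X x" if x: "x \<in> topspace T" for x
  proof -
    obtain i where i: "i \<in> {1..m}" "\<epsilon> * s x < \<phi> i x" using big [OF x] by blast
    then have "i \<in> weight_support m \<phi>' x" by (auto simp: weight_support_def \<phi>'_def)
    then have "0 < \<phi>' i x * (a i \<bullet> X x)" using Xpos [OF x] i by (simp add: \<phi>'_def inner_commute)
    moreover have "0 \<le> \<phi>' j x * (a j \<bullet> X x)" if "j \<in> {1..m}" for j
    proof (cases "\<phi>' j x = 0")
      case False
      then have "j \<in> weight_support m \<phi>' x" using that by (simp add: weight_support_def)
      then have "0 < a j \<bullet> X x" using Xpos [OF x] by (simp add: inner_commute)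
      moreover have "0 \<le> \<phi>' j x" by (simp add: \<phi>'_def)
      ultimately show ?thesis by simp
    qed simp
    ultimately have "0 < (\<Sum>j = 1..m. \<phi>' j x * (a j \<bullet> X x))"
      using i by (intro sum_pos2 [of _ i]) auto
    then show ?thesis by (simp add: weighted_sum_def inner_sum_left)
  qed
  have X0: "X x \<noteq> 0" if "x \<in> topspace T" for x using wsX [OF that] by auto
  have 1: "homotopic_maps T ?SL (\<lambda>x. sgn (weighted_sum m a \<phi> x)) (\<lambda>x. sgn (weighted_sum m a \<phi>' x))"
  proof (rule weighted_sums_homotopic [OF L \<phi> \<phi>'])
    show "\<exists>\<sigma>. origin_free a \<sigma> \<and> weight_support m \<phi> x \<subseteq> \<sigma> \<and> weight_support m \<phi>' x \<subseteq> \<sigma>" if "x \<in> topspace T" for x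
      using free [OF that] supp' [OF that] by (intro exI [of _ "weight_support m \<phi> x"]) simp
  qed
  have 2: "homotopic_maps T ?SL (\<lambda>x. sgn (weighted_sum m a \<phi>' x)) (\<lambda>x. sgn (X x))"
  proof (rule homotopic_sgn_segment [OF L(1) weighted_sum_continuous [OF \<phi>'] weighted_sum_in_span Xc XL])
    fix x assume x: "x \<in> topspace T"
    show "0 \<notin> closed_segment (weighted_sum m a \<phi>' x) (X x)"
    proof
      assume "0 \<in> closed_segment (weighted_sum m a \<phi>' x) (X x)"
      then obtain t where t: "0 \<le> t" "t \<le> 1" "0 = (1 - t) *\<^sub>R weighted_sum m a \<phi>' x + t *\<^sub>R X x"
        by (auto simp: in_segment)
      have "0 = (1 - t) * (weighted_sum m a \<phi>' x \<bullet> X x) + t * (X x \<bullet> X x)"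
        using arg_cong [OF t(3), of "\<lambda>y. y \<bullet> X x"] by (simp add: inner_add_left)
      moreover have "0 < (1 - t) * p + t * q" if "0 < p" "0 < q" for p q
        using t(1,2) that by (cases "t = 0") (auto intro: add_nonneg_pos)
      from this [OF wsX [OF x]] have "0 < (1 - t) * (weighted_sum m a \<phi>' x \<bullet> X x) + t * (X x \<bullet> X x)"
        using X0 [OF x] by simp
      ultimately show False by simp
    qed
  qed
  let ?h = "comparison_map m a a'"
  have "homotopic_maps T unit_sphere (?h \<circ> (\<lambda>x. sgn (weighted_sum m a \<phi> x))) (?h \<circ> (\<lambda>x. sgn (X x)))"
    by (rule homotopic_with_compose_continuous_map_left [OF homotopic_with_trans [OF 1 2] ch]) auto
  moreover have "homotopic_maps T unit_sphere (\<lambda>x. sgn (weighted_sum m a' \<phi> x)) (?h \<circ> (\<lambda>x. sgn (X x)))"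
  proof -
    have "homotopic_maps T unit_sphere (\<lambda>x. sgn (weighted_sum m a' \<phi> x)) (\<lambda>x. sgn (weighted_sum m a' \<phi>' x))"
      unfolding us
    proof (rule weighted_sums_homotopic [OF _ _ \<phi> \<phi>'])
      fix x assume x: "x \<in> topspace T"
      have "origin_free a' (weight_support m \<phi> x)"
        by (rule iffD1 [OF equiv [OF weight_support_subset] free [OF x]])
      then show "\<exists>\<sigma>. origin_free a' \<sigma> \<and> weight_support m \<phi> x \<subseteq> \<sigma> \<and> weight_support m \<phi>' x \<subseteq> \<sigma>"
        using supp' [OF x] by blast
    qed auto
    moreover have "homotopic_maps T unit_sphere (\<lambda>x. sgn (weighted_sum m a' \<phi>' x)) (?h \<circ> (\<lambda>x. sgn (X x)))"
    proof -
      have cX: "continuous_map T ?SL (\<lambda>x. sgn (X x))"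
        using 2 homotopic_with_imp_continuous_maps by blast
      let ?\<theta> = "\<lambda>i x. positive_part_weight a i (sgn (X x))"
      have \<theta>: "weight_family T m ?\<theta>"
        unfolding weight_family_def
      proof (intro conjI ballI)
        show "continuous_map T euclideanreal (?\<theta> i)" if "i \<in> {1..m}" for i
          using continuous_map_compose [OF cX, of euclideanreal "positive_part_weight a i"] wf that
          by (simp add: weight_family_def o_def)
        have "sgn (X x) \<in> topspace ?SL" if "x \<in> topspace T" for x
          using cX that by (auto simp: continuous_map_def)
        then show "0 \<le> ?\<theta> i x" "0 < (\<Sum>i = 1..m. ?\<theta> i x)" if "x \<in> topspace T" for i x
          using wf that unfolding weight_family_def by (simp add: positive_part_weight_def, blast)
      qed
      have "weight_support m \<phi>' x \<subseteq> weight_support m ?\<theta> x" if x: "x \<in> topspace T" for x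
      proof
        fix i assume i: "i \<in> weight_support m \<phi>' x"
        then have "0 < sgn (X x) \<bullet> a i" using Xpos [OF x i] X0 [OF x] by (simp add: sgn_div_norm)
        then show "i \<in> weight_support m ?\<theta> x" using i by (simp add: weight_support_def positive_part_weight_def)
      qed
      moreover have "origin_free a' (weight_support m ?\<theta> x)" for x
        using supp_free' [of "sgn (X x)"] by (simp add: weight_support_def)
      ultimately have "homotopic_maps T unit_sphere (\<lambda>x. sgn (weighted_sum m a' \<phi>' x)) (\<lambda>x. sgn (weighted_sum m a' ?\<theta> x))"
        unfolding us by (intro weighted_sums_homotopic [OF _ _ \<phi>' \<theta>]) auto
      then show ?thesis by (simp add: comparison_map_def weighted_sum_def o_def)
    qed
    ultimately show ?thesis by (rule homotopic_with_trans)
  qed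
  ultimately show "homotopic_maps T unit_sphere (\<lambda>x. sgn (weighted_sum m a' \<phi> x))
      (?h \<circ> (\<lambda>x. sgn (weighted_sum m a \<phi> x)))"
    using homotopic_with_trans homotopic_with_sym by blast
qed

section \<open>Two configurations with the same balanced sets\<close>

lemma r_balanced_iff: "r_balanced r (v ` \<sigma>) \<longleftrightarrow> \<not> origin_free (\<lambda>i. v i - r) \<sigma>"
proof -
  have "(\<lambda>i. v i - r) ` \<sigma> = (+) (- r) ` (v ` \<sigma>)" by (auto simp: image_image)
  then have "convex hull ((\<lambda>i. v i - r) ` \<sigma>) = (+) (- r) ` (convex hull (v ` \<sigma>))"
    using convex_hull_translation [of "- r" "v ` \<sigma>"] by simp
  then show ?thesis by (auto simp: r_balanced_def origin_free_def image_iff)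
qed

lemma cover_map_eq_sgn:
  assumes "(\<Sum>i = 1..m. \<phi> i x) = 1"
  shows "cover_map m \<phi> v r x = sgn (weighted_sum m (\<lambda>i. v i - r) \<phi> x)"
proof -
  have "weighted_sum m (\<lambda>i. v i - r) \<phi> x = (\<Sum>i = 1..m. \<phi> i x *\<^sub>R v i) - (\<Sum>i = 1..m. \<phi> i x) *\<^sub>R r"
    by (simp add: weighted_sum_def scaleR_diff_right sum_subtractf scaleR_sum_left)
  then show ?thesis using assms by (simp add: cover_map_def radial_projection_def sgn_div_norm)
qed

text \<open>
  Pairing a convex combination equal to \<open>0\<close> with \<open>w\<close> shows that \<open>a j\<close> occurs in it with coefficient zero. Thus the
  complex of origin-free sets is a cone with apex \<open>j\<close>.
\<close>

lemma separates_some_cone: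
  fixes a :: "nat \<Rightarrow> 'v::euclidean_space"
  assumes "separates_some m a"
  obtains j where "j \<in> {1..m}" "\<And>\<sigma>. \<lbrakk>\<sigma> \<subseteq> {1..m}; origin_free a \<sigma>\<rbrakk> \<Longrightarrow> origin_free a (insert j \<sigma>)"
proof -
  obtain w j where j: "j \<in> {1..m}" "0 < w \<bullet> a j" and w: "\<And>i. i \<in> {1..m} \<Longrightarrow> 0 \<le> w \<bullet> a i"
    using assms by (auto simp: separates_some_def)
  have "origin_free a (insert j \<sigma>)" if \<sigma>: "\<sigma> \<subseteq> {1..m}" "origin_free a \<sigma>" for \<sigma>
  proof (cases "\<sigma> = {}")
    case True then show ?thesis using j(2) by (auto simp: origin_free_def)
  next
    case False
    show ?thesis
      unfolding origin_free_def
    proof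
      assume "0 \<in> convex hull (a ` insert j \<sigma>)"
      then obtain u t y where u: "0 \<le> u" "0 \<le> t" "u + t = 1" "y \<in> convex hull (a ` \<sigma>)" "0 = u *\<^sub>R a j + t *\<^sub>R y"
        using False by (auto simp: convex_hull_insert)
      have "convex hull (a ` \<sigma>) \<subseteq> {y. 0 \<le> w \<bullet> y}"
        by (rule hull_minimal) (use w \<sigma> convex_halfspace_ge [of 0 w] in auto)
      then have "0 \<le> t * (w \<bullet> y)" using u by auto
      moreover have "0 \<le> u * (w \<bullet> a j)" using u(1) j(2) by simp
      moreover have "u * (w \<bullet> a j) + t * (w \<bullet> y) = 0"
        using arg_cong [OF u(5), of "\<lambda>z. w \<bullet> z"] by (simp add: inner_add_right)
      ultimately have "u * (w \<bullet> a j) = 0" by linarith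
      then have "u = 0" using j(2) by simp
      then have "y = 0" using u by simp
      then show False using u(4) \<sigma>(2) by (simp add: origin_free_def)
    qed
  qed
  then show thesis using that j(1) by blast
qed

text \<open>
  All weights are moved to the apex of the cone.
\<close>

lemma cone_nullhomotopic:
  fixes a :: "nat \<Rightarrow> 'v::euclidean_space"
  assumes j: "j \<in> {1..m}" and cone: "\<And>\<sigma>. \<lbrakk>\<sigma> \<subseteq> {1..m}; origin_free a \<sigma>\<rbrakk> \<Longrightarrow> origin_free a (insert j \<sigma>)"
    and \<phi>: "weight_family T m \<phi>"
    and free: "\<And>x. x \<in> topspace T \<Longrightarrow> origin_free a (weight_support m \<phi> x)" and ne: "topspace T \<noteq> {}"
  shows "\<exists>c \<in> sphere 0 1. homotopic_maps T unit_sphere (\<lambda>x. sgn (weighted_sum m a \<phi> x)) (\<lambda>_. c)"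
proof -
  define \<psi> where "\<psi> = (\<lambda>i (x::'a). if i = j then 1 else 0::real)"
  have \<psi>: "weight_family T m \<psi>"
    unfolding weight_family_def
  proof (intro conjI ballI)
    show "continuous_map T euclideanreal (\<psi> i)" for i by (simp add: \<psi>_def)
    show "0 \<le> \<psi> i x" for i x by (simp add: \<psi>_def)
    show "0 < (\<Sum>i = 1..m. \<psi> i x)" for x using j by (simp add: \<psi>_def)
  qed
  have \<psi>a: "weighted_sum m a \<psi> x = a j" for x
  proof -
    have "weighted_sum m a \<psi> x = (\<Sum>i = 1..m. if i = j then a i else 0)"
      unfolding weighted_sum_def by (rule sum.cong) (auto simp: \<psi>_def)
    then show ?thesis using j by simp
  qed
  have insert_free: "origin_free a (insert j (weight_support m \<phi> x))" if "x \<in> topspace T" for x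
    using cone [OF weight_support_subset free [OF that]] .
  then have "origin_free a {j}" using ne origin_free_subset [of a _ "{j}"] by blast
  then have "a j \<noteq> 0" by (auto simp: origin_free_def)
  moreover have "homotopic_maps T (top_of_set (sphere 0 1 \<inter> UNIV))
      (\<lambda>x. sgn (weighted_sum m a \<phi> x)) (\<lambda>x. sgn (weighted_sum m a \<psi> x))"
  proof (rule weighted_sums_homotopic [OF _ _ \<phi> \<psi>])
    show "\<exists>\<sigma>. origin_free a \<sigma> \<and> weight_support m \<phi> x \<subseteq> \<sigma> \<and> weight_support m \<psi> x \<subseteq> \<sigma>" if "x \<in> topspace T" for x
      using insert_free [OF that]
      by (intro exI [of _ "insert j (weight_support m \<phi> x)"]) (auto simp: weight_support_def \<psi>_def)
  qed auto
  ultimately show ?thesis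
    by (intro bexI [of _ "sgn (a j)"]) (auto simp: \<psi>a unit_sphere_def norm_sgn)
qed

lemma sphere_map_null_through_lowdim:
  fixes L :: "'v::euclidean_space set" and h :: "'v \<Rightarrow> 'v"
  assumes L: "subspace L" "L \<noteq> UNIV" and ne: "topspace T \<noteq> {}"
    and g: "continuous_map T (top_of_set (sphere 0 1 \<inter> L)) g"
    and h: "continuous_map (top_of_set (sphere 0 1 \<inter> L)) unit_sphere h"
  shows "\<exists>c \<in> sphere 0 1. homotopic_maps T unit_sphere (h \<circ> g) (\<lambda>_. c)"
proof -
  have us: "unit_sphere = top_of_set (sphere 0 1 \<inter> (UNIV :: 'v set))" by (simp add: unit_sphere_def)
  have "dim L < dim (UNIV :: 'v set)"
    using L dim_eq_full [of L] dim_subset_UNIV [of L] by (metis dim_UNIV le_neq_implies_less span_eq_iff)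
  moreover have "continuous_on (sphere 0 1 \<inter> L) h" "h \<in> sphere 0 1 \<inter> L \<rightarrow> sphere 0 1 \<inter> UNIV"
    using h by (auto simp: us)
  ultimately obtain c where
    "homotopic_with_canon (\<lambda>x. True) (sphere 0 1 \<inter> L) (sphere 0 1 \<inter> UNIV) h (\<lambda>x. c)"
    using spheremap_lemma2 [OF L(1) subspace_UNIV] by blast
  then have "homotopic_maps T unit_sphere (h \<circ> g) ((\<lambda>x. c) \<circ> g)"
    unfolding us by (rule homotopic_with_compose_continuous_map_right [OF _ g]) auto
  then have hom: "homotopic_maps T unit_sphere (h \<circ> g) (\<lambda>_. c)" by (simp add: o_def)
  then have "continuous_map T unit_sphere (\<lambda>_. c)" using homotopic_with_imp_continuous_maps by blast
  then have "c \<in> sphere 0 1" using ne by (auto simp: continuous_map_def unit_sphere_def)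
  with hom show ?thesis by blast
qed

text \<open>
  The composite arises from \<open>comparison_map_homotopic\<close> for the hemisphere weights of \<open>a\<close> on the sphere itself. Their
  weighted sum of the vectors \<open>a i\<close> has positive inner product with the point \<open>x\<close>, so it gives a map homotopic
  to the identity.
\<close>

lemma comparison_map_inverse:
  fixes a a' :: "nat \<Rightarrow> 'v::euclidean_space"
  assumes equiv: "\<And>\<sigma>. \<sigma> \<subseteq> {1..m} \<Longrightarrow> origin_free a \<sigma> \<longleftrightarrow> origin_free a' \<sigma>"
    and ns: "\<not> separates_some m a" "\<not> separates_some m a'"
    and full: "span (a ` {1..m}) = UNIV" "span (a' ` {1..m}) = UNIV"
  shows "homotopic_maps unit_sphere unit_sphere (comparison_map m a' a \<circ> comparison_map m a a') id"
proof -
  let ?p = "positive_part_weight a"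
  have us: "unit_sphere = top_of_set (sphere 0 1 \<inter> (UNIV :: 'v set))" by (simp add: unit_sphere_def)
  have wf: "weight_family unit_sphere m ?p"
    unfolding us by (rule positive_part_weight_family [OF ns(1)]) (use full in simp)
  have free: "origin_free a (weight_support m ?p x)" for x
    unfolding positive_part_support by (rule positive_side_origin_free) auto
  have free': "origin_free a' (weight_support m ?p x)" for x
    by (rule iffD1 [OF equiv [OF weight_support_subset] free])
  have "homotopic_maps unit_sphere unit_sphere (\<lambda>x. sgn (weighted_sum m a ?p x))
      (comparison_map m a' a \<circ> (\<lambda>x. sgn (weighted_sum m a' ?p x)))"
    using comparison_map_homotopic(3) [OF _ ns(2) wf, of a] equiv free' by blast
  then have 1: "homotopic_maps unit_sphere unit_sphere (\<lambda>x. sgn (weighted_sum m a ?p x))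
      (comparison_map m a' a \<circ> comparison_map m a a')"
    by (simp add: comparison_map_def [abs_def] o_def)
  have "homotopic_maps unit_sphere (top_of_set (sphere 0 1 \<inter> (UNIV :: 'v set)))
      (\<lambda>x. sgn (weighted_sum m a ?p x)) (\<lambda>x. sgn (id x))"
  proof (rule homotopic_sgn_segment [OF _ weighted_sum_continuous [OF wf]])
    fix x :: 'v assume "x \<in> topspace unit_sphere"
    then have "x \<noteq> 0" by (auto simp: unit_sphere_def)
    have "0 < weighted_sum m a ?p x \<bullet> x"
    proof -
      obtain i where i: "i \<in> {1..m}" "0 < x \<bullet> a i"
        using exists_positive_inner [OF ns(1), of x] full \<open>x \<noteq> 0\<close> by auto
      have "0 < (\<Sum>i = 1..m. ?p i x * (a i \<bullet> x))"
        by (rule sum_pos2 [of _ i]) (use i in \<open>auto simp: positive_part_weight_def max_def inner_commute\<close>)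
      then show ?thesis by (simp add: weighted_sum_def inner_sum_left)
    qed
    then have pos: "weighted_sum m a ?p x \<in> {y. 0 < x \<bullet> y}" "x \<in> {y. 0 < x \<bullet> y}"
      using \<open>x \<noteq> 0\<close> by (auto simp: inner_commute)
    have "closed_segment (weighted_sum m a ?p x) x \<subseteq> {y. 0 < x \<bullet> y}"
      by (rule closed_segment_subset [OF pos]) (rule convex_halfspace_gt)
    then show "0 \<notin> closed_segment (weighted_sum m a ?p x) (id x)" by auto
  qed (auto simp: unit_sphere_def continuous_map_in_subtopology)
  then have "homotopic_maps unit_sphere unit_sphere (\<lambda>x. sgn (weighted_sum m a ?p x)) id"
    unfolding us by (rule homotopic_with_eq) (auto simp: sgn_div_norm)
  with 1 show ?thesis using homotopic_with_trans homotopic_with_sym by blast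
qed

text \<open>
  In the first alternative one of the configurations has \<open>separates_some\<close> or spans a proper subspace; this is passed on
  to the other one by the cone property or by the factorisation through the lower-dimensional sphere.
\<close>

lemma sphere_maps_dichotomy:
  fixes a a' :: "nat \<Rightarrow> 'v::euclidean_space"
  assumes equiv: "\<And>\<sigma>. \<sigma> \<subseteq> {1..m} \<Longrightarrow> origin_free a \<sigma> \<longleftrightarrow> origin_free a' \<sigma>"
    and \<phi>: "weight_family T m \<phi>"
    and free: "\<And>x. x \<in> topspace T \<Longrightarrow> origin_free a (weight_support m \<phi> x)" and ne: "topspace T \<noteq> {}"
  shows "(\<exists>c \<in> sphere 0 1. \<exists>c' \<in> sphere 0 1.
            homotopic_maps T unit_sphere (\<lambda>x. sgn (weighted_sum m a \<phi> x)) (\<lambda>_. c) \<and>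
            homotopic_maps T unit_sphere (\<lambda>x. sgn (weighted_sum m a' \<phi> x)) (\<lambda>_. c')) \<or>
         (\<exists>h k. continuous_map unit_sphere unit_sphere h \<and> continuous_map unit_sphere unit_sphere k \<and>
            homotopic_maps unit_sphere unit_sphere (k \<circ> h) id \<and>
            homotopic_maps T unit_sphere (\<lambda>x. sgn (weighted_sum m a' \<phi> x))
              (h \<circ> (\<lambda>x. sgn (weighted_sum m a \<phi> x))))"
    (is "?null a a' \<or> ?equivalence")
proof -
  have free': "origin_free a' (weight_support m \<phi> x)" if "x \<in> topspace T" for x
    by (rule iffD1 [OF equiv [OF weight_support_subset] free [OF that]])
  have null_sep: "?null b b'"
    if eq: "\<And>\<sigma>. \<sigma> \<subseteq> {1..m} \<Longrightarrow> origin_free b \<sigma> \<longleftrightarrow> origin_free b' \<sigma>"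
      and fr: "\<And>x. x \<in> topspace T \<Longrightarrow> origin_free b (weight_support m \<phi> x)"
              "\<And>x. x \<in> topspace T \<Longrightarrow> origin_free b' (weight_support m \<phi> x)"
      and sep: "separates_some m b" for b b' :: "nat \<Rightarrow> 'v"
  proof -
    obtain j where j: "j \<in> {1..m}" and cone: "\<And>\<sigma>. \<lbrakk>\<sigma> \<subseteq> {1..m}; origin_free b \<sigma>\<rbrakk> \<Longrightarrow> origin_free b (insert j \<sigma>)"
      using separates_some_cone [OF sep] by blast
    have cone': "origin_free b' (insert j \<sigma>)" if "\<sigma> \<subseteq> {1..m}" "origin_free b' \<sigma>" for \<sigma>
      using cone [of \<sigma>] eq [of \<sigma>] eq [of "insert j \<sigma>"] that j by auto
    show ?thesis
      using cone_nullhomotopic [OF j cone \<phi> fr(1) ne] cone_nullhomotopic [OF j cone' \<phi> fr(2) ne] by blast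
  qed
  have null_low: "?null b b'"
    if eq: "\<And>\<sigma>. \<sigma> \<subseteq> {1..m} \<Longrightarrow> origin_free b \<sigma> \<longleftrightarrow> origin_free b' \<sigma>"
      and fr: "\<And>x. x \<in> topspace T \<Longrightarrow> origin_free b (weight_support m \<phi> x)"
      and ns: "\<not> separates_some m b" and low: "span (b ` {1..m}) \<noteq> UNIV" for b b' :: "nat \<Rightarrow> 'v"
  proof -
    let ?L = "span (b ` {1..m})"
    note cm = comparison_map_homotopic [OF eq ns \<phi> fr]
    have incl: "continuous_map (top_of_set (sphere 0 1 \<inter> ?L)) unit_sphere id"
      by (auto simp: unit_sphere_def)
    obtain c where c: "c \<in> sphere 0 1"
      "homotopic_maps T unit_sphere (\<lambda>x. sgn (weighted_sum m b \<phi> x)) (\<lambda>_. c)"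
      using sphere_map_null_through_lowdim [OF subspace_span low ne cm(2) incl] by auto
    obtain c' where c': "c' \<in> sphere 0 1"
      "homotopic_maps T unit_sphere (comparison_map m b b' \<circ> (\<lambda>x. sgn (weighted_sum m b \<phi> x))) (\<lambda>_. c')"
      using sphere_map_null_through_lowdim [OF subspace_span low ne cm(2) cm(1)] by auto
    from c c'(1) homotopic_with_trans [OF cm(3) c'(2)] show ?thesis by blast
  qed
  have equiv': "\<And>\<sigma>. \<sigma> \<subseteq> {1..m} \<Longrightarrow> origin_free a' \<sigma> \<longleftrightarrow> origin_free a \<sigma>" using equiv by blast
  consider "separates_some m a" | "separates_some m a'"
    | "\<not> separates_some m a" "span (a ` {1..m}) \<noteq> UNIV"
    | "\<not> separates_some m a'" "span (a' ` {1..m}) \<noteq> UNIV"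
    | "\<not> separates_some m a" "\<not> separates_some m a'" "span (a ` {1..m}) = UNIV" "span (a' ` {1..m}) = UNIV"
    by blast
  then show ?thesis
  proof cases
    case 1 then show ?thesis using null_sep [OF equiv free free'] by blast
  next
    case 2 then show ?thesis using null_sep [OF equiv' free' free] by blast
  next
    case 3 then show ?thesis using null_low [OF equiv free] by blast
  next
    case 4 then show ?thesis using null_low [OF equiv' free'] by blast
  next
    case 5
    note cm = comparison_map_homotopic [OF equiv 5(1) \<phi> free]
    note cm' = comparison_map_homotopic [OF equiv' 5(2) \<phi> free']
    have ?equivalence
      using cm(1,3) cm'(1) comparison_map_inverse [OF equiv 5] unfolding 5(3,4)
      by (intro exI [of _ "comparison_map m a a'"] exI [of _ "comparison_map m a' a"])
         (auto simp: unit_sphere_def)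
    then show ?thesis ..
  qed
qed

text \<open>
  The reflection is needed in dimension one, where the sphere consists of two points that it exchanges.
\<close>

lemma constant_maps_homotopic_up_to_reflection:
  fixes c c' u :: "'v::euclidean_space"
  assumes c: "c \<in> sphere 0 1" "c' \<in> sphere 0 1" and u: "norm u = 1"
  shows "homotopic_maps T unit_sphere (\<lambda>_. c) (\<lambda>_. c') \<or>
         homotopic_maps T unit_sphere (\<lambda>_. c) (\<lambda>_. reflect_in u c')"
proof (cases "2 \<le> DIM('v)")
  case True
  then have "path_connected (sphere (0::'v) 1)" by (rule path_connected_sphere)
  then have "path_component (sphere 0 1) c c'" using c by (simp add: path_connected_component)
  then obtain p where "path p" "path_image p \<subseteq> sphere 0 1" "pathstart p = c" "pathfinish p = c'"
    by (auto simp: path_component_def)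
  then have "pathin unit_sphere p \<and> p 0 = c \<and> p 1 = c'"
    unfolding unit_sphere_def pathin_canon_iff by (auto simp: path_image_def pathstart_def pathfinish_def)
  then have "path_component_of unit_sphere c c'" unfolding path_component_of_def by blast
  then show ?thesis by (simp add: homotopic_constant_maps)
next
  case False
  then have "card (Basis :: 'v set) = 1" using DIM_positive [where 'a = 'v] by linarith
  then obtain b :: 'v where b: "Basis = {b}" by (auto simp: card_1_singleton_iff)
  have unit: "x = b \<or> x = - b" if "norm x = 1" for x :: 'v
  proof -
    have x: "x = (x \<bullet> b) *\<^sub>R b" using euclidean_representation [of x] by (simp add: b)
    have "norm b = 1" using norm_Basis [of b] by (simp add: b)
    then have "\<bar>x \<bullet> b\<bar> = 1" using arg_cong [OF x, of norm] that by simp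
    then consider "x \<bullet> b = 1" | "x \<bullet> b = -1" by linarith
    then show ?thesis using x by cases auto
  qed
  have bb: "b \<bullet> b = 1" using inner_same_Basis [of b] by (simp add: b)
  have "reflect_in u c' = - c'"
    using unit [OF u] unit [of c'] c(2) bb by (auto simp: reflect_in_def scaleR_2)
  then have "c = c' \<or> c = reflect_in u c'" using unit [of c] unit [of c'] c by auto
  then show ?thesis
    using c by (auto simp: unit_sphere_def)
qed

lemma sphere_maps_equal_up_to_reflection:
  fixes a a' :: "nat \<Rightarrow> 'v::euclidean_space"
  assumes equiv: "\<And>\<sigma>. \<sigma> \<subseteq> {1..m} \<Longrightarrow> origin_free a \<sigma> \<longleftrightarrow> origin_free a' \<sigma>"
    and \<phi>: "weight_family T m \<phi>"
    and free: "\<And>x. x \<in> topspace T \<Longrightarrow> origin_free a (weight_support m \<phi> x)"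
    and u: "norm u = 1" "sphere_degree (reflect_in u) = -1"
  defines "g \<equiv> \<lambda>x. sgn (weighted_sum m a \<phi> x)" and "g' \<equiv> \<lambda>x. sgn (weighted_sum m a' \<phi> x)"
  shows "homotopic_maps T unit_sphere g g' \<or>
         homotopic_maps T unit_sphere g (reflect_in u \<circ> g')"
proof (cases "topspace T = {}")
  case True
  then show ?thesis by (auto simp: null_topspace_iff_trivial homotopic_on_empty)
next
  case False
  let ?\<rho> = "reflect_in u"
  have c\<rho>: "continuous_map unit_sphere unit_sphere ?\<rho>" by (rule continuous_map_reflect_in [OF u(1)])
  have \<rho>\<rho>: "?\<rho> \<circ> ?\<rho> = id" using reflect_in_involution [OF u(1)] by auto
  consider (null) c c' where "c \<in> sphere 0 1" "c' \<in> sphere 0 1"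
      "homotopic_maps T unit_sphere g (\<lambda>_. c)" "homotopic_maps T unit_sphere g' (\<lambda>_. c')"
    | (equivalence) h k where "continuous_map unit_sphere unit_sphere h" "continuous_map unit_sphere unit_sphere k"
      "homotopic_maps unit_sphere unit_sphere (k \<circ> h) id"
      "homotopic_maps T unit_sphere g' (h \<circ> g)"
    using sphere_maps_dichotomy [OF equiv \<phi> free False] unfolding g_def g'_def by blast
  then show ?thesis
  proof cases
    case null
    have "homotopic_maps T unit_sphere (?\<rho> \<circ> g') (?\<rho> \<circ> (\<lambda>_. c'))"
      by (rule homotopic_with_compose_continuous_map_left [OF null(4) c\<rho>]) auto
    then have "homotopic_maps T unit_sphere (\<lambda>_. ?\<rho> c') (?\<rho> \<circ> g')"
      by (simp add: o_def homotopic_with_sym)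
    then show ?thesis
      using constant_maps_homotopic_up_to_reflection [OF null(1,2) u(1), of T] null(3,4)
      by (meson homotopic_with_sym homotopic_with_trans)
  next
    case equivalence
    have g: "continuous_map T unit_sphere g"
    proof -
      have "homotopic_maps T (top_of_set (sphere 0 1 \<inter> UNIV)) g g"
        unfolding g_def by (rule weighted_sums_homotopic [OF _ _ \<phi> \<phi>]) (use free in auto)
      then show ?thesis using homotopic_with_imp_continuous_maps by (fastforce simp: unit_sphere_def)
    qed
    have he: "homotopy_equivalence_map unit_sphere unit_sphere ?\<rho>"
      unfolding homotopy_equivalence_map_def using c\<rho> by (intro conjI exI [of _ ?\<rho>]) (simp_all only: \<rho>\<rho> homotopic_with_refl continuous_map_id)
    from homotopy_equivalence_homotopic_id_or_reversing [OF equivalence(1-3) he u(2)]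
    show ?thesis
    proof
      assume "homotopic_maps unit_sphere unit_sphere h id"
      then have "homotopic_maps T unit_sphere (h \<circ> g) (id \<circ> g)"
        by (rule homotopic_with_compose_continuous_map_right [OF _ g]) auto
      then have "homotopic_maps T unit_sphere g' g"
        using homotopic_with_trans [OF equivalence(4)] by simp
      then show ?thesis by (simp add: homotopic_with_sym)
    next
      assume "homotopic_maps unit_sphere unit_sphere h ?\<rho>"
      then have "homotopic_maps T unit_sphere (h \<circ> g) (?\<rho> \<circ> g)"
        by (rule homotopic_with_compose_continuous_map_right [OF _ g]) auto
      then have "homotopic_maps T unit_sphere g' (?\<rho> \<circ> g)"
        by (rule homotopic_with_trans [OF equivalence(4)])
      then have "homotopic_maps T unit_sphere (?\<rho> \<circ> g') (?\<rho> \<circ> (?\<rho> \<circ> g))"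
        by (rule homotopic_with_compose_continuous_map_left [OF _ c\<rho>]) auto
      then have "homotopic_maps T unit_sphere (?\<rho> \<circ> g') g"
        by (simp add: o_assoc \<rho>\<rho>)
      then show ?thesis by (simp add: homotopic_with_sym)
    qed
  qed
qed

section \<open>Classes and degrees of covers\<close>

lemma homotopy_class_eq_iff:
  assumes "continuous_map X Y g"
  shows "homotopy_class X Y g = homotopy_class X Y g' \<longleftrightarrow> homotopic_maps X Y g g'"
proof
  assume "homotopy_class X Y g = homotopy_class X Y g'"
  moreover have "g \<in> homotopy_class X Y g" using assms by (simp add: homotopy_class_def)
  ultimately show "homotopic_maps X Y g g'"
    by (simp add: homotopy_class_def homotopic_with_sym)
next
  assume "homotopic_maps X Y g g'"
  then show "homotopy_class X Y g = homotopy_class X Y g'"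
    unfolding homotopy_class_def using homotopic_with_trans homotopic_with_sym by blast
qed

lemma inv_class_homotopy_class:
  assumes f: "continuous_map unit_sphere unit_sphere f" and g: "continuous_map T unit_sphere g"
  shows "inv_class T f (homotopy_class T unit_sphere g) = homotopy_class T unit_sphere (f \<circ> g)"
proof -
  have "homotopy_class T unit_sphere (f \<circ> h) = homotopy_class T unit_sphere (f \<circ> g)"
    if "h \<in> homotopy_class T unit_sphere g" for h
  proof -
    have "homotopic_maps T unit_sphere h g"
      using that by (simp add: homotopy_class_def homotopic_with_sym)
    then have hg: "homotopic_maps T unit_sphere (f \<circ> h) (f \<circ> g)"
      by (rule homotopic_with_compose_continuous_map_left [OF _ f]) auto
    then show ?thesis
      using homotopy_class_eq_iff [of T unit_sphere "f \<circ> h" "f \<circ> g"] homotopic_with_imp_continuous_maps by blast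
  qed
  moreover have "g \<in> homotopy_class T unit_sphere g" using g by (simp add: homotopy_class_def)
  ultimately show ?thesis unfolding inv_class_def by blast
qed

lemma partition_of_unity_weight_family:
  assumes "partition_of_unity T m F \<phi>"
  shows "weight_family T m \<phi>"
  using assms by (simp add: partition_of_unity_def weight_family_def)

lemma partition_of_unity_support:
  assumes \<phi>: "partition_of_unity T m F \<phi>" and x: "x \<in> topspace T"
  shows "weight_support m \<phi> x \<subseteq> {i \<in> {1..m}. x \<in> F i}"
proof
  fix i assume i: "i \<in> weight_support m \<phi> x"
  then have "x \<in> {x \<in> topspace T. \<phi> i x \<noteq> 0}" using x by (simp add: weight_support_def)
  then have "x \<in> T closure_of {x \<in> topspace T. \<phi> i x \<noteq> 0}"
    using closure_of_subset [of "{x \<in> topspace T. \<phi> i x \<noteq> 0}" T] by blast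
  then show "i \<in> {i \<in> {1..m}. x \<in> F i}"
    using \<phi> i by (auto simp: partition_of_unity_def weight_support_def)
qed

lemma no_balanced_simplex_origin_free:
  assumes "no_balanced_simplex T m F v r" "x \<in> topspace T"
  shows "origin_free (\<lambda>i. v i - r) {i \<in> {1..m}. x \<in> F i}"
proof -
  have "{i \<in> {1..m}. x \<in> F i} \<in> nerve T m F" using assms(2) by (auto simp: nerve_def)
  then show ?thesis using assms(1) by (simp add: no_balanced_simplex_def r_balanced_iff)
qed

lemma cover_maps_homotopic:
  assumes nb: "no_balanced_simplex T m F v r"
    and \<phi>: "partition_of_unity T m F \<phi>" and \<psi>: "partition_of_unity T m F \<psi>"
  shows "homotopic_maps T unit_sphere (cover_map m \<phi> v r) (cover_map m \<psi> v r)"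
proof -
  let ?a = "\<lambda>i. v i - r"
  have "homotopic_maps T (top_of_set (sphere 0 1 \<inter> UNIV))
      (\<lambda>x. sgn (weighted_sum m ?a \<phi> x)) (\<lambda>x. sgn (weighted_sum m ?a \<psi> x))"
  proof (rule weighted_sums_homotopic)
    show "\<exists>\<sigma>. origin_free ?a \<sigma> \<and> weight_support m \<phi> x \<subseteq> \<sigma> \<and> weight_support m \<psi> x \<subseteq> \<sigma>"
      if "x \<in> topspace T" for x
      using no_balanced_simplex_origin_free [OF nb that] partition_of_unity_support [OF \<phi> that]
        partition_of_unity_support [OF \<psi> that] by blast
  qed (use \<phi> \<psi> in \<open>auto intro: partition_of_unity_weight_family\<close>)
  then show ?thesis
    unfolding unit_sphere_def Int_UNIV_right
    by (rule homotopic_with_eq) (use \<phi> \<psi> in \<open>auto intro!: cover_map_eq_sgn simp: partition_of_unity_def\<close>)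
qed

lemma open_cover_class_eq:
  assumes nb: "no_balanced_simplex T m F v r" and \<phi>: "partition_of_unity T m F \<phi>"
  shows "open_cover_class T m F v r = homotopy_class T unit_sphere (cover_map m \<phi> v r)"
  unfolding open_cover_class_def
proof (rule the_equality)
  show "\<exists>\<psi>. partition_of_unity T m F \<psi> \<and>
      homotopy_class T unit_sphere (cover_map m \<phi> v r) = homotopy_class T unit_sphere (cover_map m \<psi> v r)"
    using \<phi> by blast
  fix C assume "\<exists>\<psi>. partition_of_unity T m F \<psi> \<and> C = homotopy_class T unit_sphere (cover_map m \<psi> v r)"
  then obtain \<psi> where \<psi>: "partition_of_unity T m F \<psi>" "C = homotopy_class T unit_sphere (cover_map m \<psi> v r)"
    by blast
  have h: "homotopic_maps T unit_sphere (cover_map m \<psi> v r) (cover_map m \<phi> v r)"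
    by (rule cover_maps_homotopic [OF nb \<psi>(1) \<phi>])
  then show "C = homotopy_class T unit_sphere (cover_map m \<phi> v r)"
    using homotopy_class_eq_iff homotopic_with_imp_continuous_maps \<psi>(2) by blast
qed

text \<open>
  Two enlargements with the same nerve are compared through their intersection, a partition of unity of which serves both.
\<close>

lemma closed_cover_class_eq:
  assumes N: "normal_space T" and nb: "no_balanced_simplex T m F v r"
    and U: "open_cover T m U" "\<And>i. i \<in> {1..m} \<Longrightarrow> F i \<subseteq> U i" "nerve T m U = nerve T m F"
    and cov: "closed_cover T m F"
  shows "closed_cover_class T m F v r = open_cover_class T m U v r"
  unfolding closed_cover_class_def
proof (rule the_equality)
  show "\<exists>W. open_cover T m W \<and> (\<forall>i\<in>{1..m}. F i \<subseteq> W i) \<and> nerve T m W = nerve T m F \<and>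
      open_cover_class T m U v r = open_cover_class T m W v r"
    using U by blast
  fix C assume "\<exists>W. open_cover T m W \<and> (\<forall>i\<in>{1..m}. F i \<subseteq> W i) \<and> nerve T m W = nerve T m F \<and>
      C = open_cover_class T m W v r"
  then obtain W where W: "open_cover T m W" "\<forall>i\<in>{1..m}. F i \<subseteq> W i" "nerve T m W = nerve T m F"
    and C: "C = open_cover_class T m W v r" by blast
  let ?V = "\<lambda>i. U i \<inter> W i"
  have "open_cover T m ?V"
    unfolding open_cover_def
  proof (intro conjI ballI)
    show "openin T (U i \<inter> W i)" if "i \<in> {1..m}" for i
      using U(1) W(1) that by (auto simp: open_cover_def)
    have "(\<Union>i\<in>{1..m}. U i \<inter> W i) \<subseteq> topspace T" using U(1) by (auto simp: open_cover_def)
    moreover have "topspace T \<subseteq> (\<Union>i\<in>{1..m}. U i \<inter> W i)"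
      using cov U(2) W(2) unfolding closed_cover_def by blast
    ultimately show "(\<Union>i\<in>{1..m}. U i \<inter> W i) = topspace T" by blast
  qed
  then obtain \<phi> where \<phi>: "partition_of_unity T m ?V \<phi>" using partition_of_unity_exists [OF N] by blast
  then have "partition_of_unity T m U \<phi>" "partition_of_unity T m W \<phi>"
    by (simp_all add: partition_of_unity_def)
  moreover have "no_balanced_simplex T m U v r" "no_balanced_simplex T m W v r"
    using nb U(3) W(3) by (simp_all add: no_balanced_simplex_def)
  ultimately show "C = open_cover_class T m U v r"
    using open_cover_class_eq C by metis
qed

lemma cover_class_representative:
  assumes N: "normal_space T" and cov: "open_cover T m F \<or> closed_cover T m F"
    and nb: "no_balanced_simplex T m F v r" and nb': "no_balanced_simplex T m F v' r'"
  obtains \<phi> where "weight_family T m \<phi>" "\<And>x. x \<in> topspace T \<Longrightarrow> (\<Sum>i = 1..m. \<phi> i x) = 1"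
    "\<And>x. x \<in> topspace T \<Longrightarrow> origin_free (\<lambda>i. v i - r) (weight_support m \<phi> x)"
    "cover_class T m F v r = homotopy_class T unit_sphere (cover_map m \<phi> v r)"
    "cover_class T m F v' r' = homotopy_class T unit_sphere (cover_map m \<phi> v' r')"
proof -
  obtain U where U: "open_cover T m U" "nerve T m U = nerve T m F"
    and cl: "cover_class T m F v r = open_cover_class T m U v r"
            "cover_class T m F v' r' = open_cover_class T m U v' r'"
  proof (cases "open_cover T m F")
    case True
    then show ?thesis by (intro that [of F]) (simp_all add: cover_class_def)
  next
    case False
    then have F: "closed_cover T m F" using cov by blast
    then obtain U where U: "open_cover T m U" "\<And>i. i \<in> {1..m} \<Longrightarrow> F i \<subseteq> U i" "nerve T m U = nerve T m F"
      using normal_space_swell_closed_cover [OF N] by blast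
    show ?thesis
      using False closed_cover_class_eq [OF N nb U F] closed_cover_class_eq [OF N nb' U F]
      by (intro that [of U] U) (simp_all add: cover_class_def)
  qed
  obtain \<phi> where \<phi>: "partition_of_unity T m U \<phi>" using partition_of_unity_exists [OF N U(1)] .
  have nbU: "no_balanced_simplex T m U v r" "no_balanced_simplex T m U v' r'"
    using nb nb' U(2) by (simp_all add: no_balanced_simplex_def)
  show thesis
  proof (rule that [of \<phi>])
    show "weight_family T m \<phi>" by (rule partition_of_unity_weight_family [OF \<phi>])
    show "(\<Sum>i = 1..m. \<phi> i x) = 1" if "x \<in> topspace T" for x
      using \<phi> that by (simp add: partition_of_unity_def)
    show "origin_free (\<lambda>i. v i - r) (weight_support m \<phi> x)" if "x \<in> topspace T" for x
      using origin_free_subset [OF no_balanced_simplex_origin_free [OF nbU(1) that] partition_of_unity_support [OF \<phi> that]] .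
    show "cover_class T m F v r = homotopy_class T unit_sphere (cover_map m \<phi> v r)"
      "cover_class T m F v' r' = homotopy_class T unit_sphere (cover_map m \<phi> v' r')"
      using cl open_cover_class_eq [OF nbU(1) \<phi>] open_cover_class_eq [OF nbU(2) \<phi>] by auto
  qed
qed

lemma BS_equivalent_origin_free:
  assumes "BS_equivalent m v r v' r'" "\<sigma> \<subseteq> {1..m}"
  shows "origin_free (\<lambda>i. v i - r) \<sigma> \<longleftrightarrow> origin_free (\<lambda>i. v' i - r') \<sigma>"
proof -
  have "v ` \<sigma> \<in> BS (v ` {1..m}) r \<longleftrightarrow> v' ` \<sigma> \<in> BS (v' ` {1..m}) r'"
    using assms by (simp add: BS_equivalent_def)
  then show ?thesis using assms(2) r_balanced_iff [of r v \<sigma>] r_balanced_iff [of r' v' \<sigma>]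
    by (simp add: BS_def image_mono)
qed

text \<open>
  The reflection \<open>\<rho>\<close> is an involution and sends the generator \<open>s\<close> to its inverse, so the image of the fundamental class
  under \<open>g\<close> is the \<open>k\<close>-th power of \<open>s\<close> iff its image under \<open>g'\<close> is the \<open>- k\<close>-th power. If the images are not
  powers of \<open>s\<close>, both degrees are the same unspecified number.
\<close>

lemma mapping_degree_reflection:
  fixes u :: "'v::euclidean_space"
  assumes u: "norm u = 1" "sphere_degree (reflect_in u) = -1" and s: "sphere_generator s"
    and g': "continuous_map T unit_sphere g'"
    and hom: "homotopic_maps T unit_sphere g (reflect_in u \<circ> g')"
  shows "mapping_degree T \<omega> s g = mapping_degree T \<omega> s g' \<or>
         mapping_degree T \<omega> s g = - mapping_degree T \<omega> s g'"
proof -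
  define n where "n = DIM('v) - 1"
  let ?Y = "unit_sphere :: 'v topology"
  let ?H = "homology_group (int n) ?Y" and ?G = "reduced_homology_group (int n) ?Y"
  let ?\<rho> = "reflect_in u"
  let ?r = "hom_induced (int n) ?Y {} ?Y {} ?\<rho>"
  have c\<rho>: "continuous_map ?Y ?Y ?\<rho>" by (rule continuous_map_reflect_in [OF u(1)])
  obtain \<phi> :: "(nat \<Rightarrow> real) \<Rightarrow> 'v" and \<psi> where "homeomorphic_maps (nsphere (DIM('v) - 1)) ?Y \<phi> \<psi>"
    by (rule unit_sphere_nsphere_maps [where 'v = 'v], rule that)
  then have hm: "homeomorphic_maps (nsphere n) ?Y \<phi> \<psi>" by (simp only: n_def)
  interpret H: comm_group ?H by (rule abelian_homology_group)
  interpret G: group ?G by simp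
  interpret r: group_hom ?H ?H ?r
    by (auto simp: group_hom_def group_hom_axioms_def hom_induced_empty_hom)
  have sG: "s \<in> carrier ?G" "subgroup_generated ?G {s} = ?G"
    using s by (simp_all add: sphere_generator_def Let_def n_def)
  then have sH: "s \<in> carrier ?H" using carrier_reduced_homology_group_subset by blast
  have pow: "s [^]\<^bsub>?G\<^esub> (k::int) = s [^]\<^bsub>?H\<^esub> k" for k
    using sG(1) H.int_pow_subgroup_generated unfolding reduced_homology_group_def by metis
  have uniq: "s [^]\<^bsub>?H\<^esub> (k::int) = s [^]\<^bsub>?H\<^esub> l \<longleftrightarrow> k = l" for k l
    using infinite_cyclic_generator(1) [OF _ reduced_homology_homeomorphic_nsphere [OF hm] sG, of k l] by (simp add: pow)
  have rs: "?r s = s [^]\<^bsub>?H\<^esub> (-1::int)"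
    using hom_induced_homeomorphic_nsphere [OF hm c\<rho> sG(1)]
      sphere_degree_conjugate [OF hm n_def c\<rho>] u(2) pow by simp
  have rpow: "?r (s [^]\<^bsub>?H\<^esub> (k::int)) = s [^]\<^bsub>?H\<^esub> (- k)" for k
    using r.hom_int_pow [OF sH, of k] H.int_pow_pow [OF sH, of "-1" k] by (simp add: rs)
  have rr: "?r (?r y) = y" if "y \<in> carrier ?H" for y
  proof -
    have "?\<rho> \<circ> ?\<rho> = id" using reflect_in_involution [OF u(1)] by auto
    then have "?r \<circ> ?r = hom_induced (int n) ?Y {} ?Y {} id"
      using hom_induced_compose_empty [OF c\<rho> c\<rho>, of "int n"] by simp
    then show ?thesis using hom_induced_id [OF that] by (metis comp_apply)
  qed
  define \<mu> where "\<mu> = fundamental_class n T \<omega>"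
  define y where "y = hom_induced (int n) T {} ?Y {} g' \<mu>"
  have y: "y \<in> carrier ?H" unfolding y_def by (rule hom_induced_carrier)
  have "hom_induced (int n) T {} ?Y {} g = hom_induced (int n) T {} ?Y {} (?\<rho> \<circ> g')"
    by (rule homology_homotopy_empty [OF hom])
  then have gy: "hom_induced (int n) T {} ?Y {} g \<mu> = ?r y"
    using hom_induced_compose_empty [OF g' c\<rho>, of "int n"] by (simp add: y_def)
  have iff: "?r y = s [^]\<^bsub>?H\<^esub> k \<longleftrightarrow> y = s [^]\<^bsub>?H\<^esub> (- k)" for k :: int
    using rr [OF y] rpow [of k] rpow [of "- k"] by auto
  have deg': "mapping_degree T \<omega> s g' = (THE k. y = s [^]\<^bsub>?H\<^esub> k)"
    by (simp only: mapping_degree_def Let_def n_def y_def \<mu>_def)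
  have deg: "mapping_degree T \<omega> s g = (THE k. y = s [^]\<^bsub>?H\<^esub> (- k))"
    using gy by (simp only: mapping_degree_def Let_def iff flip: n_def \<mu>_def)
  show ?thesis
  proof (cases "\<exists>k::int. y = s [^]\<^bsub>?H\<^esub> k")
    case True
    then obtain k :: int where k: "y = s [^]\<^bsub>?H\<^esub> k" by blast
    have "mapping_degree T \<omega> s g' = k" unfolding deg' k uniq by simp
    moreover have "mapping_degree T \<omega> s g = - k" unfolding deg k uniq by (rule the_equality) auto
    ultimately show ?thesis by simp
  next
    case False
    then show ?thesis unfolding deg deg' by simp
  qed
qed

theorem theorem4p2:
  fixes T :: "'a topology"
    and m :: nat
    and v v' :: "nat \<Rightarrow> 'v::euclidean_space"
    and r r' :: 'v
    and F :: "nat \<Rightarrow> 'a set"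
  assumes "BS_equivalent m v r v' r'"
    and "Hausdorff_space T"
    and "paracompact_space T"
    and "open_cover T m F \<or> closed_cover T m F"
    and "no_balanced_simplex T m F v r"
  shows "(\<forall>f. homotopy_equivalence_map unit_sphere unit_sphere f \<and> sphere_degree f = -1 \<longrightarrow>
            cover_class T m F v r = cover_class T m F v' r' \<or>
            cover_class T m F v r = inv_class T f (cover_class T m F v' r')) \<and>
         (null_class T (cover_class T m F v r) \<longleftrightarrow> null_class T (cover_class T m F v' r')) \<and>
         (\<forall>\<omega> s. closed_manifold (DIM('v) - 1) T \<and> orientation (DIM('v) - 1) T \<omega> \<and>
            sphere_generator (s :: 'v chain set) \<longrightarrow>
            cover_degree T \<omega> s m F v r = cover_degree T \<omega> s m F v' r' \<or>
            cover_degree T \<omega> s m F v r = - cover_degree T \<omega> s m F v' r')"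
proof -
  let ?C = "cover_class T m F v r" and ?C' = "cover_class T m F v' r'"
  let ?a = "\<lambda>i. v i - r" and ?a' = "\<lambda>i. v' i - r'"
  have N: "normal_space T" by (rule paracompact_Hausdorff_imp_normal [OF assms(3,2)])
  have equiv: "origin_free ?a \<sigma> \<longleftrightarrow> origin_free ?a' \<sigma>" if "\<sigma> \<subseteq> {1..m}" for \<sigma>
    by (rule BS_equivalent_origin_free [OF assms(1) that])
  have nb': "no_balanced_simplex T m F v' r'"
    unfolding no_balanced_simplex_def
  proof
    fix \<sigma> assume "\<sigma> \<in> nerve T m F"
    then have "\<sigma> \<subseteq> {1..m}" "origin_free ?a \<sigma>"
      using assms(5) by (auto simp: nerve_def no_balanced_simplex_def r_balanced_iff)
    then show "\<not> r_balanced r' (v' ` \<sigma>)" using equiv by (simp add: r_balanced_iff)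
  qed
  obtain \<phi> where \<phi>: "weight_family T m \<phi>" "\<And>x. x \<in> topspace T \<Longrightarrow> (\<Sum>i = 1..m. \<phi> i x) = 1"
    and free: "\<And>x. x \<in> topspace T \<Longrightarrow> origin_free ?a (weight_support m \<phi> x)"
    and C: "?C = homotopy_class T unit_sphere (cover_map m \<phi> v r)"
    and C': "?C' = homotopy_class T unit_sphere (cover_map m \<phi> v' r')"
    using cover_class_representative [OF N assms(4,5) nb'] by blast
  obtain u :: 'v where u: "norm u = 1" "sphere_degree (reflect_in u) = -1"
    using sphere_degree_reflection by blast
  let ?\<rho> = "reflect_in u"
  have c\<rho>: "continuous_map unit_sphere unit_sphere ?\<rho>" by (rule continuous_map_reflect_in [OF u(1)])
  have \<rho>\<rho>: "?\<rho> \<circ> ?\<rho> = id" using reflect_in_involution [OF u(1)] by auto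
  let ?g = "cover_map m \<phi> v r" and ?g' = "cover_map m \<phi> v' r'"
  let ?s = "\<lambda>x. sgn (weighted_sum m ?a \<phi> x)" and ?s' = "\<lambda>x. sgn (weighted_sum m ?a' \<phi> x)"
  have eq: "?g x = ?s x" if "x \<in> topspace T" for x
    by (rule cover_map_eq_sgn [of \<phi> x m v r, OF \<phi>(2) [OF that]])
  have eq': "?g' x = ?s' x" if "x \<in> topspace T" for x
    by (rule cover_map_eq_sgn [of \<phi> x m v' r', OF \<phi>(2) [OF that]])
  have "homotopic_maps T unit_sphere ?s ?s' \<or> homotopic_maps T unit_sphere ?s (?\<rho> \<circ> ?s')"
    by (rule sphere_maps_equal_up_to_reflection [OF equiv \<phi>(1) free u])
  then have dich: "homotopic_maps T unit_sphere ?g ?g' \<or> homotopic_maps T unit_sphere ?g (?\<rho> \<circ> ?g')"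
  proof
    assume "homotopic_maps T unit_sphere ?s ?s'"
    then have "homotopic_maps T unit_sphere ?g ?g'"
      by (rule homotopic_with_eq) (simp_all add: eq eq')
    then show ?thesis ..
  next
    assume "homotopic_maps T unit_sphere ?s (?\<rho> \<circ> ?s')"
    then have "homotopic_maps T unit_sphere ?g (?\<rho> \<circ> ?g')"
      by (rule homotopic_with_eq) (simp_all add: eq eq')
    then show ?thesis ..
  qed
  then have g: "continuous_map T unit_sphere ?g" using homotopic_with_imp_continuous_maps by blast
  have g': "continuous_map T unit_sphere ?g'"
    using dich
  proof
    assume "homotopic_maps T unit_sphere ?g (?\<rho> \<circ> ?g')"
    then have "continuous_map T unit_sphere (?\<rho> \<circ> ?g')" using homotopic_with_imp_continuous_maps by blast
    from continuous_map_compose [OF this c\<rho>] show ?thesis by (simp add: o_assoc \<rho>\<rho>)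
  qed (use homotopic_with_imp_continuous_maps in blast)

  have classes: "?C = ?C' \<or> ?C = inv_class T f ?C'"
    if f: "homotopy_equivalence_map unit_sphere unit_sphere f" "sphere_degree f = -1" for f
    using dich
  proof
    assume "homotopic_maps T unit_sphere ?g ?g'"
    then show ?thesis using homotopy_class_eq_iff [OF g] C C' by blast
  next
    assume h: "homotopic_maps T unit_sphere ?g (?\<rho> \<circ> ?g')"
    have cf: "continuous_map unit_sphere unit_sphere f" using f(1) by (simp add: homotopy_equivalence_map_def)
    have "homotopic_maps unit_sphere unit_sphere (?\<rho> \<circ> ?\<rho>) id" by (simp add: \<rho>\<rho>)
    moreover have "\<not> homotopic_maps unit_sphere unit_sphere ?\<rho> id"
      using sphere_degree_homotopic [of ?\<rho> id] u(2) sphere_degree_id [where 'v = 'v] by auto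
    ultimately have "homotopic_maps unit_sphere unit_sphere ?\<rho> f"
      using homotopy_equivalence_homotopic_id_or_reversing [OF c\<rho> c\<rho> _ f] by blast
    then have "homotopic_maps T unit_sphere (?\<rho> \<circ> ?g') (f \<circ> ?g')"
      by (rule homotopic_with_compose_continuous_map_right [OF _ g']) auto
    with h have "homotopic_maps T unit_sphere ?g (f \<circ> ?g')" by (rule homotopic_with_trans)
    then show ?thesis
      using homotopy_class_eq_iff [OF g] inv_class_homotopy_class [OF cf g'] C C' by simp
  qed

  have null_iff: "null_class T (homotopy_class T unit_sphere h) \<longleftrightarrow>
      (\<exists>c \<in> topspace unit_sphere. homotopic_maps T unit_sphere h (\<lambda>_. c))"
    if "continuous_map T unit_sphere h" for h :: "'a \<Rightarrow> 'v"
    unfolding null_class_def using homotopy_class_eq_iff [OF that] by blast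
  have null_\<rho>: "\<exists>c \<in> topspace unit_sphere. homotopic_maps T unit_sphere (?\<rho> \<circ> h) (\<lambda>_. c)"
    if "c \<in> topspace unit_sphere" "homotopic_maps T unit_sphere h (\<lambda>_. c)" for h :: "'a \<Rightarrow> 'v" and c
  proof -
    have "homotopic_maps T unit_sphere (?\<rho> \<circ> h) (?\<rho> \<circ> (\<lambda>_. c))"
      by (rule homotopic_with_compose_continuous_map_left [OF that(2) c\<rho>]) auto
    moreover have "?\<rho> c \<in> topspace unit_sphere" using c\<rho> that(1) by (auto simp: continuous_map_def)
    ultimately show ?thesis by (auto simp: o_def)
  qed
  have null: "null_class T ?C \<longleftrightarrow> null_class T ?C'"
    unfolding C C' null_iff [OF g] null_iff [OF g']
    using dich
  proof
    assume h: "homotopic_maps T unit_sphere ?g ?g'"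
    show "(\<exists>c\<in>topspace unit_sphere. homotopic_maps T unit_sphere ?g (\<lambda>_. c)) \<longleftrightarrow>
          (\<exists>c\<in>topspace unit_sphere. homotopic_maps T unit_sphere ?g' (\<lambda>_. c))"
      using h homotopic_with_trans homotopic_with_sym by meson
  next
    assume h: "homotopic_maps T unit_sphere ?g (?\<rho> \<circ> ?g')"
    have "homotopic_maps T unit_sphere (?\<rho> \<circ> ?g) (?\<rho> \<circ> (?\<rho> \<circ> ?g'))"
      by (rule homotopic_with_compose_continuous_map_left [OF h c\<rho>]) auto
    then have h': "homotopic_maps T unit_sphere ?g' (?\<rho> \<circ> ?g)"
      by (simp add: o_assoc \<rho>\<rho> homotopic_with_sym)
    show "(\<exists>c\<in>topspace unit_sphere. homotopic_maps T unit_sphere ?g (\<lambda>_. c)) \<longleftrightarrow>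
          (\<exists>c\<in>topspace unit_sphere. homotopic_maps T unit_sphere ?g' (\<lambda>_. c))"
      using null_\<rho> homotopic_with_trans [OF h] homotopic_with_trans [OF h'] by meson
  qed

  have degree: "cover_degree T \<omega> s m F v r = cover_degree T \<omega> s m F v' r' \<or>
            cover_degree T \<omega> s m F v r = - cover_degree T \<omega> s m F v' r'"
    if s: "sphere_generator (s :: 'v chain set)" for \<omega> s
  proof -
    define G where "G = (SOME g. g \<in> ?C)"
    define G' where "G' = (SOME g. g \<in> ?C')"
    have "?g \<in> ?C" unfolding C using g by (simp add: homotopy_class_def)
    then have "G \<in> ?C" unfolding G_def by (rule someI [of "\<lambda>g. g \<in> ?C"])
    then have G: "homotopic_maps T unit_sphere ?g G" by (simp add: C homotopy_class_def)
    have "?g' \<in> ?C'" unfolding C' using g' by (simp add: homotopy_class_def)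
    then have "G' \<in> ?C'" unfolding G'_def by (rule someI [of "\<lambda>g. g \<in> ?C'"])
    then have G': "homotopic_maps T unit_sphere ?g' G'" by (simp add: C' homotopy_class_def)
    show ?thesis
      using dich
    proof
      assume "homotopic_maps T unit_sphere ?g ?g'"
      then have "?C = ?C'" using homotopy_class_eq_iff [OF g] C C' by blast
      then show ?thesis by (simp add: cover_degree_def)
    next
      assume h: "homotopic_maps T unit_sphere ?g (?\<rho> \<circ> ?g')"
      have "homotopic_maps T unit_sphere (?\<rho> \<circ> ?g') (?\<rho> \<circ> G')"
        by (rule homotopic_with_compose_continuous_map_left [OF G' c\<rho>]) auto
      then have "homotopic_maps T unit_sphere G (?\<rho> \<circ> G')"
        using h G homotopic_with_trans homotopic_with_sym by meson
      moreover have "continuous_map T unit_sphere G'" using G' homotopic_with_imp_continuous_maps by blast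
      ultimately show ?thesis
        unfolding cover_degree_def G_def [symmetric] G'_def [symmetric]
        using mapping_degree_reflection [OF u s] by blast
    qed
  qed
  show ?thesis using classes null degree by blast
qed

end
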